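(* Fix $0\le\eta_2<\eta_1\le1$ and $\varepsilon>0$. There is a sequence $(\mathcal{A}_N)_{N\ge1}$ of algorithms, $\mathcal{A}_N$ an $N$-sample algorithm (depending only on $N,\eta_1,\eta_2,\varepsilon$), such that for any sequence $(\mu_N)_{N\ge1}$ of reservoir distributions, setting \[ \alpha_N=\frac{1}{\eta_1-\eta_2}\int_{1-\eta_1}^{1-\eta_2}G_{\mu_N}^{-1}(x)\,dx \] and letting $a_{i^*}$ be the output of $\mathcal{A}_N$ run on $\mu_N$, we have \[ \limsup_{N\to\infty}\frac{\big(-\log\mathbb{P}[p_{i^*}<\alpha_N-\varepsilon]\big)\cdot\log^2N}{c_{\alpha_N,\alpha_N-\varepsilon}\,N}\ \ge\ 1 . \]
   Context: Infinite-armed Bernoulli bandit: a reservoir distribution $\mu$ is any Borel probability measure on $[0,1]$. There are countably many arms $a_1,a_2,\dots$ whose means $p_1,p_2,\dots$ are drawn i.i.d. from $\mu$ (unknown to the algorithm). Each time arm $a_i$ is sampled it returns a reward in $\{0,1\}$ distributed as Bernoulli$(p_i)$, independently of all other rewards given the means. An algorithm, at each step, chooses (based on previously observed rewards and possibly internal randomness) an arm to sample, and at the end outputs an arm index $i^*$. An $N$-sample algorithm takes exactly $N$ samples almost surely and then outputs $i^*$. $G_\mu(\tau)=\mu([0,\tau])$, $G_\mu^{-1}(p)=\inf\{\tau:G_\mu(\tau)\ge p\}$. For $a,b\in[0,1]$, $c_{a,b}=\frac{(\arccos(1-2a)-\arccos(1-2b))^2}{2}$. *)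

theory Defs
  imports "HOL-Probability.Probability"
begin

definition reservoir :: "real measure \<Rightarrow> bool" where
  "reservoir \<mu> \<longleftrightarrow> prob_space \<mu> \<and> sets \<mu> = sets borel \<and> measure \<mu> {0..1} = 1"

definition G :: "real measure \<Rightarrow> real \<Rightarrow> real" where
  "G \<mu> \<tau> = measure \<mu> {..\<tau>}"

text \<open>Generalised inverse; tau ranges over [0,1] (the support), so that Ginv mu 0 = 0.\<close>
definition Ginv :: "real measure \<Rightarrow> real \<Rightarrow> real" where
  "Ginv \<mu> q = Inf {\<tau> \<in> {0..1}. G \<mu> \<tau> \<ge> q}"

definition cab :: "real \<Rightarrow> real \<Rightarrow> real" where
  "cab a b = (arccos (1 - 2*a) - arccos (1 - 2*b))^2 / 2"

text \<open>A history is the list of (arm index, reward) pairs observed so far.\<close>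
type_synonym hist = "(nat \<times> bool) list"

text \<open>An algorithm: a (randomised) arm-selection rule depending on the history, and a
  (randomised) output rule depending on the final history.\<close>
type_synonym algo = "(hist \<Rightarrow> nat pmf) \<times> (hist \<Rightarrow> nat pmf)"

fun run_hist :: "(hist \<Rightarrow> nat pmf) \<Rightarrow> (nat \<Rightarrow> real) \<Rightarrow> nat \<Rightarrow> hist pmf" where
  "run_hist \<pi> p 0 = return_pmf []"
| "run_hist \<pi> p (Suc n) =
     run_hist \<pi> p n \<bind> (\<lambda>h. \<pi> h \<bind> (\<lambda>a. map_pmf (\<lambda>r. h @ [(a, r)]) (bernoulli_pmf (p a))))"

definition output_dist :: "algo \<Rightarrow> (nat \<Rightarrow> real) \<Rightarrow> nat \<Rightarrow> nat pmf" where
  "output_dist A p N = run_hist (fst A) p N \<bind> snd A"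

definition fail_prob :: "algo \<Rightarrow> real measure \<Rightarrow> nat \<Rightarrow> real \<Rightarrow> real" where
  "fail_prob A \<mu> N thr =
     enn2real (\<integral>\<^sup>+ p. ennreal (measure_pmf.prob (output_dist A p N) {i. p i < thr})
                 \<partial>(PiM UNIV (\<lambda>_::nat. \<mu>)))"

definition alpha :: "real measure \<Rightarrow> real \<Rightarrow> real \<Rightarrow> real" where
  "alpha \<mu> \<eta>1 \<eta>2 = integral {1 - \<eta>1 .. 1 - \<eta>2} (Ginv \<mu>) / (\<eta>1 - \<eta>2)"

definition rate_term :: "real \<Rightarrow> real \<Rightarrow> real \<Rightarrow> nat \<Rightarrow> ereal" where
  "rate_term P a b N =
     (if P = 0 then \<infinity> else ereal ((- ln P) * (ln (real N))^2 / (cab a b * real N)))"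

end

theory Submission
  imports Defs "HOL-Real_Asymp.Real_Asymp"
begin

text \<open>
A vanishing fraction of the budget is spent on estimating the reservoir's distribution function from
many arms with boundedly many pulls each; up to an error probability exponentially small in \<open>N\<close>, this
reveals the level \<open>\<alpha>\<close> to any fixed accuracy. Afterwards fresh arms are examined one at a time: an arm
with \<open>t\<close> pulls is dropped as soon as its empirical mean falls below a threshold which, in the variance
stabilising coordinate \<open>\<theta> = arccos (1 - 2 p)\<close>, decreases linearly in \<open>ln t\<close> from slightly below \<open>\<alpha>\<close> to
slightly above \<open>\<alpha> - \<epsilon>\<close>, that is with slope \<open>\<Delta> / ln N\<close> where \<open>\<Delta>\<^sup>2 / 2 = c\<close>. An arm dropped after exactly
\<open>t\<close> pulls stayed above the curve until then, and whatever its true mean, the cheapest way of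
doing so has probability about \<open>exp (- t (\<Delta> / ln N)\<^sup>2 / 2)\<close> (tilt by \<open>ln (t / s) - 1\<close> at time \<open>s \<le> t\<close>, a
function with mean \<open>0\<close> and variance \<open>1\<close>). Thus every pull of a dropped arm costs a factor
\<open>exp (- c / (ln N)\<^sup>2)\<close>, while a bad arm that is never dropped pays even more; a renewal argument turns
this into the bound for the whole run. Since only a limes superior is claimed, the slack may be
sent to zero along a sequence of budgets.
\<close>

section \<open>The reward process of a single arm\<close>

text \<open>Write \<open>k m\<close> for the mean probability that a fresh arm is dropped after
  exactly \<open>m\<close> pulls. The renewal argument needs
  \<open>\<Sum>m. exp (\<beta> * m) * k m \<le> 1\<close>, and as all poor arms may be dropped at
  the first check, this sum can come close to 1. The room comes from the good arms: \<alpha> is an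
  average of quantiles over a slice of width \<open>\<eta>1 - \<eta>2\<close>, so a fraction of at
  least \<open>(\<eta>1 - \<eta>2) * \<delta>\<close> of all arms has mean at least \<alpha> -
  \<delta>, and such arms are rarely dropped. All later checks together must cost less than this
  fixed fraction, which shapes the schedule. That the tilt has mean 0 removes the true mean of an
  arm from the bound. Only its variance is left, and this is close to that of the threshold unless
  the mean is far from it, where crude bounds suffice. The algorithm is fixed before the reservoirs.
  Hence the bounds are proved for each arm mean separately, the estimated level is rounded to a
  finite grid, and a budget has to be large enough for finitely many stopping rules only.\<close>

definition clip :: "real \<Rightarrow> real" where
  "clip x = min 1 (max 0 x)"

lemma clip_bounds [simp]: "0 \<le> clip x" "clip x \<le> 1"
  by (auto simp: clip_def)

lemma clip_measurable [measurable]: "clip \<in> borel_measurable borel"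
  unfolding clip_def by measurable

lemma pmf_bernoulli_clip: "pmf (bernoulli_pmf x) r = (if r then clip x else 1 - clip x)"
  by (simp add: bernoulli_pmf.rep_eq clip_def)

text \<open>\<open>bernoulli_pmf\<close> truncates its parameter, so a run can be described by
  formulas in \<open>clip (p i)\<close> for every real sequence \<open>p\<close>, also where some
  \<open>p i\<close> lies outside the unit interval.\<close>

lemma bernoulli_pmf_clip: "bernoulli_pmf (clip x) = bernoulli_pmf x"
  by (rule pmf_eqI) (simp add: pmf_bernoulli_clip clip_def)

text \<open>Second-order Taylor expansion of the centred reward. The true variance
  \<open>p * (1 - p)\<close> is kept, rather than bounded by 1/4, because the sharp constant
  requires it; \<open>exp \<bar>h\<bar>\<close> bounds the remainder and tends to 1 for small
  tilts.\<close>

lemma bernoulli_mgf_le: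
  fixes p h :: real
  assumes p: "0 \<le> p" "p \<le> 1"
  shows "1 - p + p * exp h \<le> exp (p * h + p * (1 - p) * h\<^sup>2 * exp \<bar>h\<bar> / 2)"
proof -
  have taylor: "exp x \<le> 1 + x + x\<^sup>2 / 2 * exp \<bar>h\<bar>" if "\<bar>x\<bar> \<le> \<bar>h\<bar>" for x :: real
  proof -
    obtain t where t: "\<bar>t\<bar> \<le> \<bar>x\<bar>" "exp x = (\<Sum>m<2. x ^ m / fact m) + exp t / fact 2 * x ^ 2"
      using Maclaurin_exp_le by blast
    have "exp t \<le> exp \<bar>h\<bar>" using t that by simp
    then have "exp t * x\<^sup>2 / 2 \<le> exp \<bar>h\<bar> * x\<^sup>2 / 2"
      by (intro divide_right_mono mult_right_mono) auto
    then show ?thesis using t by (simp add: numeral_2_eq_2 algebra_simps)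
  qed
  have 1: "\<bar>- p * h\<bar> \<le> \<bar>h\<bar>" "\<bar>(1 - p) * h\<bar> \<le> \<bar>h\<bar>"
    using p by (auto simp: abs_mult intro!: mult_left_le_one_le)
  have "(1 - p) * exp (- p * h) + p * exp ((1 - p) * h) \<le>
        (1 - p) * (1 + - p * h + (- p * h)\<^sup>2 / 2 * exp \<bar>h\<bar>)
        + p * (1 + (1 - p) * h + ((1 - p) * h)\<^sup>2 / 2 * exp \<bar>h\<bar>)"
    using p by (intro add_mono mult_left_mono taylor 1) auto
  also have "\<dots> = 1 + p * (1 - p) * h\<^sup>2 * exp \<bar>h\<bar> / 2"
    by (simp add: field_simps power2_eq_square)
  also have "\<dots> \<le> exp (p * (1 - p) * h\<^sup>2 * exp \<bar>h\<bar> / 2)" by simp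
  finally have "exp (p * h) * ((1 - p) * exp (- p * h) + p * exp ((1 - p) * h))
      \<le> exp (p * h) * exp (p * (1 - p) * h\<^sup>2 * exp \<bar>h\<bar> / 2)"
    by (rule mult_left_mono) simp
  also have "exp (p * h) * ((1 - p) * exp (- p * h) + p * exp ((1 - p) * h)) = 1 - p + p * exp h"
    by (simp add: algebra_simps exp_add[symmetric] mult_exp_exp)
  finally show ?thesis by (simp add: mult_exp_exp)
qed

text \<open>For tail bounds in which only the order of the exponent matters: a variance of at most
  1/4 meets a remainder factor of at most 3.\<close>

lemma bernoulli_variance_exp_le:
  fixes p c :: real
  assumes p: "0 \<le> p" "p \<le> 1" and c: "\<bar>c\<bar> \<le> 1"
  shows "p * (1 - p) * exp \<bar>c\<bar> \<le> 1"
proof -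
  have "0 \<le> (p - 1/2)\<^sup>2" by simp
  then have "p * (1 - p) \<le> 1/4" by (simp add: power2_eq_square algebra_simps)
  moreover have "exp \<bar>c\<bar> \<le> 3"
  proof -
    have "exp \<bar>c\<bar> \<le> exp 1" using c by simp
    then show ?thesis using exp_le by linarith
  qed
  ultimately have "p * (1 - p) * exp \<bar>c\<bar> \<le> 1/4 * 3"
    using p by (intro mult_mono) auto
  then show ?thesis by simp
qed

text \<open>The last word is tested by \<open>\<phi>\<close> only, and \<open>w\<close> itself not
  by \<open>st\<close>: with \<open>\<phi> = st\<close> this is the law of the dropping time of an
  arm, with the negation of \<open>st\<close> its probability of survival.\<close>

fun hit_prob :: "(bool list \<Rightarrow> bool) \<Rightarrow> (bool list \<Rightarrow> bool) \<Rightarrow> real \<Rightarrow> bool list \<Rightarrow> nat \<Rightarrow> real" where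
  "hit_prob st \<phi> q w 0 = of_bool (\<phi> w)"
| "hit_prob st \<phi> q w (Suc m) =
     q * (if m > 0 \<and> st (w @ [True]) then 0 else hit_prob st \<phi> q (w @ [True]) m) +
     (1 - q) * (if m > 0 \<and> st (w @ [False]) then 0 else hit_prob st \<phi> q (w @ [False]) m)"

lemma hit_prob_bounds: "0 \<le> q \<Longrightarrow> q \<le> 1 \<Longrightarrow> 0 \<le> hit_prob st \<phi> q w m \<and> hit_prob st \<phi> q w m \<le> 1"
proof (induction m arbitrary: w)
  case (Suc m)
  have *: "0 \<le> (if m > 0 \<and> st u then 0 else hit_prob st \<phi> q u m)" "(if m > 0 \<and> st u then 0 else hit_prob st \<phi> q u m) \<le> 1" for u
    using Suc by auto
  have "q * (if m > 0 \<and> st (w @ [True]) then 0 else hit_prob st \<phi> q (w @ [True]) m) +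
     (1 - q) * (if m > 0 \<and> st (w @ [False]) then 0 else hit_prob st \<phi> q (w @ [False]) m) \<le> q * 1 + (1 - q) * 1"
    using Suc.prems by (intro add_mono mult_left_mono *) auto
  moreover have "0 \<le> q * (if m > 0 \<and> st (w @ [True]) then 0 else hit_prob st \<phi> q (w @ [True]) m) +
     (1 - q) * (if m > 0 \<and> st (w @ [False]) then 0 else hit_prob st \<phi> q (w @ [False]) m)"
    using Suc.prems by (intro add_nonneg_nonneg mult_nonneg_nonneg *) auto
  ultimately show ?case by simp
qed auto

lemma hit_prob_measurable [measurable]:
  assumes [measurable]: "f \<in> borel_measurable M"
  shows "(\<lambda>x. hit_prob st \<phi> (f x) w m) \<in> borel_measurable M"
proof (induction m arbitrary: w)
  case (Suc m)
  note [measurable] = Suc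
  show ?case
    by (cases "m > 0 \<and> st (w @ [True])"; cases "m > 0 \<and> st (w @ [False])") simp_all
qed simp

text \<open>The output is the arm in use when the budget ends, so failure is decided by the current
  \<open>i\<close> alone. The recursion over rewards yields an explicit measurable function of the
  means.\<close>

fun search_fail :: "(bool list \<Rightarrow> bool) \<Rightarrow> real \<Rightarrow> (nat \<Rightarrow> real) \<Rightarrow> nat \<Rightarrow> bool list \<Rightarrow> nat \<Rightarrow> real" where
  "search_fail st b p i w 0 = of_bool (p i < b)"
| "search_fail st b p i w (Suc n) =
     clip (p i) * (if st (w @ [True]) then search_fail st b p (Suc i) [] n else search_fail st b p i (w @ [True]) n) +
     (1 - clip (p i)) * (if st (w @ [False]) then search_fail st b p (Suc i) [] n else search_fail st b p i (w @ [False]) n)"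

lemma search_fail_bounds: "0 \<le> search_fail st b p i w n \<and> search_fail st b p i w n \<le> 1"
proof (induction n arbitrary: i w)
  case (Suc n)
  let ?g = "\<lambda>u. (if st u then search_fail st b p (Suc i) [] n else search_fail st b p i u n)"
  have *: "0 \<le> ?g u" "?g u \<le> 1" for u
    using Suc by auto
  have "clip (p i) * ?g (w @ [True]) + (1 - clip (p i)) * ?g (w @ [False]) \<le> clip (p i) * 1 + (1 - clip (p i)) * 1"
    by (intro add_mono mult_left_mono *) auto
  moreover have "0 \<le> clip (p i) * ?g (w @ [True]) + (1 - clip (p i)) * ?g (w @ [False])"
    by (intro add_nonneg_nonneg mult_nonneg_nonneg *) auto
  ultimately show ?case by simp
qed auto

lemma search_fail_measurable [measurable]:
  assumes "sets \<mu> = sets borel"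
  shows "(\<lambda>p. search_fail st b p i w n) \<in> borel_measurable (PiM UNIV (\<lambda>_. \<mu>))"
proof -
  have [measurable]: "(\<lambda>p. p i) \<in> borel_measurable (PiM UNIV (\<lambda>_. \<mu>))" for i :: nat
    using measurable_component_singleton[of i UNIV "\<lambda>_. \<mu>"]
    by (simp add: measurable_cong_sets[OF refl assms])
  show ?thesis
  proof (induction n arbitrary: i w)
    case 0 then show ?case by simp
  next
    case (Suc n)
    note [measurable] = Suc
    show ?case by (cases "st (w @ [True])"; cases "st (w @ [False])") simp_all
  qed
qed

text \<open>Renewal decomposition at the first time the current arm is abandoned.\<close>
lemma search_fail_decomp:
  assumes "\<not> st w"
  shows "search_fail st b p i w n =
    (\<Sum>m=1..n. hit_prob st st (clip (p i)) w m * search_fail st b p (Suc i) [] (n - m))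
    + hit_prob st (\<lambda>u. \<not> st u) (clip (p i)) w n * of_bool (p i < b)"
  using assms
proof (induction n arbitrary: w)
  case (Suc n)
  let ?q = "clip (p i)" and ?b = "of_bool (p i < b) :: real"
  let ?W = "\<lambda>m. search_fail st b p (Suc i) [] m"
  let ?g = "\<lambda>u. (if st u then ?W n else search_fail st b p i u n)"
  let ?k = "\<lambda>u m. (if m > 0 \<and> st u then 0 else hit_prob st st ?q u m)"
  let ?l = "\<lambda>u m. (if m > 0 \<and> st u then 0 else hit_prob st (\<lambda>u. \<not> st u) ?q u m)"
  \<comment> \<open>The term \<open>m = 0\<close> is the case in which the new reward itself
    triggers \<open>st\<close>; after the shift by one it is dropping at time 1.\<close>
  have step: "?g u = (\<Sum>m=0..n. ?k u m * ?W (n - m)) + ?l u n * ?b" for u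
  proof (cases "st u")
    case True
    have "(\<Sum>m=0..n. ?k u m * ?W (n - m)) = (\<Sum>m=0..n. if m = 0 then ?W n else 0)"
      using True by (intro sum.cong) auto
    then show ?thesis using True by (cases n) auto
  next
    case False
    have "(\<Sum>m=0..n. ?k u m * ?W (n - m)) = (\<Sum>m=1..n. hit_prob st st ?q u m * ?W (n - m))"
      using False by (simp add: sum.atLeast_Suc_atMost)
    then show ?thesis using False Suc.IH[OF False] by simp
  qed
  have "(\<Sum>m=1..Suc n. hit_prob st st ?q w m * ?W (Suc n - m)) = (\<Sum>m=0..n. hit_prob st st ?q w (Suc m) * ?W (n - m))"
    by (simp only: One_nat_def sum.atLeast_Suc_atMost_Suc_shift o_def diff_Suc_Suc)
  also have "\<dots> = ?q * (\<Sum>m=0..n. ?k (w @ [True]) m * ?W (n - m)) + (1 - ?q) * (\<Sum>m=0..n. ?k (w @ [False]) m * ?W (n - m))"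
    by (simp add: sum_distrib_left sum.distrib[symmetric] algebra_simps)
  finally have A: "(\<Sum>m=1..Suc n. hit_prob st st ?q w m * ?W (Suc n - m)) = \<dots>" .
  have "search_fail st b p i w (Suc n) = ?q * ?g (w @ [True]) + (1 - ?q) * ?g (w @ [False])" by simp
  also have "\<dots> = (\<Sum>m=1..Suc n. hit_prob st st ?q w m * ?W (Suc n - m)) + hit_prob st (\<lambda>u. \<not> st u) ?q w (Suc n) * ?b"
    unfolding step A hit_prob.simps(2) by (simp only: algebra_simps)
  finally show ?case .
qed simp

definition first_hit :: "(bool list \<Rightarrow> bool) \<Rightarrow> (bool list \<Rightarrow> bool) \<Rightarrow> nat \<Rightarrow> bool list \<Rightarrow> bool" where
  "first_hit st \<phi> M u \<longleftrightarrow> length u = M \<and> \<phi> u \<and> (\<forall>j. 0 < j \<and> j < M \<longrightarrow> \<not> st (take j u))"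

text \<open>Exponential Markov inequality by backward induction: the accumulated tilt times the
  exponential moments of the rewards still to come is a martingale, it dominates the indicator of
  \<open>\<phi>\<close> at the end, and branches cut by \<open>st\<close> only help.\<close>

lemma hit_prob_chernoff_aux:
  assumes q: "0 \<le> q" "q \<le> 1"
    and z: "\<And>u. first_hit st \<phi> M u \<Longrightarrow> z \<le> (\<Sum>t<M. h t * of_bool (u ! t))"
  shows "length w + m = M \<Longrightarrow> (\<And>j. 0 < j \<Longrightarrow> j \<le> length w \<Longrightarrow> j < M \<Longrightarrow> \<not> st (take j w)) \<Longrightarrow>
     hit_prob st \<phi> q w m \<le> exp ((\<Sum>t<length w. h t * of_bool (w ! t)) - z) * (\<Prod>t=length w..<M. 1 - q + q * exp (h t))"
proof (induction m arbitrary: w)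
  case 0
  then have "\<phi> w \<Longrightarrow> z \<le> (\<Sum>t<M. h t * of_bool (w ! t))" by (intro z) (auto simp: first_hit_def)
  with 0 show ?case by (cases "\<phi> w") auto
next
  case (Suc m)
  let ?E = "\<lambda>u. exp ((\<Sum>t<length u. h t * of_bool (u ! t)) - z)"
  let ?n = "length w"
  let ?P = "\<Prod>t=Suc ?n..<M. 1 - q + q * exp (h t)"
  have Ppos: "0 \<le> ?P" using q by (intro prod_nonneg) auto
  have *: "(if m > 0 \<and> st (w @ [r]) then 0 else hit_prob st \<phi> q (w @ [r]) m) \<le> ?E (w @ [r]) * ?P" for r
  proof (cases "m > 0 \<and> st (w @ [r])")
    case True then show ?thesis using Ppos by simp
  next
    case False
    have "hit_prob st \<phi> q (w @ [r]) m \<le> ?E (w @ [r]) * (\<Prod>t=length (w @ [r])..<M. 1 - q + q * exp (h t))"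
    proof (rule Suc.IH)
      fix j assume j: "0 < j" "j \<le> length (w @ [r])" "j < M"
      show "\<not> st (take j (w @ [r]))"
      proof (cases "j \<le> ?n")
        case True then show ?thesis using Suc.prems(2)[of j] j by simp
      next
        case False': False
        then have "j = Suc ?n" using j by simp
        then show ?thesis using False j Suc.prems(1) by simp
      qed
    qed (use Suc.prems in simp)
    then show ?thesis unfolding if_not_P[OF False] by (simp only: length_append_singleton)
  qed
  have E: "?E (w @ [r]) = ?E w * (if r then exp (h ?n) else 1)" for r
    by (simp add: nth_append exp_diff exp_add)
  have "hit_prob st \<phi> q w (Suc m) \<le> q * (?E (w @ [True]) * ?P) + (1 - q) * (?E (w @ [False]) * ?P)"
    unfolding hit_prob.simps using q by (intro add_mono mult_left_mono *) auto
  also have "\<dots> = ?E w * ((1 - q + q * exp (h ?n)) * ?P)"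
    unfolding E by (simp add: algebra_simps)
  also have "(1 - q + q * exp (h ?n)) * ?P = (\<Prod>t=?n..<M. 1 - q + q * exp (h t))"
    using Suc.prems(1) by (simp add: prod.atLeast_Suc_lessThan)
  finally show ?case .
qed

definition successes :: "nat \<Rightarrow> bool list \<Rightarrow> real" where
  "successes j u = (\<Sum>t<j. of_bool (u ! t))"

lemma successes_take: "j \<le> i \<Longrightarrow> successes j (take i u) = successes j u"
  unfolding successes_def by (rule sum.cong) auto

text \<open>The exponential moment is tilted by the linear statistic \<open>\<Sum>j\<in>I. c j * successes (Ms j)\<close>.\<close>
lemma hit_prob_chernoff:
  fixes c :: "'i \<Rightarrow> real"
  assumes q: "0 \<le> q" "q \<le> 1" and I: "finite I" "\<And>j. j \<in> I \<Longrightarrow> Ms j \<le> M"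
    and H: "(\<Sum>j\<in>I. \<bar>c j\<bar>) \<le> H"
    and z: "\<And>u. first_hit st \<phi> M u \<Longrightarrow> z \<le> (\<Sum>j\<in>I. c j * successes (Ms j) u)"
  shows "hit_prob st \<phi> q [] M \<le> exp (- z + q * (\<Sum>j\<in>I. c j * real (Ms j))
      + q * (1 - q) * exp H / 2 * (\<Sum>i\<in>I. \<Sum>j\<in>I. c i * c j * real (min (Ms i) (Ms j))))"
proof -
  define h where "h t = (\<Sum>j\<in>I. c j * of_bool (t < Ms j))" for t
  have ind: "(\<Sum>t<M. of_bool (t < m) * f t) = (\<Sum>t<m. f t)" if "m \<le> M" for m and f :: "nat \<Rightarrow> real"
  proof -
    have "(\<Sum>t<M. of_bool (t < m) * f t) = (\<Sum>t\<in>{..<m}. of_bool (t < m) * f t)"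
      using that by (intro sum.mono_neutral_right) auto
    then show ?thesis by simp
  qed
  have lin: "(\<Sum>t<M. h t * f t) = (\<Sum>j\<in>I. c j * (\<Sum>t<Ms j. f t))" for f :: "nat \<Rightarrow> real"
  proof -
    have "(\<Sum>t<M. h t * f t) = (\<Sum>j\<in>I. \<Sum>t<M. c j * (of_bool (t < Ms j) * f t))"
      unfolding h_def sum_distrib_right by (subst sum.swap) (simp add: mult.assoc)
    also have "\<dots> = (\<Sum>j\<in>I. c j * (\<Sum>t<Ms j. f t))"
      using I by (intro sum.cong refl) (simp only: sum_distrib_left[symmetric] ind)
    finally show ?thesis .
  qed
  have quad: "(\<Sum>t<M. h t * h t) = (\<Sum>i\<in>I. \<Sum>j\<in>I. c i * c j * real (min (Ms i) (Ms j)))"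
  proof -
    have "(\<Sum>t<Ms i. h t) = (\<Sum>j\<in>I. c j * real (min (Ms i) (Ms j)))" for i
    proof -
      have "(\<Sum>t<Ms i. of_bool (t < Ms j)) = real (min (Ms i) (Ms j))" for j
      proof -
        have "{..<Ms i} \<inter> {t. t < Ms j} = {..<min (Ms i) (Ms j)}" by auto
        then show ?thesis by (simp add: of_bool_def sum.If_cases)
      qed
      then show ?thesis unfolding h_def
        by (subst sum.swap) (simp add: sum_distrib_left[symmetric])
    qed
    then show ?thesis by (simp add: lin sum_distrib_left mult.assoc)
  qed
  have hH: "\<bar>h t\<bar> \<le> H" for t
  proof -
    have "\<bar>h t\<bar> \<le> (\<Sum>j\<in>I. \<bar>c j * of_bool (t < Ms j)\<bar>)" unfolding h_def by (rule sum_abs)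
    also have "\<dots> \<le> (\<Sum>j\<in>I. \<bar>c j\<bar>)" by (intro sum_mono) auto
    finally show ?thesis using H by simp
  qed
  have "hit_prob st \<phi> q [] M \<le> exp ((\<Sum>t<length ([]::bool list). h t * of_bool ([] ! t)) - z) * (\<Prod>t=length ([]::bool list)..<M. 1 - q + q * exp (h t))"
  proof (rule hit_prob_chernoff_aux[OF q])
    fix u :: "bool list" assume "first_hit st \<phi> M u"
    from z[OF this] show "z \<le> (\<Sum>t<M. h t * of_bool (u ! t))" by (simp add: lin successes_def)
  qed auto
  also have "\<dots> = exp (- z) * (\<Prod>t<M. 1 - q + q * exp (h t))"
    by (simp add: atLeast0LessThan)
  finally have fin: "hit_prob st \<phi> q [] M \<le> exp (- z) * (\<Prod>t<M. 1 - q + q * exp (h t))" .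
  have "(\<Prod>t<M. 1 - q + q * exp (h t)) \<le> (\<Prod>t<M. exp (q * h t + q * (1 - q) * exp H / 2 * (h t * h t)))"
  proof (intro prod_mono conjI)
    fix t
    show "0 \<le> 1 - q + q * exp (h t)" using q by simp
    have "q * (1 - q) * (h t)\<^sup>2 * exp \<bar>h t\<bar> \<le> q * (1 - q) * (h t)\<^sup>2 * exp H"
      using q hH[of t] by (intro mult_left_mono) auto
    then have "exp (q * h t + q * (1 - q) * (h t)\<^sup>2 * exp \<bar>h t\<bar> / 2) \<le> exp (q * h t + q * (1 - q) * exp H / 2 * (h t * h t))"
      by (simp add: power2_eq_square mult_ac)
    with bernoulli_mgf_le[OF q, of "h t"]
    show "1 - q + q * exp (h t) \<le> exp (q * h t + q * (1 - q) * exp H / 2 * (h t * h t))" by linarith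
  qed
  also have "(\<Prod>t<M. exp (q * h t + q * (1 - q) * exp H / 2 * (h t * h t)))
      = exp (q * (\<Sum>t<M. h t) + q * (1 - q) * exp H / 2 * (\<Sum>t<M. h t * h t))"
    by (simp add: exp_sum[symmetric] sum.distrib sum_distrib_left)
  also have "(\<Sum>t<M. h t) = (\<Sum>j\<in>I. c j * real (Ms j))" using lin[of "\<lambda>_. 1"] by simp
  finally have "exp (- z) * (\<Prod>t<M. 1 - q + q * exp (h t)) \<le> exp (- z) * exp (q * (\<Sum>j\<in>I. c j * real (Ms j))
      + q * (1 - q) * exp H / 2 * (\<Sum>i\<in>I. \<Sum>j\<in>I. c i * c j * real (min (Ms i) (Ms j))))"
    unfolding quad by (intro mult_left_mono) simp_all
  with fin show ?thesis by (simp only: mult_exp_exp add.assoc)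
qed

text \<open>One checkpoint and a convenient rather than optimal tilt: the distance of
  \<open>q\<close> from \<open>t\<close> contributes at least \<open>c^2 * m\<close> to the
  exponent, and the variance takes back at most half of it. The sign of \<open>c\<close> selects the
  side of the tail.\<close>

lemma hit_prob_tail:
  assumes q: "0 \<le> q" "q \<le> 1" and m: "m \<le> M" and c: "\<bar>c\<bar> \<le> 1" "c * q \<le> c * t - c\<^sup>2"
    and z: "\<And>u. first_hit st \<phi> M u \<Longrightarrow> c * (real m * t) \<le> c * successes m u"
  shows "hit_prob st \<phi> q [] M \<le> exp (- (c\<^sup>2 * real m / 2))"
proof -
  have "hit_prob st \<phi> q [] M \<le> exp (- (c * (real m * t)) + q * (\<Sum>j\<in>{()}. c * real m)
    + q * (1 - q) * exp \<bar>c\<bar> / 2 * (\<Sum>i\<in>{()}. \<Sum>j\<in>{()}. c * c * real (min m m)))"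
    using z by (intro hit_prob_chernoff[OF q]) (use m in auto)
  also have "\<dots> \<le> exp (- (c\<^sup>2 * real m / 2))"
  proof -
    have "q * (1 - q) * exp \<bar>c\<bar> \<le> 1"
      using q c(1) by (rule bernoulli_variance_exp_le)
    then have "q * (1 - q) * exp \<bar>c\<bar> / 2 * (c\<^sup>2 * real m) \<le> 1/2 * (c\<^sup>2 * real m)"
      by (intro mult_right_mono) auto
    moreover have "real m * (c * q) \<le> real m * (c * t - c\<^sup>2)"
      using c by (intro mult_left_mono) auto
    then have "q * (c * real m) \<le> c * (real m * t) - c\<^sup>2 * real m"
      by (simp add: algebra_simps)
    ultimately show ?thesis by (simp add: power2_eq_square[symmetric])
  qed
  finally show ?thesis .
qed

lemma hit_prob_tail_low:
  assumes q: "0 \<le> q" "q \<le> 1" and m: "m \<le> M" and \<kappa>: "0 \<le> \<kappa>" "\<kappa> \<le> 1" "q \<le> t - \<kappa>"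
    and z: "\<And>u. first_hit st \<phi> M u \<Longrightarrow> real m * t \<le> successes m u"
  shows "hit_prob st \<phi> q [] M \<le> exp (- (\<kappa>\<^sup>2 * real m / 2))"
proof (rule hit_prob_tail[OF q m, where c = \<kappa>])
  show "\<kappa> * q \<le> \<kappa> * t - \<kappa>\<^sup>2"
    using mult_left_mono[OF \<kappa>(3) \<kappa>(1)] by (simp add: power2_eq_square algebra_simps)
qed (use \<kappa> z in \<open>auto intro!: mult_left_mono\<close>)

lemma hit_prob_tail_high:
  assumes q: "0 \<le> q" "q \<le> 1" and m: "m \<le> M" and \<kappa>: "0 \<le> \<kappa>" "\<kappa> \<le> 1" "t + \<kappa> \<le> q"
    and z: "\<And>u. first_hit st \<phi> M u \<Longrightarrow> successes m u \<le> real m * t"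
  shows "hit_prob st \<phi> q [] M \<le> exp (- (\<kappa>\<^sup>2 * real m / 2))"
proof -
  have "hit_prob st \<phi> q [] M \<le> exp (- ((- \<kappa>)\<^sup>2 * real m / 2))"
  proof (rule hit_prob_tail[OF q m])
    show "- \<kappa> * q \<le> - \<kappa> * t - (- \<kappa>)\<^sup>2"
      using mult_left_mono[OF \<kappa>(3) \<kappa>(1)] by (simp add: power2_eq_square algebra_simps)
  qed (use \<kappa> z in \<open>auto intro!: mult_left_mono\<close>)
  then show ?thesis by simp
qed

section \<open>Renewal bound for the search\<close>

lemma nn_integral_PiM_prod:
  fixes \<mu> :: "'a measure" and g :: "nat \<Rightarrow> 'a \<Rightarrow> ennreal"
  assumes \<mu>: "prob_space \<mu>" and J: "finite J"
    and g: "\<And>j. j \<in> J \<Longrightarrow> g j \<in> borel_measurable \<mu>"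
  shows "(\<integral>\<^sup>+ p. (\<Prod>j\<in>J. g j (p j)) \<partial>PiM UNIV (\<lambda>_. \<mu>)) = (\<Prod>j\<in>J. \<integral>\<^sup>+ x. g j x \<partial>\<mu>)"
proof -
  interpret P: product_prob_space "\<lambda>_::nat. \<mu>" UNIV
    by (intro product_prob_spaceI \<mu>)
  have "(\<lambda>p. \<Prod>j\<in>J. g j (p j)) \<in> borel_measurable (PiM J (\<lambda>_. \<mu>))"
    using g by (intro borel_measurable_prod_ennreal) (auto intro!: measurable_compose[OF measurable_component_singleton])
  then have "(\<integral>\<^sup>+ p. (\<Prod>j\<in>J. g j (p j)) \<partial>distr (PiM UNIV (\<lambda>_. \<mu>)) (PiM J (\<lambda>_. \<mu>)) (\<lambda>x. restrict x J)) =
      (\<integral>\<^sup>+ p. (\<Prod>j\<in>J. g j (restrict p J j)) \<partial>PiM UNIV (\<lambda>_. \<mu>))"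
    by (intro nn_integral_distr measurable_restrict_subset) auto
  then have "(\<integral>\<^sup>+ p. (\<Prod>j\<in>J. g j (p j)) \<partial>PiM J (\<lambda>_. \<mu>)) =
      (\<integral>\<^sup>+ p. (\<Prod>j\<in>J. g j (restrict p J j)) \<partial>PiM UNIV (\<lambda>_. \<mu>))"
    using P.distr_PiM_restrict_finite[OF J] by simp
  moreover have "(\<integral>\<^sup>+ p. (\<Prod>j\<in>J. g j (p j)) \<partial>PiM J (\<lambda>_. \<mu>)) = (\<Prod>j\<in>J. \<integral>\<^sup>+ x. g j x \<partial>\<mu>)"
    using g by (intro P.product_nn_integral_prod J) auto
  ultimately show ?thesis by simp
qed

text \<open>Induction on \<open>W n \<le> (\<Sum>m. k m * W (n - m)) + D * exp (- \<beta> *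
  n)\<close>: because \<open>m \<ge> 1\<close>, the factor \<open>n - m + 1\<close> is at most
  \<open>n\<close>, so the renewal condition bounds the sum by
  \<open>D * n * exp (- \<beta> * n)\<close>, and the survival term adds one more unit. The product
  over \<open>J\<close> carries the factors of arms already left, which are independent of the arms
  ahead.\<close>

lemma search_fail_integral_le:
  fixes \<mu> :: "real measure" and g :: "nat \<Rightarrow> real \<Rightarrow> ennreal"
  assumes \<mu>: "prob_space \<mu>" and s: "sets \<mu> = sets borel" and st: "\<not> st []" and D: "0 \<le> D"
    and surv: "\<And>n x. n \<le> N \<Longrightarrow> x < b \<Longrightarrow> hit_prob st (\<lambda>u. \<not> st u) (clip x) [] n \<le> D * exp (- \<beta> * real n)"
    and ren: "(\<Sum>m=1..N. ennreal (exp (\<beta> * real m)) * (\<integral>\<^sup>+ x. ennreal (hit_prob st st (clip x) [] m) \<partial>\<mu>)) \<le> 1"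
  shows "n \<le> N \<Longrightarrow> finite J \<Longrightarrow> J \<subseteq> {..<i} \<Longrightarrow> (\<And>j. j \<in> J \<Longrightarrow> g j \<in> borel_measurable \<mu>) \<Longrightarrow>
    (\<integral>\<^sup>+ p. (\<Prod>j\<in>J. g j (p j)) * ennreal (search_fail st b p i [] n) \<partial>PiM UNIV (\<lambda>_. \<mu>))
      \<le> (\<Prod>j\<in>J. \<integral>\<^sup>+ x. g j x \<partial>\<mu>) * ennreal (D * (real n + 1) * exp (- \<beta> * real n))"
proof (induction n arbitrary: i J g rule: less_induct)
  case (less n i J g)
  let ?P = "PiM UNIV (\<lambda>_::nat. \<mu>)"
  let ?G = "\<Prod>j\<in>J. \<integral>\<^sup>+ x. g j x \<partial>\<mu>"
  let ?e = "D * exp (- \<beta> * real n)"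
  let ?k = "\<lambda>m. \<integral>\<^sup>+ x. ennreal (hit_prob st st (clip x) [] m) \<partial>\<mu>"
  \<comment> \<open>Leaving arm \<open>i\<close> adds its dropping probability to the weights, so
    that the induction hypothesis applies to \<open>insert i J\<close>.\<close>
  define g' where "g' m = g(i := \<lambda>x. ennreal (hit_prob st st (clip x) [] m))" for m
  note s' = measurable_cong_sets[OF s refl, simp]
  have iJ: "i \<notin> J" using less.prems by auto
  have g'_meas: "g' m j \<in> borel_measurable \<mu>" if "j \<in> insert i J" for m j
    using that less.prems unfolding g'_def by auto
  have comp: "(\<lambda>p. f (p j)) \<in> borel_measurable ?P" if "f \<in> borel_measurable \<mu>" for f :: "real \<Rightarrow> ennreal" and j
    using that by (auto intro!: measurable_compose[OF measurable_component_singleton])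
  have [measurable]: "(\<lambda>p. \<Prod>j\<in>J. g j (p j)) \<in> borel_measurable ?P"
    using less.prems by (intro borel_measurable_prod_ennreal) (auto intro!: comp)
  have [measurable]: "(\<lambda>p. \<Prod>j\<in>insert i J. g' m j (p j)) \<in> borel_measurable ?P" for m
    using g'_meas by (intro borel_measurable_prod_ennreal) (auto intro!: comp)
  note [measurable] = search_fail_measurable[OF s]
  have pw: "(\<Prod>j\<in>J. g j (p j)) * ennreal (search_fail st b p i [] n) \<le>
      (\<Sum>m=1..n. (\<Prod>j\<in>insert i J. g' m j (p j)) * ennreal (search_fail st b p (Suc i) [] (n - m)))
      + (\<Prod>j\<in>J. g j (p j)) * ennreal ?e" for p
  proof -
    have "hit_prob st (\<lambda>u. \<not> st u) (clip (p i)) [] n * of_bool (p i < b) \<le> ?e"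
      using surv[of n "p i"] less.prems D by (cases "p i < b") auto
    then have "search_fail st b p i [] n \<le> (\<Sum>m=1..n. hit_prob st st (clip (p i)) [] m * search_fail st b p (Suc i) [] (n - m)) + ?e"
      using search_fail_decomp[of st "[]", OF st, of b p i n] by linarith
    then have "ennreal (search_fail st b p i [] n) \<le> ennreal ((\<Sum>m=1..n. hit_prob st st (clip (p i)) [] m * search_fail st b p (Suc i) [] (n - m)) + ?e)"
      by (rule ennreal_leI)
    also have "\<dots> = (\<Sum>m=1..n. ennreal (hit_prob st st (clip (p i)) [] m) * ennreal (search_fail st b p (Suc i) [] (n - m))) + ennreal ?e"
    proof -
      have nn: "0 \<le> hit_prob st st (clip (p i)) [] m" "0 \<le> search_fail st b p (Suc i) [] l" for m l
        using hit_prob_bounds[of "clip (p i)"] search_fail_bounds by auto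
      then have "0 \<le> (\<Sum>m=1..n. hit_prob st st (clip (p i)) [] m * search_fail st b p (Suc i) [] (n - m))"
        by (intro sum_nonneg mult_nonneg_nonneg)
      moreover have "ennreal (\<Sum>m=1..n. hit_prob st st (clip (p i)) [] m * search_fail st b p (Suc i) [] (n - m))
        = (\<Sum>m=1..n. ennreal (hit_prob st st (clip (p i)) [] m) * ennreal (search_fail st b p (Suc i) [] (n - m)))"
        using nn by (subst sum_ennreal[symmetric]) (simp_all only: ennreal_mult mult_nonneg_nonneg)
      ultimately show ?thesis using D by (simp add: ennreal_plus)
    qed
    finally have "(\<Prod>j\<in>J. g j (p j)) * ennreal (search_fail st b p i [] n) \<le> (\<Prod>j\<in>J. g j (p j)) * \<dots>"
      by (rule mult_left_mono) simp
    also have "\<dots> = (\<Sum>m=1..n. (\<Prod>j\<in>insert i J. g' m j (p j)) * ennreal (search_fail st b p (Suc i) [] (n - m)))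
      + (\<Prod>j\<in>J. g j (p j)) * ennreal ?e"
    proof -
      have "(\<Prod>j\<in>insert i J. g' m j (p j)) = ennreal (hit_prob st st (clip (p i)) [] m) * (\<Prod>j\<in>J. g j (p j))" for m
      proof -
        have "(\<Prod>j\<in>J. g' m j (p j)) = (\<Prod>j\<in>J. g j (p j))"
          using iJ by (intro prod.cong) (auto simp: g'_def)
        then show ?thesis using iJ less.prems by (simp add: g'_def)
      qed
      then show ?thesis by (simp add: distrib_left sum_distrib_left mult_ac)
    qed
    finally show ?thesis .
  qed
  have "(\<integral>\<^sup>+ p. (\<Prod>j\<in>J. g j (p j)) * ennreal (search_fail st b p i [] n) \<partial>?P) \<le>
      (\<integral>\<^sup>+ p. (\<Sum>m=1..n. (\<Prod>j\<in>insert i J. g' m j (p j)) * ennreal (search_fail st b p (Suc i) [] (n - m)))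
      + (\<Prod>j\<in>J. g j (p j)) * ennreal ?e \<partial>?P)"
    by (intro nn_integral_mono pw)
  also have "\<dots> = (\<Sum>m=1..n. \<integral>\<^sup>+ p. (\<Prod>j\<in>insert i J. g' m j (p j)) * ennreal (search_fail st b p (Suc i) [] (n - m)) \<partial>?P)
      + (\<integral>\<^sup>+ p. (\<Prod>j\<in>J. g j (p j)) \<partial>?P) * ennreal ?e"
    by (subst nn_integral_add) (auto simp: nn_integral_sum nn_integral_multc)
  also have "(\<integral>\<^sup>+ p. (\<Prod>j\<in>J. g j (p j)) \<partial>?P) = ?G"
    by (rule nn_integral_PiM_prod[OF \<mu>, of J g]) (use less.prems in \<open>assumption | blast\<close>)+
  also have "(\<Sum>m=1..n. \<integral>\<^sup>+ p. (\<Prod>j\<in>insert i J. g' m j (p j)) * ennreal (search_fail st b p (Suc i) [] (n - m)) \<partial>?P)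
      \<le> (\<Sum>m=1..n. ?G * ennreal (?e * real n) * (ennreal (exp (\<beta> * real m)) * ?k m))" (is "?S1 \<le> ?S2")
  proof (rule sum_mono)
    fix m assume m: "m \<in> {1..n}"
    have "(\<integral>\<^sup>+ p. (\<Prod>j\<in>insert i J. g' m j (p j)) * ennreal (search_fail st b p (Suc i) [] (n - m)) \<partial>?P)
       \<le> (\<Prod>j\<in>insert i J. \<integral>\<^sup>+ x. g' m j x \<partial>\<mu>) * ennreal (D * (real (n - m) + 1) * exp (- \<beta> * real (n - m)))"
      using m less.prems g'_meas by (intro less.IH) auto
    also have "(\<Prod>j\<in>insert i J. \<integral>\<^sup>+ x. g' m j x \<partial>\<mu>) = ?k m * ?G"
    proof -
      have "(\<Prod>j\<in>J. \<integral>\<^sup>+ x. g' m j x \<partial>\<mu>) = ?G"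
        using iJ by (intro prod.cong) (auto simp: g'_def)
      then show ?thesis using iJ less.prems by (simp add: g'_def)
    qed
    also have "?k m * ?G * ennreal (D * (real (n - m) + 1) * exp (- \<beta> * real (n - m)))
      \<le> ?k m * ?G * ennreal (?e * real n * exp (\<beta> * real m))"
    proof (intro mult_left_mono ennreal_leI)
      show "D * (real (n - m) + 1) * exp (- \<beta> * real (n - m)) \<le> ?e * real n * exp (\<beta> * real m)"
      proof -
        have "D * (real (n - m) + 1) * exp (- \<beta> * real (n - m)) = (D * exp (- \<beta> * real n) * exp (\<beta> * real m)) * (real n - real m + 1)"
          using m by (simp add: of_nat_diff algebra_simps mult_exp_exp)
        also have "\<dots> \<le> (D * exp (- \<beta> * real n) * exp (\<beta> * real m)) * real n"
          using m D by (intro mult_left_mono) auto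
        finally show ?thesis by (simp add: mult_ac)
      qed
    qed simp
    finally have le: "(\<integral>\<^sup>+ p. (\<Prod>j\<in>insert i J. g' m j (p j)) * ennreal (search_fail st b p (Suc i) [] (n - m)) \<partial>?P)
      \<le> ?k m * ?G * ennreal (?e * real n * exp (\<beta> * real m))" .
    show "(\<integral>\<^sup>+ p. (\<Prod>j\<in>insert i J. g' m j (p j)) * ennreal (search_fail st b p (Suc i) [] (n - m)) \<partial>?P)
      \<le> ?G * ennreal (?e * real n) * (ennreal (exp (\<beta> * real m)) * ?k m)"
    proof -
      have "ennreal (?e * real n * exp (\<beta> * real m)) = ennreal (?e * real n) * ennreal (exp (\<beta> * real m))"
        using D by (intro ennreal_mult) auto
      then have "?k m * ?G * ennreal (?e * real n * exp (\<beta> * real m)) = ?G * ennreal (?e * real n) * (ennreal (exp (\<beta> * real m)) * ?k m)"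
        by (simp only: mult_ac)
      with le show ?thesis by simp
    qed
  qed
  also have "(\<Sum>m=1..n. ?G * ennreal (?e * real n) * (ennreal (exp (\<beta> * real m)) * ?k m))
    = ?G * ennreal (?e * real n) * (\<Sum>m=1..n. ennreal (exp (\<beta> * real m)) * ?k m)"
    by (simp add: sum_distrib_left)
  also have "?G * ennreal (?e * real n) * (\<Sum>m=1..n. ennreal (exp (\<beta> * real m)) * ?k m) \<le> ?G * ennreal (?e * real n) * 1"
  proof (intro mult_left_mono)
    have "(\<Sum>m=1..n. ennreal (exp (\<beta> * real m)) * ?k m) \<le> (\<Sum>m=1..N. ennreal (exp (\<beta> * real m)) * ?k m)"
      using less.prems by (intro sum_mono2) auto
    with ren show "(\<Sum>m=1..n. ennreal (exp (\<beta> * real m)) * ?k m) \<le> 1" by (rule order_trans[rotated])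
  qed simp
  also have "?G * ennreal (?e * real n) * 1 + ?G * ennreal ?e = ?G * ennreal (D * (real n + 1) * exp (- \<beta> * real n))"
  proof -
    have "?e * real n + ?e = D * (real n + 1) * exp (- \<beta> * real n)" by (simp add: algebra_simps)
    moreover have "ennreal (?e * real n + ?e) = ennreal (?e * real n) + ennreal ?e"
      using D by (intro ennreal_plus) auto
    ultimately show ?thesis by (simp only: mult_1_right distrib_left)
  qed
  finally show ?case by (simp only: add_right_mono)
qed

section \<open>Two-stage algorithms\<close>

definition words :: "'a set \<Rightarrow> nat \<Rightarrow> 'a list set" where
  "words A n = {xs. set xs \<subseteq> A \<and> length xs = n}"

lemma finite_words [simp]: "finite A \<Longrightarrow> finite (words A n)"
  by (simp add: words_def finite_lists_length_eq)

lemma words_0 [simp]: "words A 0 = {[]}"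
  by (auto simp: words_def)

lemma sum_words_Suc:
  assumes "finite A"
  shows "(\<Sum>xs\<in>words A (Suc n). f xs) = (\<Sum>x\<in>A. \<Sum>xs\<in>words A n. f (x # xs))"
proof -
  have eq: "words A (Suc n) = (\<lambda>(x, xs). x # xs) ` (A \<times> words A n)"
    by (auto simp: words_def image_iff length_Suc_conv)
  have "(\<Sum>xs\<in>words A (Suc n). f xs) = (\<Sum>(x, xs)\<in>A \<times> words A n. f (x # xs))"
    unfolding eq by (subst sum.reindex) (auto simp: inj_on_def case_prod_unfold)
  then show ?thesis by (simp add: sum.cartesian_product)
qed

lemma sum_words_prod:
  fixes f :: "'a \<Rightarrow> 'b :: comm_semiring_1"
  assumes "finite A"
  shows "(\<Sum>xs\<in>words A n. \<Prod>i<n. f (xs ! i)) = (\<Sum>x\<in>A. f x) ^ n"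
proof (induction n)
  case (Suc n)
  have "(\<Sum>xs\<in>words A (Suc n). \<Prod>i<Suc n. f (xs ! i))
      = (\<Sum>x\<in>A. \<Sum>xs\<in>words A n. f x * (\<Prod>i<n. f (xs ! i)))"
    by (simp add: sum_words_Suc assms prod.lessThan_Suc_shift del: prod.lessThan_Suc)
  also have "\<dots> = (\<Sum>x\<in>A. f x) * (\<Sum>x\<in>A. f x) ^ n"
    by (simp add: sum_distrib_left[symmetric] Suc.IH sum_distrib_right)
  finally show ?case by simp
qed simp

abbreviation rewards :: "nat \<Rightarrow> bool list set" where
  "rewards m \<equiv> words UNIV m"

definition wt :: "real \<Rightarrow> bool list \<Rightarrow> real" where
  "wt q w = (\<Prod>i<length w. if w ! i then q else 1 - q)"

lemma wt_Nil [simp]: "wt q [] = 1"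
  by (simp add: wt_def)

lemma wt_Cons [simp]: "wt q (r # w) = (if r then q else 1 - q) * wt q w"
  by (simp add: wt_def prod.lessThan_Suc_shift del: prod.lessThan_Suc)

lemma wt_nonneg: "0 \<le> q \<Longrightarrow> q \<le> 1 \<Longrightarrow> 0 \<le> wt q w"
  unfolding wt_def by (intro prod_nonneg) auto

lemma wt_measurable [measurable]:
  assumes [measurable]: "f \<in> borel_measurable M"
  shows "(\<lambda>x. wt (f x) w) \<in> borel_measurable M"
proof (induction w)
  case (Cons r w)
  note [measurable] = Cons
  show ?case by (cases r) simp_all
qed simp

lemma sum_wt: "(\<Sum>w\<in>rewards m. wt q w) = 1"
  using sum_words_prod[of UNIV "\<lambda>r. if r then q else 1 - q" m]
  by (simp add: wt_def words_def UNIV_bool)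

text \<open>The output after the last reward is the arm that would be pulled next, so a single
  function \<open>arm\<close> of the rewards serves for selection and output.\<close>

fun replay_fail :: "(bool list \<Rightarrow> nat) \<Rightarrow> real \<Rightarrow> (nat \<Rightarrow> real) \<Rightarrow> bool list \<Rightarrow> nat \<Rightarrow> real" where
  "replay_fail arm b p rs 0 = of_bool (p (arm rs) < b)"
| "replay_fail arm b p rs (Suc n) =
     clip (p (arm rs)) * replay_fail arm b p (rs @ [True]) n + (1 - clip (p (arm rs))) * replay_fail arm b p (rs @ [False]) n"

lemma replay_fail_nonneg: "0 \<le> replay_fail arm b p rs n"
  by (induction n arbitrary: rs) (auto intro!: add_nonneg_nonneg mult_nonneg_nonneg)

text \<open>A deterministic rule determines the arms from the rewards, so the rewards alone,
  extracted by \<open>map snd\<close>, represent the history.\<close>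

definition policy :: "(bool list \<Rightarrow> nat) \<Rightarrow> algo" where
  "policy arm = (\<lambda>h. return_pmf (arm (map snd h)), \<lambda>h. return_pmf (arm (map snd h)))"

text \<open>\<open>run_hist\<close> has the newest reward outermost, \<open>replay_fail\<close> the
  oldest; with \<open>k\<close> rewards outstanding the two recursions can be exchanged one step at
  a time.\<close>

lemma nn_integral_run_hist:
  "(\<integral>\<^sup>+ h. ennreal (replay_fail arm b p (map snd h) k) \<partial>run_hist (fst (policy arm)) p n)
    = ennreal (replay_fail arm b p [] (n + k))"
proof (induction n arbitrary: k)
  case (Suc n)
  have "(\<integral>\<^sup>+ h. ennreal (replay_fail arm b p (map snd h) k) \<partial>run_hist (fst (policy arm)) p (Suc n))
    = (\<integral>\<^sup>+ h. (\<integral>\<^sup>+ r. ennreal (replay_fail arm b p (map snd h @ [r]) k) \<partial>bernoulli_pmf (p (arm (map snd h))))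
        \<partial>run_hist (fst (policy arm)) p n)"
    by (simp add: policy_def bind_return_pmf)
  also have "(\<lambda>h. \<integral>\<^sup>+ r. ennreal (replay_fail arm b p (map snd h @ [r]) k) \<partial>bernoulli_pmf (p (arm (map snd h))))
      = (\<lambda>h. ennreal (replay_fail arm b p (map snd h) (Suc k)))"
    by (subst bernoulli_pmf_clip[symmetric])
       (simp add: replay_fail_nonneg ennreal_mult ennreal_plus mult_ac)
  finally show ?case by (simp add: Suc.IH del: replay_fail.simps)
qed simp

lemma prob_output_dist:
  "measure_pmf.prob (output_dist (policy arm) p N) {i. p i < b} = replay_fail arm b p [] N"
proof -
  have "emeasure (measure_pmf (output_dist (policy arm) p N)) {i. p i < b}
     = (\<integral>\<^sup>+ i. indicator {i. p i < b} i \<partial>output_dist (policy arm) p N)"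
    by simp
  also have "\<dots> = (\<integral>\<^sup>+ h. ennreal (replay_fail arm b p (map snd h) 0) \<partial>run_hist (fst (policy arm)) p N)"
    by (simp add: output_dist_def policy_def del: nn_integral_indicator)
       (auto intro!: nn_integral_cong simp: indicator_def)
  also have "\<dots> = ennreal (replay_fail arm b p [] N)"
    by (simp add: nn_integral_run_hist del: replay_fail.simps)
  finally show ?thesis
    by (simp add: measure_def replay_fail_nonneg)
qed

section \<open>The two-stage algorithm\<close>

definition step :: "(bool list \<Rightarrow> bool) \<Rightarrow> nat \<times> bool list \<Rightarrow> bool \<Rightarrow> nat \<times> bool list" where
  "step st s r = (if st (snd s @ [r]) then (Suc (fst s), []) else (fst s, snd s @ [r]))"

text \<open>Arms \<open>0, \<dots>, n0 - 1\<close> receive \<open>m\<close> pulls each; \<open>E\<close> reads off a stopping rule from these rewards,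
  which then drives the search through the fresh arms \<open>n0, n0 + 1, \<dots>\<close>.\<close>
definition two_stage :: "nat \<Rightarrow> nat \<Rightarrow> (bool list \<Rightarrow> bool list \<Rightarrow> bool) \<Rightarrow> bool list \<Rightarrow> nat" where
  "two_stage m n0 E rs =
     (if length rs < n0 * m then length rs div m
      else fst (foldl (step (E (take (n0 * m) rs))) (n0, []) (drop (n0 * m) rs)))"

lemma replay_fail_second_stage:
  assumes "length rs = n0 * m"
  shows "replay_fail (two_stage m n0 E) b p (rs @ s) n =
    (case foldl (step (E rs)) (n0, []) s of (i, w) \<Rightarrow> search_fail (E rs) b p i w n)"
proof (induction n arbitrary: s)
  case 0 then show ?case using assms by (simp add: two_stage_def case_prod_unfold)
next
  case (Suc n)
  have "two_stage m n0 E (rs @ s) = fst (foldl (step (E rs)) (n0, []) s)"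
    using assms by (simp add: two_stage_def)
  moreover obtain i w where iw: "foldl (step (E rs)) (n0, []) s = (i, w)" by fastforce
  moreover have "step (E rs) (i, w) r = (if E rs (w @ [r]) then (Suc i, []) else (i, w @ [r]))" for r
    by (simp add: step_def)
  ultimately show ?case
    using Suc.IH[of "s @ [True]"] Suc.IH[of "s @ [False]"] by simp
qed

lemma replay_fail_block:
  assumes "k < n0"
  shows "length rs = k * m + t \<Longrightarrow> t + j \<le> m \<Longrightarrow> replay_fail (two_stage m n0 E) b p rs (j + n) =
    (\<Sum>w\<in>rewards j. wt (clip (p k)) w * replay_fail (two_stage m n0 E) b p (rs @ w) n)"
proof (induction j arbitrary: rs t)
  case (Suc j)
  have "k * m + t < k * m + m" using Suc.prems by simp
  also have "\<dots> \<le> n0 * m" using assms by (metis Suc_leI add.commute mult_Suc mult_le_mono1)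
  finally have "two_stage m n0 E rs = k"
    using Suc.prems by (simp add: two_stage_def div_eq_dividend_iff)
  then show ?case
    using Suc.IH[of "rs @ [True]" "Suc t"] Suc.IH[of "rs @ [False]" "Suc t"] Suc.prems
    by (simp add: sum_words_Suc UNIV_bool sum_distrib_left mult.assoc)
qed simp

lemma replay_fail_two_stage:
  "length rs = k0 * m \<Longrightarrow> k0 + k = n0 \<Longrightarrow> replay_fail (two_stage m n0 E) b p rs (k * m + n) =
    (\<Sum>ws\<in>words (rewards m) k. (\<Prod>i<k. wt (clip (p (k0 + i))) (ws ! i)) * search_fail (E (rs @ concat ws)) b p n0 [] n)"
proof (induction k arbitrary: k0 rs)
  case 0 then show ?case using replay_fail_second_stage[of rs n0 m E b p "[]" n] by simp
next
  case (Suc k)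
  have "replay_fail (two_stage m n0 E) b p rs (Suc k * m + n) = replay_fail (two_stage m n0 E) b p rs (m + (k * m + n))"
    by (simp add: algebra_simps)
  also have "\<dots> = (\<Sum>w\<in>rewards m. wt (clip (p k0)) w * replay_fail (two_stage m n0 E) b p (rs @ w) (k * m + n))"
    using Suc.prems by (intro replay_fail_block[where t = 0]) auto
  also have "\<dots> = (\<Sum>w\<in>rewards m. wt (clip (p k0)) w *
     (\<Sum>ws\<in>words (rewards m) k. (\<Prod>i<k. wt (clip (p (Suc k0 + i))) (ws ! i)) * search_fail (E ((rs @ w) @ concat ws)) b p n0 [] n))"
    using Suc.prems by (intro sum.cong refl arg_cong2[where f = "(*)"] Suc.IH) (auto simp: words_def)
  also have "\<dots> = (\<Sum>ws\<in>words (rewards m) (Suc k). (\<Prod>i<Suc k. wt (clip (p (k0 + i))) (ws ! i)) * search_fail (E (rs @ concat ws)) b p n0 [] n)"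
    by (simp add: sum_words_Suc sum_distrib_left prod.lessThan_Suc_shift mult.assoc del: prod.lessThan_Suc)
  finally show ?case .
qed

text \<open>Conditioning on the first-stage words \<open>ws\<close>, whose probability is the
  product of the integrals of \<open>wt\<close>. On \<open>Bad\<close> the search failure is bounded
  by 1; elsewhere \<open>Z\<close> bounds it relative to the probability of \<open>ws\<close>, and
  these probabilities add up to 1.\<close>

lemma fail_prob_two_stage_le:
  fixes \<mu> :: "real measure"
  assumes \<mu>: "prob_space \<mu>" and s: "sets \<mu> = sets borel" and Z: "0 \<le> Z" and N: "N = n0 * m + n"
    and good: "\<And>ws. ws \<in> words (rewards m) n0 \<Longrightarrow> ws \<notin> Bad \<Longrightarrow>
      (\<integral>\<^sup>+ p. (\<Prod>i<n0. ennreal (wt (clip (p i)) (ws ! i))) * ennreal (search_fail (E (concat ws)) b p n0 [] n) \<partial>PiM UNIV (\<lambda>_. \<mu>))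
       \<le> (\<Prod>i<n0. \<integral>\<^sup>+ x. ennreal (wt (clip x) (ws ! i)) \<partial>\<mu>) * ennreal Z"
  shows "fail_prob (policy (two_stage m n0 E)) \<mu> N b
    \<le> Z + (\<Sum>ws\<in>words (rewards m) n0 \<inter> Bad. \<Prod>i<n0. \<integral>x. wt (clip x) (ws ! i) \<partial>\<mu>)"
proof -
  let ?P = "PiM UNIV (\<lambda>_::nat. \<mu>)" and ?W = "words (rewards m) n0"
  let ?\<nu> = "\<lambda>w. \<integral>\<^sup>+ x. ennreal (wt (clip x) w) \<partial>\<mu>" and ?r = "\<lambda>w. \<integral>x. wt (clip x) w \<partial>\<mu>"
  interpret prob_space \<mu> by fact
  note s' = measurable_cong_sets[OF s refl, simp]
  have wt_meas: "(\<lambda>x. wt (clip x) w) \<in> borel_measurable \<mu>" for w by simp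
  have wt_le: "wt q w \<le> 1" if "0 \<le> q" "q \<le> 1" for q w
    using that unfolding wt_def by (intro prod_le_1) auto
  have int: "integrable \<mu> (\<lambda>x. wt (clip x) w)" for w
    by (rule integrable_const_bound[where B = 1]) (use wt_meas wt_le wt_nonneg in auto)
  have \<nu>: "?\<nu> w = ennreal (?r w)" for w
    by (rule nn_integral_eq_integral) (use int wt_nonneg in auto)
  have r0: "0 \<le> ?r w" for w
    by (rule Bochner_Integration.integral_nonneg) (use wt_nonneg in auto)
  have sum1: "(\<Sum>w\<in>rewards m. ?r w) = 1"
    by (subst Bochner_Integration.integral_sum[symmetric]) (auto simp: int sum_wt prob_space)
  have comp: "(\<lambda>p. f (p j)) \<in> borel_measurable ?P" if "f \<in> borel_measurable \<mu>" for f :: "real \<Rightarrow> ennreal" and j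
    using that by (auto intro!: measurable_compose[OF measurable_component_singleton])
  have [measurable]: "(\<lambda>p. \<Prod>i<n0. ennreal (wt (clip (p i)) (ws ! i))) \<in> borel_measurable ?P" for ws
    using wt_meas by (intro borel_measurable_prod_ennreal comp[of "\<lambda>x. ennreal (wt (clip x) w)" for w]) auto
  note [measurable] = search_fail_measurable[OF s]
  let ?I = "\<lambda>ws. \<integral>\<^sup>+ p. (\<Prod>i<n0. ennreal (wt (clip (p i)) (ws ! i))) * ennreal (search_fail (E (concat ws)) b p n0 [] n) \<partial>?P"
  have val: "ennreal (replay_fail (two_stage m n0 E) b p [] N) =
      (\<Sum>ws\<in>?W. (\<Prod>i<n0. ennreal (wt (clip (p i)) (ws ! i))) * ennreal (search_fail (E (concat ws)) b p n0 [] n))" for p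
  proof -
    have "replay_fail (two_stage m n0 E) b p [] N =
        (\<Sum>ws\<in>?W. (\<Prod>i<n0. wt (clip (p i)) (ws ! i)) * search_fail (E (concat ws)) b p n0 [] n)"
      using replay_fail_two_stage[of "[]" 0 m n0 n0 E b p n] by (simp add: N)
    moreover have "0 \<le> (\<Prod>i<n0. wt (clip (p i)) (ws ! i))" for ws
      by (intro prod_nonneg) (auto intro: wt_nonneg)
    ultimately show ?thesis
      using search_fail_bounds wt_nonneg
      by (simp add: sum_ennreal[symmetric] ennreal_mult prod_ennreal del: sum_ennreal)
  qed
  have "(\<integral>\<^sup>+ p. ennreal (measure_pmf.prob (output_dist (policy (two_stage m n0 E)) p N) {i. p i < b}) \<partial>?P)
     = (\<Sum>ws\<in>?W. ?I ws)"
    unfolding prob_output_dist val by (subst nn_integral_sum) auto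
  also have "\<dots> \<le> (\<Sum>ws\<in>?W. (\<Prod>i<n0. ?\<nu> (ws ! i)) * ennreal Z + (if ws \<in> Bad then \<Prod>i<n0. ?\<nu> (ws ! i) else 0))"
  proof (rule sum_mono)
    fix ws assume ws: "ws \<in> ?W"
    show "?I ws \<le> (\<Prod>i<n0. ?\<nu> (ws ! i)) * ennreal Z + (if ws \<in> Bad then \<Prod>i<n0. ?\<nu> (ws ! i) else 0)"
    proof (cases "ws \<in> Bad")
      case False
      then show ?thesis using good[OF ws] by simp
    next
      case True
      have "?I ws \<le> (\<integral>\<^sup>+ p. (\<Prod>i<n0. ennreal (wt (clip (p i)) (ws ! i))) \<partial>?P)"
      proof (rule nn_integral_mono)
        fix p
        have "ennreal (search_fail (E (concat ws)) b p n0 [] n) \<le> 1"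
          using search_fail_bounds by (simp add: ennreal_le_1)
        then show "(\<Prod>i<n0. ennreal (wt (clip (p i)) (ws ! i))) * ennreal (search_fail (E (concat ws)) b p n0 [] n)
            \<le> (\<Prod>i<n0. ennreal (wt (clip (p i)) (ws ! i)))"
          by (metis mult.right_neutral mult_left_mono zero_le)
      qed
      also have "\<dots> = (\<Prod>i<n0. ?\<nu> (ws ! i))"
        by (rule nn_integral_PiM_prod[OF \<mu>, of "{..<n0}" "\<lambda>i x. ennreal (wt (clip x) (ws ! i))"]) auto
      finally show ?thesis using True by (simp add: add_increasing)
    qed
  qed
  also have "\<dots> = ennreal (Z + (\<Sum>ws\<in>?W \<inter> Bad. \<Prod>i<n0. ?r (ws ! i)))"
  proof -
    have "(\<Sum>ws\<in>?W. (\<Prod>i<n0. ?\<nu> (ws ! i))) = (\<Sum>w\<in>rewards m. ?\<nu> w) ^ n0"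
      by (rule sum_words_prod) simp
    also have "\<dots> = 1" using r0 by (simp add: \<nu> sum1)
    finally have "(\<Sum>ws\<in>?W. (\<Prod>i<n0. ?\<nu> (ws ! i)) * ennreal Z) = ennreal Z"
      by (simp add: sum_distrib_right[symmetric])
    moreover have "(\<Sum>ws\<in>?W. (if ws \<in> Bad then \<Prod>i<n0. ?\<nu> (ws ! i) else 0)) = (\<Sum>ws\<in>?W \<inter> Bad. \<Prod>i<n0. ?\<nu> (ws ! i))"
      by (simp add: sum.inter_restrict)
    moreover have "\<dots> = ennreal (\<Sum>ws\<in>?W \<inter> Bad. \<Prod>i<n0. ?r (ws ! i))"
      using r0 by (simp add: \<nu> prod_ennreal sum_ennreal prod_nonneg)
    ultimately show ?thesis using Z r0 by (simp add: sum.distrib ennreal_plus sum_nonneg prod_nonneg)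
  qed
  finally show ?thesis unfolding fail_prob_def
    using Z r0 by (intro enn2real_leI) (auto intro!: add_nonneg_nonneg sum_nonneg prod_nonneg)
qed

section \<open>Estimation of the target level\<close>

lemma bernoulli_mgf_le_square:
  fixes p c :: real
  assumes p: "0 \<le> p" "p \<le> 1" and c: "\<bar>c\<bar> \<le> 1"
  shows "1 - p + p * exp c \<le> exp (p * c + c\<^sup>2 / 2)"
proof -
  have "p * (1 - p) * exp \<bar>c\<bar> \<le> 1"
    using assms by (rule bernoulli_variance_exp_le)
  then have "p * (1 - p) * exp \<bar>c\<bar> * c\<^sup>2 \<le> 1 * c\<^sup>2"
    by (intro mult_right_mono) auto
  then have "exp (p * c + p * (1 - p) * c\<^sup>2 * exp \<bar>c\<bar> / 2) \<le> exp (p * c + c\<^sup>2 / 2)"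
    by (simp add: mult_ac)
  with bernoulli_mgf_le[OF p, of c] show ?thesis by linarith
qed

text \<open>Chernoff bound for the number of letters satisfying \<open>\<phi>\<close> among
  independent letters with law \<open>\<nu>\<close>: the exponential moment factorises by
  \<open>sum_words_prod\<close>. A negative \<open>c\<close> gives the lower tail.\<close>

lemma sum_words_tail:
  fixes \<nu> :: "'a \<Rightarrow> real" and \<phi> :: "'a \<Rightarrow> bool"
  assumes A: "finite A" "\<And>w. w \<in> A \<Longrightarrow> 0 \<le> \<nu> w" "(\<Sum>w\<in>A. \<nu> w) = 1" and c: "\<bar>c\<bar> \<le> 1"
  defines "H \<equiv> \<Sum>w\<in>A. \<nu> w * of_bool (\<phi> w)"
  shows "(\<Sum>ws\<in>{ws\<in>words A n. real n * (c * H + c\<^sup>2) \<le> c * (\<Sum>i<n. of_bool (\<phi> (ws ! i)))}. \<Prod>i<n. \<nu> (ws ! i))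
    \<le> exp (- (real n * c\<^sup>2 / 2))"
proof -
  let ?B = "{ws\<in>words A n. real n * (c * H + c\<^sup>2) \<le> c * (\<Sum>i<n. of_bool (\<phi> (ws ! i)))}"
  have H: "0 \<le> H" "H \<le> 1"
  proof -
    show "0 \<le> H" unfolding H_def using A by (intro sum_nonneg) auto
    have "H \<le> (\<Sum>w\<in>A. \<nu> w)" unfolding H_def using A by (intro sum_mono) auto
    then show "H \<le> 1" using A by simp
  qed
  have nn: "0 \<le> (\<Prod>i<n. \<nu> (ws ! i))" if "ws \<in> words A n" for ws
    using that A by (intro prod_nonneg) (auto simp: words_def dest: nth_mem)
  have "(\<Sum>ws\<in>?B. \<Prod>i<n. \<nu> (ws ! i))
     \<le> (\<Sum>ws\<in>?B. (\<Prod>i<n. \<nu> (ws ! i)) * exp (c * (\<Sum>i<n. of_bool (\<phi> (ws ! i))) - real n * (c * H + c\<^sup>2)))"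
  proof (rule sum_mono)
    fix ws assume ws: "ws \<in> ?B"
    then have "1 \<le> exp (c * (\<Sum>i<n. of_bool (\<phi> (ws ! i))) - real n * (c * H + c\<^sup>2))" by simp
    then show "(\<Prod>i<n. \<nu> (ws ! i)) \<le> (\<Prod>i<n. \<nu> (ws ! i)) * exp (c * (\<Sum>i<n. of_bool (\<phi> (ws ! i))) - real n * (c * H + c\<^sup>2))"
      using nn[of ws] ws mult_left_mono[of 1 _ "\<Prod>i<n. \<nu> (ws ! i)"] by simp
  qed
  also have "\<dots> \<le> (\<Sum>ws\<in>words A n. (\<Prod>i<n. \<nu> (ws ! i)) * exp (c * (\<Sum>i<n. of_bool (\<phi> (ws ! i))) - real n * (c * H + c\<^sup>2)))"
    using A nn by (intro sum_mono2 mult_nonneg_nonneg) auto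
  also have "\<dots> = (\<Sum>ws\<in>words A n. (\<Prod>i<n. \<nu> (ws ! i) * exp (c * of_bool (\<phi> (ws ! i))))) * exp (- (real n * (c * H + c\<^sup>2)))"
    unfolding sum_distrib_right
    by (intro sum.cong refl) (simp only: sum_distrib_left diff_conv_add_uminus exp_add exp_sum[OF finite_lessThan] prod.distrib mult.assoc)
  also have "(\<Sum>ws\<in>words A n. (\<Prod>i<n. \<nu> (ws ! i) * exp (c * of_bool (\<phi> (ws ! i))))) = (\<Sum>w\<in>A. \<nu> w * exp (c * of_bool (\<phi> w))) ^ n"
    by (rule sum_words_prod[OF A(1)])
  also have "(\<Sum>w\<in>A. \<nu> w * exp (c * of_bool (\<phi> w))) = 1 - H + H * exp c"
  proof -
    have "(\<Sum>w\<in>A. \<nu> w * exp (c * of_bool (\<phi> w))) = (\<Sum>w\<in>A. \<nu> w - \<nu> w * of_bool (\<phi> w) + \<nu> w * of_bool (\<phi> w) * exp c)"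
      by (intro sum.cong) auto
    then show ?thesis by (simp only: sum.distrib sum_subtractf H_def sum_distrib_right A(3))
  qed
  also have "(1 - H + H * exp c) ^ n * exp (- (real n * (c * H + c\<^sup>2)))
      \<le> exp (H * c + c\<^sup>2 / 2) ^ n * exp (- (real n * (c * H + c\<^sup>2)))"
    using H c by (intro mult_right_mono power_mono bernoulli_mgf_le_square) auto
  also have "\<dots> = exp (- (real n * c\<^sup>2 / 2))"
    by (simp add: exp_of_nat_mult[symmetric] mult_exp_exp algebra_simps)
  finally show ?thesis .
qed

lemma sum_words_deviation:
  fixes \<nu> :: "'a \<Rightarrow> real" and \<phi> :: "'a \<Rightarrow> bool"
  assumes A: "finite A" "\<And>w. w \<in> A \<Longrightarrow> 0 \<le> \<nu> w" "(\<Sum>w\<in>A. \<nu> w) = 1" and \<kappa>: "0 \<le> \<kappa>" "\<kappa> \<le> 1"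
  defines "H \<equiv> \<Sum>w\<in>A. \<nu> w * of_bool (\<phi> w)"
  shows "(\<Sum>ws\<in>{ws\<in>words A n. real n * \<kappa> \<le> \<bar>(\<Sum>i<n. of_bool (\<phi> (ws ! i))) - real n * H\<bar>}. \<Prod>i<n. \<nu> (ws ! i))
    \<le> 2 * exp (- (real n * \<kappa>\<^sup>2 / 2))"
proof -
  let ?F = "\<lambda>ws. \<Prod>i<n. \<nu> (ws ! i)"
  let ?s = "\<lambda>ws. \<Sum>i<n. of_bool (\<phi> (ws ! i)) :: real"
  let ?B = "\<lambda>c. {ws\<in>words A n. real n * (c * H + c\<^sup>2) \<le> c * ?s ws}"
  have nn: "0 \<le> ?F ws" if "ws \<in> words A n" for ws
    using that A by (intro prod_nonneg) (auto simp: words_def dest: nth_mem)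
  have sub: "{ws\<in>words A n. real n * \<kappa> \<le> \<bar>?s ws - real n * H\<bar>} \<subseteq> ?B \<kappa> \<union> ?B (- \<kappa>)"
  proof
    fix ws assume ws: "ws \<in> {ws\<in>words A n. real n * \<kappa> \<le> \<bar>?s ws - real n * H\<bar>}"
    then consider "real n * \<kappa> \<le> ?s ws - real n * H" | "real n * \<kappa> \<le> real n * H - ?s ws" by fastforce
    then show "ws \<in> ?B \<kappa> \<union> ?B (- \<kappa>)"
    proof cases
      case 1
      from mult_left_mono[OF 1 \<kappa>(1)] ws show ?thesis by (simp add: algebra_simps power2_eq_square)
    next
      case 2
      from mult_left_mono[OF 2 \<kappa>(1)] ws show ?thesis by (simp add: algebra_simps power2_eq_square)
    qed
  qed
  have "(\<Sum>ws\<in>{ws\<in>words A n. real n * \<kappa> \<le> \<bar>?s ws - real n * H\<bar>}. ?F ws) \<le> (\<Sum>ws\<in>?B \<kappa> \<union> ?B (- \<kappa>). ?F ws)"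
    using A nn by (intro sum_mono2 sub) auto
  also have "\<dots> \<le> (\<Sum>ws\<in>?B \<kappa>. ?F ws) + (\<Sum>ws\<in>?B (- \<kappa>). ?F ws)"
  proof -
    have "0 \<le> (\<Sum>ws\<in>?B \<kappa> \<inter> ?B (- \<kappa>). ?F ws)" using nn by (intro sum_nonneg) auto
    then show ?thesis using A sum.union_inter[of "?B \<kappa>" "?B (- \<kappa>)" ?F] by simp
  qed
  also have "\<dots> \<le> exp (- (real n * \<kappa>\<^sup>2 / 2)) + exp (- (real n * (- \<kappa>)\<^sup>2 / 2))"
    unfolding H_def using \<kappa> by (intro add_mono sum_words_tail A) auto
  finally show ?thesis by simp
qed

text \<open>As a function of \<open>q\<close> this is a blurred indicator of
  \<open>q \<le> t\<close>. Its integral over the reservoir is a blurred distribution function, and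
  this is what the first stage can estimate.\<close>

definition low_prob :: "nat \<Rightarrow> real \<Rightarrow> real \<Rightarrow> real" where
  "low_prob m t q = (\<Sum>w\<in>rewards m. wt q w * of_bool (successes m w \<le> real m * t))"

lemma low_prob_bounds:
  assumes q: "0 \<le> q" "q \<le> 1"
  shows "0 \<le> low_prob m t q" "low_prob m t q \<le> 1"
proof -
  show "0 \<le> low_prob m t q" unfolding low_prob_def using wt_nonneg[OF q] by (intro sum_nonneg) auto
  have "low_prob m t q \<le> (\<Sum>w\<in>rewards m. wt q w)"
    unfolding low_prob_def using wt_nonneg[OF q] by (intro sum_mono) auto
  then show "low_prob m t q \<le> 1" by (simp add: sum_wt)
qed

lemma low_prob_tails:
  assumes q: "0 \<le> q" "q \<le> 1" and \<kappa>: "0 \<le> \<kappa>" "\<kappa> \<le> 1"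
  shows "t + \<kappa> \<le> q \<Longrightarrow> low_prob m t q \<le> exp (- (real m * \<kappa>\<^sup>2 / 2))"
    and "q \<le> t - \<kappa> \<Longrightarrow> 1 - low_prob m t q \<le> exp (- (real m * \<kappa>\<^sup>2 / 2))"
proof -
  let ?\<nu> = "\<lambda>r. if r then q else 1 - q"
  have wt: "wt q w = (\<Prod>i<m. ?\<nu> (w ! i))" if "w \<in> rewards m" for w
    using that by (simp add: wt_def words_def)
  have tail: "(\<Sum>w\<in>{w\<in>rewards m. real m * (c * q + c\<^sup>2) \<le> c * successes m w}. wt q w) \<le> exp (- (real m * c\<^sup>2 / 2))" if "\<bar>c\<bar> \<le> 1" for c
  proof -
    have eq: "(\<Sum>w\<in>UNIV. ?\<nu> w * of_bool w) = q" by (simp add: UNIV_bool)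
    have "(\<Sum>ws\<in>{ws\<in>rewards m. real m * (c * (\<Sum>w\<in>UNIV. ?\<nu> w * of_bool w) + c\<^sup>2) \<le> c * (\<Sum>i<m. of_bool (ws ! i))}.
        \<Prod>i<m. ?\<nu> (ws ! i)) \<le> exp (- (real m * c\<^sup>2 / 2))"
      by (rule sum_words_tail) (use q that in \<open>auto simp: UNIV_bool\<close>)
    moreover have "(\<Sum>w\<in>{w\<in>rewards m. real m * (c * q + c\<^sup>2) \<le> c * successes m w}. wt q w)
       = (\<Sum>ws\<in>{ws\<in>rewards m. real m * (c * q + c\<^sup>2) \<le> c * (\<Sum>i<m. of_bool (ws ! i))}. \<Prod>i<m. ?\<nu> (ws ! i))"
      by (intro sum.cong) (auto simp: successes_def wt)
    ultimately show ?thesis unfolding eq by simp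
  qed
  show "low_prob m t q \<le> exp (- (real m * \<kappa>\<^sup>2 / 2))" if h: "t + \<kappa> \<le> q"
  proof -
    have "low_prob m t q \<le> (\<Sum>w\<in>{w\<in>rewards m. real m * (- \<kappa> * q + (- \<kappa>)\<^sup>2) \<le> - \<kappa> * successes m w}. wt q w)"
      unfolding low_prob_def sum.inter_filter[OF finite_words[OF finite_class.finite_UNIV]]
    proof (rule sum_mono)
      fix w assume "w \<in> rewards m"
      have "\<kappa> * successes m w \<le> \<kappa> * (real m * (q - \<kappa>))" if "successes m w \<le> real m * t"
        using h \<kappa> by (intro mult_left_mono order_trans[OF that]) auto
      then show "wt q w * of_bool (successes m w \<le> real m * t) \<le> (if real m * (- \<kappa> * q + (- \<kappa>)\<^sup>2) \<le> - \<kappa> * successes m w then wt q w else 0)"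
        using wt_nonneg[OF q, of w] by (auto simp: algebra_simps power2_eq_square)
    qed
    also have "\<dots> \<le> exp (- (real m * (- \<kappa>)\<^sup>2 / 2))" by (rule tail) (use \<kappa> in auto)
    finally show ?thesis by simp
  qed
  show "1 - low_prob m t q \<le> exp (- (real m * \<kappa>\<^sup>2 / 2))" if h: "q \<le> t - \<kappa>"
  proof -
    have "1 - low_prob m t q = (\<Sum>w\<in>rewards m. wt q w * of_bool (\<not> successes m w \<le> real m * t))"
      unfolding low_prob_def sum_wt[of q m, symmetric] sum_subtractf[symmetric] by (intro sum.cong) auto
    also have "\<dots> \<le> (\<Sum>w\<in>{w\<in>rewards m. real m * (\<kappa> * q + \<kappa>\<^sup>2) \<le> \<kappa> * successes m w}. wt q w)"
      unfolding sum.inter_filter[OF finite_words[OF finite_class.finite_UNIV]]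
    proof (rule sum_mono)
      fix w assume "w \<in> rewards m"
      have "\<kappa> * (real m * (q + \<kappa>)) \<le> \<kappa> * successes m w" if "real m * t < successes m w"
        using h \<kappa> by (intro mult_left_mono order_trans[OF _ less_imp_le[OF that]]) auto
      then show "wt q w * of_bool (\<not> successes m w \<le> real m * t) \<le> (if real m * (\<kappa> * q + \<kappa>\<^sup>2) \<le> \<kappa> * successes m w then wt q w else 0)"
        using wt_nonneg[OF q, of w] by (auto simp: algebra_simps power2_eq_square)
    qed
    also have "\<dots> \<le> exp (- (real m * \<kappa>\<^sup>2 / 2))" by (rule tail) (use \<kappa> in auto)
    finally show ?thesis .
  qed
qed

section \<open>Quantiles of a reservoir\<close>

context
  fixes \<mu> :: "real measure"
  assumes res: "reservoir \<mu>"
begin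

lemma reservoir_prob: "prob_space \<mu>" and reservoir_sets: "sets \<mu> = sets borel"
  and reservoir_unit: "measure \<mu> {0..1} = 1"
  using res by (auto simp: reservoir_def)

lemma reservoir_space: "space \<mu> = UNIV"
  using sets_eq_imp_space_eq[OF reservoir_sets] by simp

lemma G_mono: "s \<le> t \<Longrightarrow> G \<mu> s \<le> G \<mu> t"
proof -
  interpret prob_space \<mu> by (rule reservoir_prob)
  show "s \<le> t \<Longrightarrow> G \<mu> s \<le> G \<mu> t"
    unfolding G_def by (intro finite_measure_mono) (auto simp: reservoir_sets)
qed

lemma G_1: "G \<mu> 1 = 1"
proof -
  interpret prob_space \<mu> by (rule reservoir_prob)
  have "measure \<mu> {0..1} \<le> G \<mu> 1"
    unfolding G_def by (intro finite_measure_mono) (auto simp: reservoir_sets)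
  moreover have "G \<mu> 1 \<le> 1" unfolding G_def by (rule prob_le_1)
  ultimately show ?thesis using reservoir_unit by simp
qed

lemma G_upper: "1 - measure \<mu> {t..} \<le> G \<mu> t"
proof -
  interpret prob_space \<mu> by (rule reservoir_prob)
  have "space \<mu> - {t..} = {..<t}" by (auto simp: reservoir_space)
  then have "1 - measure \<mu> {t..} = measure \<mu> {..<t}"
    using prob_compl[of "{t..}"] by (simp add: reservoir_sets)
  also have "\<dots> \<le> G \<mu> t"
    unfolding G_def by (intro finite_measure_mono) (auto simp: reservoir_sets)
  finally show ?thesis .
qed

lemma Ginv_le: "0 \<le> t \<Longrightarrow> t \<le> 1 \<Longrightarrow> q \<le> G \<mu> t \<Longrightarrow> Ginv \<mu> q \<le> t"
  unfolding Ginv_def by (intro cInf_lower) auto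

lemma Ginv_ge:
  assumes "q \<le> 1" "\<And>t. 0 \<le> t \<Longrightarrow> t \<le> 1 \<Longrightarrow> q \<le> G \<mu> t \<Longrightarrow> s \<le> t"
  shows "s \<le> Ginv \<mu> q"
proof -
  have "1 \<in> {\<tau> \<in> {0..1}. G \<mu> \<tau> \<ge> q}" using assms G_1 by simp
  then show ?thesis unfolding Ginv_def by (intro cInf_greatest) (use assms in auto)
qed

lemma Ginv_bounds: "q \<le> 1 \<Longrightarrow> 0 \<le> Ginv \<mu> q" "q \<le> 1 \<Longrightarrow> Ginv \<mu> q \<le> 1"
  using G_1 by (auto intro!: Ginv_ge Ginv_le)

lemma Ginv_mono: "p \<le> q \<Longrightarrow> q \<le> 1 \<Longrightarrow> Ginv \<mu> p \<le> Ginv \<mu> q"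
  by (rule Ginv_ge) (auto intro!: Ginv_le)

text \<open>By monotonicity the grid points at which \<open>G \<mu>\<close> is below
  \<open>q\<close> form an initial segment, and its length is \<open>Q * Ginv \<mu> q\<close> up to
  one. The quantile thus becomes a sum of indicators in \<open>q\<close>, whose integral over
  \<open>q\<close> is explicit.\<close>

lemma Ginv_grid:
  assumes q: "q \<le> 1" and Q: "0 < Q"
  defines "c \<equiv> \<Sum>j<Q. of_bool (G \<mu> (real j / real Q) < q) :: real"
  shows "real Q * Ginv \<mu> q \<le> c" "c \<le> real Q * Ginv \<mu> q + 1"
proof -
  define A where "A = {j. j < Q \<and> G \<mu> (real j / real Q) < q}"
  have fin: "finite A" by (simp add: A_def)
  have cA: "c = real (card A)" by (simp add: c_def A_def Int_def lessThan_def)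
  have down: "i \<in> A" if "j \<in> A" "i \<le> j" for i j
  proof -
    have "G \<mu> (real i / real Q) \<le> G \<mu> (real j / real Q)" using that by (intro G_mono divide_right_mono) auto
    then show ?thesis using that by (auto simp: A_def)
  qed
  have A: "A = {..<card A}"
  proof (cases "A = {}")
    case False
    have "A = {..Max A}"
    proof (intro equalityI subsetI)
      fix i assume "i \<in> {..Max A}"
      then show "i \<in> A" using down[OF Max_in[OF fin False]] by simp
    qed (use fin in auto)
    then have "A = {..<Suc (Max A)}" by (simp add: lessThan_Suc_atMost)
    then show ?thesis by (metis card_lessThan)
  qed simp
  have "card A \<le> card {..<Q}" by (intro card_mono) (auto simp: A_def)
  then have le: "card A \<le> Q" by simp
  have "Ginv \<mu> q \<le> real (card A) / real Q"
  proof (cases "card A < Q")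
    case True
    have "card A \<notin> A" using A by (metis lessThan_iff less_irrefl)
    then have "q \<le> G \<mu> (real (card A) / real Q)" using True by (auto simp: A_def)
    then show ?thesis using le Q by (intro Ginv_le) auto
  next
    case False
    then show ?thesis using le Q Ginv_bounds[OF q] by simp
  qed
  then show "real Q * Ginv \<mu> q \<le> c" using Q by (simp add: cA field_simps)
  show "c \<le> real Q * Ginv \<mu> q + 1"
  proof (cases "card A")
    case 0
    then show ?thesis using Ginv_bounds[OF q] by (simp add: cA)
  next
    case (Suc k)
    then have "k \<in> A" using A by (metis lessI lessThan_iff)
    then have k: "G \<mu> (real k / real Q) < q" by (simp add: A_def)
    have "real k / real Q \<le> Ginv \<mu> q"
    proof (rule Ginv_ge[OF q])
      fix t assume t: "q \<le> G \<mu> t"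
      show "real k / real Q \<le> t"
        using G_mono[of t "real k / real Q"] k t by (cases "real k / real Q \<le> t") auto
    qed
    then show ?thesis using Q Suc by (simp add: cA field_simps)
  qed
qed

lemma Ginv_integrable: "t \<le> 1 \<Longrightarrow> Ginv \<mu> integrable_on {s..t}"
  by (rule integrable_on_mono_on) (auto simp: mono_on_def intro: Ginv_mono)

end

section \<open>The level \<alpha> as a functional of the distribution function\<close>

lemma has_integral_step:
  fixes s t g :: real
  assumes "s \<le> t"
  shows "((\<lambda>x. of_bool (g < x) :: real) has_integral min (t - s) (max 0 (t - g))) {s..t}"
proof -
  consider "t \<le> g" | "g < s" | "s \<le> g" "g < t" by linarith
  then show ?thesis
  proof cases
    case 1
    have "((\<lambda>x. of_bool (g < x) :: real) has_integral 0) {s..t}"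
      by (rule has_integral_is_0) (use 1 in auto)
    then show ?thesis using 1 assms by simp
  next
    case 2
    have "((\<lambda>x. 1 :: real) has_integral (t - s)) {s..t}"
      using has_integral_const_real[of "1::real" s t] assms by simp
    then have "((\<lambda>x. of_bool (g < x) :: real) has_integral (t - s)) {s..t}"
      by (rule has_integral_eq[rotated]) (use 2 in auto)
    then show ?thesis using 2 by simp
  next
    case 3
    have "((\<lambda>x. of_bool (g < x) :: real) has_integral 0) {s..g}"
      by (rule has_integral_is_0) auto
    moreover have "((\<lambda>x. of_bool (g < x) :: real) has_integral (t - g)) {g..t}"
    proof (rule has_integral_spike_finite[where S = "{g}" and f = "\<lambda>x. 1"])
      show "((\<lambda>x. 1 :: real) has_integral (t - g)) {g..t}"
        using has_integral_const_real[of "1::real" g t] 3 by simp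
    qed auto
    ultimately have "((\<lambda>x. of_bool (g < x) :: real) has_integral (0 + (t - g))) {s..t}"
      using 3 by (intro has_integral_combine[of s g t]) auto
    then show ?thesis using 3 by simp
  qed
qed

text \<open>The length of the part of the interval from \<open>1 - \<eta>1\<close> to
  \<open>1 - \<eta>2\<close> that lies above \<open>g\<close>.\<close>

definition top_slice :: "real \<Rightarrow> real \<Rightarrow> real \<Rightarrow> real" where
  "top_slice \<eta>1 \<eta>2 g = min (\<eta>1 - \<eta>2) (max 0 (1 - \<eta>2 - g))"

text \<open>Riemann sum for the layer-cake form of \<alpha>, the integral of
  \<open>top_slice \<eta>1 \<eta>2 (G \<mu> \<tau>)\<close> over \<tau> in the unit interval,
  divided by \<open>\<eta>1 - \<eta>2\<close>. It avoids the inverse and is Lipschitz in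
  \<open>F\<close>, so an estimated distribution function can be inserted.\<close>

definition grid_alpha :: "real \<Rightarrow> real \<Rightarrow> nat \<Rightarrow> (nat \<Rightarrow> real) \<Rightarrow> real" where
  "grid_alpha \<eta>1 \<eta>2 Q F = (\<Sum>j<Q. top_slice \<eta>1 \<eta>2 (F j)) / (real Q * (\<eta>1 - \<eta>2))"

lemma grid_alpha_bounds:
  assumes "\<eta>2 < \<eta>1" "0 < Q"
  shows "0 \<le> grid_alpha \<eta>1 \<eta>2 Q F" "grid_alpha \<eta>1 \<eta>2 Q F \<le> 1"
proof -
  have b: "0 \<le> top_slice \<eta>1 \<eta>2 g" "top_slice \<eta>1 \<eta>2 g \<le> \<eta>1 - \<eta>2" for g
    using assms by (auto simp: top_slice_def)
  show "0 \<le> grid_alpha \<eta>1 \<eta>2 Q F" unfolding grid_alpha_def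
    using assms b by (intro divide_nonneg_nonneg sum_nonneg mult_nonneg_nonneg) auto
  have "(\<Sum>j<Q. top_slice \<eta>1 \<eta>2 (F j)) \<le> real Q * (\<eta>1 - \<eta>2)"
    using sum_bounded_above[of "{..<Q}" "\<lambda>j. top_slice \<eta>1 \<eta>2 (F j)" "\<eta>1 - \<eta>2"] b by simp
  then show "grid_alpha \<eta>1 \<eta>2 Q F \<le> 1" unfolding grid_alpha_def using assms by (simp add: divide_le_eq)
qed

lemma alpha_grid:
  assumes res: "reservoir \<mu>" and \<eta>: "0 \<le> \<eta>2" "\<eta>2 < \<eta>1" and Q: "0 < Q"
  shows "\<bar>alpha \<mu> \<eta>1 \<eta>2 - grid_alpha \<eta>1 \<eta>2 Q (\<lambda>j. G \<mu> (real j / real Q))\<bar> \<le> 1 / real Q"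
proof -
  let ?w = "\<eta>1 - \<eta>2" and ?s = "1 - \<eta>1" and ?t = "1 - \<eta>2"
  let ?c = "\<lambda>x. \<Sum>j<Q. of_bool (G \<mu> (real j / real Q) < x) :: real"
  let ?C = "\<Sum>j<Q. top_slice \<eta>1 \<eta>2 (G \<mu> (real j / real Q))"
  let ?I = "integral {?s..?t} (Ginv \<mu>)"
  have c: "(?c has_integral ?C) {?s..?t}"
  proof (rule has_integral_sum)
    fix j
    show "((\<lambda>x. of_bool (G \<mu> (real j / real Q) < x)) has_integral top_slice \<eta>1 \<eta>2 (G \<mu> (real j / real Q))) {?s..?t}"
      using has_integral_step[of ?s ?t "G \<mu> (real j / real Q)"] \<eta> by (simp add: top_slice_def)
  qed simp
  have G: "((\<lambda>x. real Q * Ginv \<mu> x) has_integral real Q * ?I) {?s..?t}"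
    using Ginv_integrable[OF res, of ?t ?s] \<eta> by (intro has_integral_mult_right integrable_integral) auto
  have G1: "((\<lambda>x. real Q * Ginv \<mu> x + 1) has_integral (real Q * ?I + ?w)) {?s..?t}"
    using has_integral_add[OF G has_integral_const_real[of "1::real" ?s ?t]] \<eta> by simp
  have "real Q * ?I \<le> ?C"
    by (rule has_integral_le[OF G c]) (use Ginv_grid[OF res] Q \<eta> in auto)
  moreover have "?C \<le> real Q * ?I + ?w"
    by (rule has_integral_le[OF c G1]) (use Ginv_grid[OF res] Q \<eta> in auto)
  ultimately have "\<bar>real Q * ?I - ?C\<bar> \<le> ?w" by linarith
  then have "\<bar>real Q * ?I - ?C\<bar> / (real Q * ?w) \<le> ?w / (real Q * ?w)"
    using \<eta> Q by (intro divide_right_mono) auto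
  moreover have "\<bar>real Q * ?I - ?C\<bar> / (real Q * ?w) = \<bar>(real Q * ?I - ?C) / (real Q * ?w)\<bar>"
    using \<eta> Q by (simp add: abs_mult)
  moreover have "(real Q * ?I - ?C) / (real Q * ?w) = alpha \<mu> \<eta>1 \<eta>2 - grid_alpha \<eta>1 \<eta>2 Q (\<lambda>j. G \<mu> (real j / real Q))"
    using \<eta> Q by (simp add: alpha_def grid_alpha_def diff_divide_distrib)
  ultimately show ?thesis using \<eta> by simp
qed

lemma alpha_le_1:
  assumes res: "reservoir \<mu>" and \<eta>: "0 \<le> \<eta>2" "\<eta>2 < \<eta>1"
  shows "alpha \<mu> \<eta>1 \<eta>2 \<le> 1"
proof -
  have "integral {1 - \<eta>1..1 - \<eta>2} (Ginv \<mu>) \<le> integral {1 - \<eta>1..1 - \<eta>2} (\<lambda>_. 1)"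
    using Ginv_integrable[OF res] Ginv_bounds[OF res] \<eta> by (intro integral_le) auto
  also have "\<dots> = \<eta>1 - \<eta>2" using \<eta> by simp
  finally show ?thesis using \<eta> by (simp add: alpha_def)
qed

text \<open>If little mass lay above \<alpha> - \<delta>, the quantiles would be at most \<alpha> -
  \<delta> except on a short interval, where they are at most 1, and their average could not reach
  \<alpha>.\<close>

lemma good_fraction:
  assumes res: "reservoir \<mu>" and \<eta>: "0 \<le> \<eta>2" "\<eta>2 < \<eta>1" "\<eta>1 \<le> 1" and \<delta>: "0 < \<delta>" "\<delta> \<le> 1"
  shows "(\<eta>1 - \<eta>2) * \<delta> \<le> measure \<mu> {alpha \<mu> \<eta>1 \<eta>2 - \<delta>..}"
proof -
  interpret prob_space \<mu> using reservoir_prob[OF res] .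
  define l where "l = alpha \<mu> \<eta>1 \<eta>2 - \<delta>"
  define m where "m = measure \<mu> {l..}"
  show ?thesis
  proof (cases "0 \<le> l")
    case False
    have "measure \<mu> {0..1} \<le> m"
      unfolding m_def using False by (intro finite_measure_mono) (auto simp: reservoir_sets[OF res])
    moreover have "(\<eta>1 - \<eta>2) * \<delta> \<le> 1 * 1" using \<eta> \<delta> by (intro mult_mono) auto
    ultimately show ?thesis using reservoir_unit[OF res] by (simp add: m_def l_def)
  next
    case True
    have l1: "l \<le> 1" using alpha_le_1[OF res \<eta>(1,2)] \<delta> by (simp add: l_def)
    let ?s = "1 - \<eta>1" and ?t = "1 - \<eta>2"
    have I1: "((\<lambda>x. l + of_bool (1 - m < x)) has_integral ((\<eta>1 - \<eta>2) * l + min (?t - ?s) (max 0 (?t - (1 - m))))) {?s..?t}"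
      using has_integral_add[OF has_integral_const_real[of l ?s ?t] has_integral_step[of ?s ?t "1 - m"]] \<eta>
      by simp
    have I2: "(Ginv \<mu> has_integral integral {?s..?t} (Ginv \<mu>)) {?s..?t}"
      using Ginv_integrable[OF res, of ?t ?s] \<eta> by (intro integrable_integral) auto
    have I3: "Ginv \<mu> x \<le> l + of_bool (1 - m < x)" if "x \<in> {?s..?t}" for x
    proof (cases "1 - m < x")
      case True
      then show ?thesis using Ginv_bounds[OF res, of x] that \<eta> \<open>0 \<le> l\<close> by auto
    next
      case False
      then have "x \<le> G \<mu> l" using G_upper[OF res, of l] by (simp add: m_def)
      then show ?thesis using Ginv_le[OF res True l1] False by simp
    qed
    have "integral {?s..?t} (Ginv \<mu>) \<le> (\<eta>1 - \<eta>2) * l + min (?t - ?s) (max 0 (?t - (1 - m)))"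
      by (rule has_integral_le[OF I2 I1 I3])
    also have "\<dots> \<le> (\<eta>1 - \<eta>2) * l + m"
    proof -
      have "max 0 (?t - (1 - m)) \<le> m" using \<eta> measure_nonneg[of \<mu> "{l..}"] by (auto simp: m_def)
      then show ?thesis by (simp add: min.coboundedI2)
    qed
    finally have "(\<eta>1 - \<eta>2) * alpha \<mu> \<eta>1 \<eta>2 \<le> (\<eta>1 - \<eta>2) * l + m"
      using \<eta> by (simp add: alpha_def)
    then show ?thesis by (simp add: l_def m_def algebra_simps)
  qed
qed

lemma top_slice_lipschitz: "f \<le> g + e \<Longrightarrow> 0 \<le> e \<Longrightarrow> top_slice \<eta>1 \<eta>2 g \<le> top_slice \<eta>1 \<eta>2 f + e"
  by (auto simp: top_slice_def)

text \<open>Blurring over one grid step moves the argument by one index. In the sums such a shift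
  exchanges a single slice, of weight \<open>1 / Q\<close>, while an error \<open>e\<close> in the
  values costs \<open>e / (\<eta>1 - \<eta>2)\<close>.\<close>

lemma grid_alpha_shift:
  assumes \<eta>: "\<eta>2 < \<eta>1" and Q: "0 < Q" and e: "0 \<le> e"
    and up: "\<And>j. j < Q \<Longrightarrow> F j \<le> g (Suc j) + e" and lo: "\<And>j. Suc j < Q \<Longrightarrow> g j \<le> F (Suc j) + e"
  shows "\<bar>grid_alpha \<eta>1 \<eta>2 Q F - grid_alpha \<eta>1 \<eta>2 Q g\<bar> \<le> 1 / real Q + e / (\<eta>1 - \<eta>2)"
proof -
  let ?p = "top_slice \<eta>1 \<eta>2" and ?w = "\<eta>1 - \<eta>2"
  have b: "0 \<le> ?p x" "?p x \<le> ?w" for x using \<eta> by (auto simp: top_slice_def)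
  obtain Q' where Q': "Q = Suc Q'" using Q by (cases Q) auto
  have "(\<Sum>j<Q. ?p (g j)) \<le> (\<Sum>j<Q. ?p (F j)) + ?w + real Q * e"
  proof -
    have "(\<Sum>j<Q. ?p (g j)) \<le> ?w + (\<Sum>j<Q'. ?p (g (Suc j)))"
      using b(2)[of "g 0"] unfolding Q' by (subst sum.lessThan_Suc_shift) simp
    also have "\<dots> \<le> ?w + (\<Sum>j<Q. ?p (g (Suc j)))" using b by (simp add: Q')
    also have "(\<Sum>j<Q. ?p (g (Suc j))) \<le> (\<Sum>j<Q. ?p (F j) + e)"
      using up e by (intro sum_mono top_slice_lipschitz) auto
    finally show ?thesis by (simp add: sum.distrib)
  qed
  moreover have "(\<Sum>j<Q. ?p (F j)) \<le> (\<Sum>j<Q. ?p (g j)) + ?w + real Q * e"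
  proof -
    have "(\<Sum>j<Q. ?p (F j)) \<le> ?w + (\<Sum>j<Q'. ?p (F (Suc j)))"
      using b(2)[of "F 0"] unfolding Q' by (subst sum.lessThan_Suc_shift) simp
    also have "(\<Sum>j<Q'. ?p (F (Suc j))) \<le> (\<Sum>j<Q'. ?p (g j) + e)"
      using lo e by (intro sum_mono top_slice_lipschitz) (auto simp: Q')
    also have "\<dots> \<le> (\<Sum>j<Q. ?p (g j)) + real Q * e"
      using b(1)[of "g Q'"] e by (simp add: sum.distrib Q' algebra_simps)
    finally show ?thesis by simp
  qed
  ultimately have "\<bar>(\<Sum>j<Q. ?p (F j)) - (\<Sum>j<Q. ?p (g j))\<bar> \<le> ?w + real Q * e" by linarith
  then have "\<bar>(\<Sum>j<Q. ?p (F j)) - (\<Sum>j<Q. ?p (g j))\<bar> / (real Q * ?w) \<le> (?w + real Q * e) / (real Q * ?w)"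
    using \<eta> Q by (intro divide_right_mono) auto
  also have "(?w + real Q * e) / (real Q * ?w) = 1 / real Q + e / ?w"
    using \<eta> Q by (simp add: add_divide_distrib)
  finally show ?thesis
    using \<eta> Q by (simp add: grid_alpha_def diff_divide_distrib[symmetric] abs_mult)
qed

lemma integral_low_prob:
  assumes res: "reservoir \<mu>"
  shows "(\<integral>x. low_prob m t (clip x) \<partial>\<mu>) = (\<Sum>w\<in>rewards m. (\<integral>x. wt (clip x) w \<partial>\<mu>) * of_bool (successes m w \<le> real m * t))"
    "integrable \<mu> (\<lambda>x. low_prob m t (clip x))" "integrable \<mu> (\<lambda>x. wt (clip x) w)"
proof -
  interpret prob_space \<mu> using reservoir_prob[OF res] .
  note s' = measurable_cong_sets[OF reservoir_sets[OF res] refl, simp]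
  have wt_le: "wt q w \<le> 1" if "0 \<le> q" "q \<le> 1" for q w
    using that unfolding wt_def by (intro prod_le_1) auto
  have int: "integrable \<mu> (\<lambda>x. wt (clip x) w)" for w
    by (rule integrable_const_bound[where B = 1]) (use wt_le wt_nonneg in auto)
  then show "integrable \<mu> (\<lambda>x. wt (clip x) w)" .
  show "integrable \<mu> (\<lambda>x. low_prob m t (clip x))"
    unfolding low_prob_def by (intro Bochner_Integration.integrable_sum integrable_mult_left int)
  show "(\<integral>x. low_prob m t (clip x) \<partial>\<mu>) = (\<Sum>w\<in>rewards m. (\<integral>x. wt (clip x) w \<partial>\<mu>) * of_bool (successes m w \<le> real m * t))"
    unfolding low_prob_def by (subst Bochner_Integration.integral_sum) (auto simp: int)
qed

text \<open>Outside a window of half-width \<open>\<kappa>\<close> around \<open>t\<close> the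
  blurred indicator differs from the true one by an exponentially small amount; inside, shifting
  \<open>t\<close> by \<open>\<kappa>\<close> puts the arms on the favourable side.\<close>

lemma integral_low_prob_bounds:
  assumes res: "reservoir \<mu>" and \<kappa>: "0 < \<kappa>" "\<kappa> \<le> 1"
  shows "t + \<kappa> \<le> 1 \<Longrightarrow> (\<integral>x. low_prob m t (clip x) \<partial>\<mu>) \<le> G \<mu> (t + \<kappa>) + exp (- (real m * \<kappa>\<^sup>2 / 2))"
    and "0 \<le> t - \<kappa> \<Longrightarrow> G \<mu> (t - \<kappa>) \<le> (\<integral>x. low_prob m t (clip x) \<partial>\<mu>) + exp (- (real m * \<kappa>\<^sup>2 / 2))"
proof -
  interpret prob_space \<mu> using reservoir_prob[OF res] .
  let ?e = "exp (- (real m * \<kappa>\<^sup>2 / 2))"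
  have ind: "integrable \<mu> (indicator {..s} :: real \<Rightarrow> real)" for s
    by (simp add: reservoir_sets[OF res] less_top[symmetric] emeasure_finite)
  show "(\<integral>x. low_prob m t (clip x) \<partial>\<mu>) \<le> G \<mu> (t + \<kappa>) + ?e" if t: "t + \<kappa> \<le> 1"
  proof -
    have "(\<integral>x. low_prob m t (clip x) \<partial>\<mu>) \<le> (\<integral>x. indicator {..t + \<kappa>} x + ?e \<partial>\<mu>)"
    proof (intro integral_mono integral_low_prob[OF res] Bochner_Integration.integrable_add ind integrable_const)
      fix x
      show "low_prob m t (clip x) \<le> indicator {..t + \<kappa>} x + ?e"
      proof (cases "x \<le> t + \<kappa>")
        case True
        then show ?thesis using low_prob_bounds(2)[of "clip x" m t] by (simp add: add_increasing2)
      next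
        case False
        then have "t + \<kappa> \<le> clip x" using t by (auto simp: clip_def)
        then show ?thesis using low_prob_tails(1)[of "clip x" \<kappa> t m] \<kappa> False by simp
      qed
    qed
    also have "\<dots> = G \<mu> (t + \<kappa>) + ?e"
      using ind prob_space by (simp add: G_def reservoir_space[OF res])
    finally show ?thesis .
  qed
  show "G \<mu> (t - \<kappa>) \<le> (\<integral>x. low_prob m t (clip x) \<partial>\<mu>) + ?e" if t: "0 \<le> t - \<kappa>"
  proof -
    have "G \<mu> (t - \<kappa>) = (\<integral>x. indicator {..t - \<kappa>} x \<partial>\<mu>)" by (simp add: G_def reservoir_space[OF res])
    also have "\<dots> \<le> (\<integral>x. low_prob m t (clip x) + ?e \<partial>\<mu>)"
    proof (intro integral_mono ind Bochner_Integration.integrable_add integral_low_prob[OF res] integrable_const)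
      fix x
      show "indicator {..t - \<kappa>} x \<le> low_prob m t (clip x) + ?e"
      proof (cases "x \<le> t - \<kappa>")
        case False
        then show ?thesis using low_prob_bounds(1)[of "clip x" m t] by simp
      next
        case True
        then have "clip x \<le> t - \<kappa>" using t by (auto simp: clip_def)
        then show ?thesis using low_prob_tails(2)[of "clip x" \<kappa> t m] \<kappa> True by simp
      qed
    qed
    also have "\<dots> = (\<integral>x. low_prob m t (clip x) \<partial>\<mu>) + ?e"
      using integral_low_prob(2)[OF res] by (simp add: prob_space)
    finally show ?thesis .
  qed
qed

section \<open>Optimally tilted Chernoff bound\<close>

text \<open>Index 0 is the moment of dropping, where the successes are bounded above and a negative
  multiplier is allowed; the other checkpoints were passed and get the multiplier \<open>g\<close>.
  Taking \<open>c 0 = - g * A\<close> makes \<open>\<Sum>i. c i * Ms i\<close> vanish, which cancels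
  the true mean. There remains the quadratic form with entries
  \<open>min (a i) (a j) - a i * a j\<close>, the covariance of a Brownian bridge.\<close>

lemma hit_prob_window:
  fixes Ms :: "nat \<Rightarrow> nat" and Ts :: "nat \<Rightarrow> real"
  assumes q: "0 \<le> q" "q \<le> 1" and Ms: "0 < Ms 0" "\<And>i. i \<le> J \<Longrightarrow> Ms i \<le> Ms 0"
    and g: "0 \<le> g" "2 * real J * g \<le> H"
    and z0: "\<And>u. first_hit st \<phi> (Ms 0) u \<Longrightarrow> successes (Ms 0) u \<le> real (Ms 0) * Ts 0"
    and zi: "\<And>u i. first_hit st \<phi> (Ms 0) u \<Longrightarrow> i \<in> {1..J} \<Longrightarrow> real (Ms i) * Ts i \<le> successes (Ms i) u"
  defines "a \<equiv> \<lambda>i. real (Ms i) / real (Ms 0)"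
  shows "hit_prob st \<phi> q [] (Ms 0) \<le> exp (- real (Ms 0) * (g * (\<Sum>i=1..J. a i * (Ts i - Ts 0))
    - q * (1 - q) * exp H / 2 * g\<^sup>2 * ((\<Sum>i=1..J. \<Sum>j=1..J. min (a i) (a j)) - (\<Sum>i=1..J. a i)\<^sup>2)))"
proof -
  define A where "A = (\<Sum>i=1..J. a i)"
  define c where "c i = (if i = 0 then - g * A else g)" for i :: nat
  define n where "n = real (Ms 0)"
  let ?n = n
  have a_n: "a i = real (Ms i) / n" for i by (simp add: a_def n_def)
  have n: "?n > 0" using Ms by (simp add: n_def)
  have Ma: "real (Ms i) = ?n * a i" for i using n by (simp add: a_n)
  have a0: "a 0 = 1" using n by (simp add: a_n n_def)
  have a: "0 \<le> a i" for i using n by (simp add: a_n)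
  have a1: "a i \<le> 1" if "i \<le> J" for i using Ms that n by (simp add: a_n n_def)
  have A: "0 \<le> A" "A \<le> real J"
    unfolding A_def using a sum_bounded_above[of "{1..J}" a 1] a1 by (auto intro!: sum_nonneg)
  have hd: "(\<Sum>i\<in>{0..J}. f i) = f 0 + (\<Sum>i=1..J. f i)" for f :: "nat \<Rightarrow> real"
    by (simp add: sum.atLeast_Suc_atMost)
  have cs: "(\<Sum>i=1..J. c i * f i) = g * (\<Sum>i=1..J. f i)" for f :: "nat \<Rightarrow> real"
    by (simp add: c_def sum_distrib_left)
  let ?Q = "\<Sum>i=1..J. \<Sum>j=1..J. min (a i) (a j)"
  have "hit_prob st \<phi> q [] (Ms 0) \<le> exp (- (\<Sum>i\<in>{0..J}. c i * (real (Ms i) * Ts i)) + q * (\<Sum>j\<in>{0..J}. c j * real (Ms j))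
      + q * (1 - q) * exp H / 2 * (\<Sum>i\<in>{0..J}. \<Sum>j\<in>{0..J}. c i * c j * real (min (Ms i) (Ms j))))"
  proof (rule hit_prob_chernoff[OF q])
    show "(\<Sum>j\<in>{0..J}. \<bar>c j\<bar>) \<le> H"
    proof -
      have "(\<Sum>j\<in>{0..J}. \<bar>c j\<bar>) = g * A + real J * g"
        unfolding hd using g A by (simp add: c_def)
      also have "g * A \<le> g * real J" using g A by (intro mult_left_mono) auto
      finally show ?thesis using g by (simp add: algebra_simps)
    qed
    fix u assume u: "first_hit st \<phi> (Ms 0) u"
    have "(\<Sum>i=1..J. g * (real (Ms i) * Ts i)) \<le> (\<Sum>i=1..J. g * successes (Ms i) u)"
      using g zi[OF u] by (intro sum_mono mult_left_mono) auto
    moreover have "g * A * successes (Ms 0) u \<le> g * A * (real (Ms 0) * Ts 0)"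
      using g A z0[OF u] by (intro mult_left_mono) auto
    ultimately show "(\<Sum>i\<in>{0..J}. c i * (real (Ms i) * Ts i)) \<le> (\<Sum>j\<in>{0..J}. c j * successes (Ms j) u)"
      unfolding hd by (simp add: c_def)
  qed (use Ms in auto)
  also have "(\<Sum>j\<in>{0..J}. c j * real (Ms j)) = 0"
    unfolding hd cs by (simp add: c_def Ma a0 A_def sum_distrib_left[symmetric])
  also have "(\<Sum>i\<in>{0..J}. c i * (real (Ms i) * Ts i)) = ?n * (g * (\<Sum>i=1..J. a i * (Ts i - Ts 0)))"
  proof -
    have e1: "(\<Sum>i=1..J. real (Ms i) * Ts i) = ?n * (\<Sum>i=1..J. a i * Ts i)"
      by (simp only: Ma sum_distrib_left mult.assoc)
    have e2: "(\<Sum>i=1..J. a i * (Ts i - Ts 0)) = (\<Sum>i=1..J. a i * Ts i) - A * Ts 0"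
      by (simp add: right_diff_distrib sum_subtractf A_def sum_distrib_right)
    show ?thesis unfolding hd cs e1 e2 by (simp add: c_def n_def[symmetric] algebra_simps)
  qed
  also have "(\<Sum>i\<in>{0..J}. \<Sum>j\<in>{0..J}. c i * c j * real (min (Ms i) (Ms j))) = ?n * (g\<^sup>2 * (?Q - A\<^sup>2))"
  proof -
    have m: "real (min (Ms i) (Ms j)) = ?n * min (a i) (a j)" for i j
      using n by (cases "Ms i \<le> Ms j") (auto simp: a_n min_def field_simps)
    have m0: "min (a 0) (a j) = a j" "min (a j) (a 0) = a j" if "j \<le> J" for j
      using a1[OF that] by (auto simp: a0 min_def)
    have row: "(\<Sum>j\<in>{0..J}. c j * min (a i) (a j)) = - g * A * a i + g * (\<Sum>j=1..J. min (a i) (a j))" if "i \<le> J" for i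
      unfolding hd cs using m0[OF that] by (simp add: c_def)
    have "(\<Sum>i\<in>{0..J}. \<Sum>j\<in>{0..J}. c i * c j * real (min (Ms i) (Ms j)))
       = ?n * (\<Sum>i\<in>{0..J}. c i * (\<Sum>j\<in>{0..J}. c j * min (a i) (a j)))"
      by (simp only: m sum_distrib_left mult_ac)
    also have "(\<Sum>i\<in>{0..J}. c i * (\<Sum>j\<in>{0..J}. c j * min (a i) (a j)))
       = (\<Sum>i\<in>{0..J}. c i * (- g * A * a i + g * (\<Sum>j=1..J. min (a i) (a j))))"
      by (intro sum.cong refl) (simp only: row atLeastAtMost_iff)
    also have "\<dots> = - g * A * (- g * A + g * A) + g * (\<Sum>i=1..J. - g * A * a i + g * (\<Sum>j=1..J. min (a i) (a j)))"
    proof -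
      have "(\<Sum>j=1..J. min (a 0) (a j)) = A" unfolding A_def by (intro sum.cong) (auto simp: m0)
      then show ?thesis unfolding hd cs by (simp add: c_def a0)
    qed
    also have "(\<Sum>i=1..J. - g * A * a i + g * (\<Sum>j=1..J. min (a i) (a j))) = - g * A * A + g * ?Q"
      by (simp add: sum.distrib sum_distrib_left[symmetric] sum_negf sum_subtractf) (simp add: A_def)
    finally show ?thesis by (simp add: algebra_simps power2_eq_square)
  qed
  finally have "hit_prob st \<phi> q [] (Ms 0) \<le> exp (- (n * (g * (\<Sum>i=1..J. a i * (Ts i - Ts 0)))) + q * 0
      + q * (1 - q) * exp H / 2 * (n * (g\<^sup>2 * (?Q - A\<^sup>2))))" .
  moreover have "- (n * X) + q * 0 + W * (n * (g\<^sup>2 * Y)) = - n * (X - W * g\<^sup>2 * Y)" for X W Y :: real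
    by (simp add: algebra_simps)
  ultimately show ?thesis by (simp only: A_def n_def)
qed

text \<open>Drift and variance of the discretised optimal tilt agree, up to boundary terms.\<close>
lemma tilt_parameters:
  assumes r: "0 < (r::real)"
  obtains x \<epsilon> :: real and J :: nat where "0 < x" "x < 1" "0 < J" "0 < \<epsilon>" "\<epsilon> \<le> 1" "\<epsilon> \<le> x / 2"
    "(\<Sum>i=1..J. real i * x ^ i) - real J ^ 2 * \<epsilon> - real J ^ 3 * \<epsilon>
      - (1 + \<epsilon>) / 2 * ((\<Sum>i=1..J. \<Sum>j=1..J. x ^ max i j) - (\<Sum>i=1..J. x ^ i)\<^sup>2 + 3 * real J ^ 2 * \<epsilon>)
      \<ge> (1 - r) / (2 * (ln x)\<^sup>2)"
proof -
  \<comment> \<open>The parameters are fixed in the order \<open>x\<close> close to 1,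
    \<open>J\<close> large, \<open>\<epsilon>\<close> small. The first choice makes
    \<open>x / (1 - x)^2\<close> nearly equal to \<open>1 / (ln x)^2\<close>.\<close>
  have "((\<lambda>x::real. x * (ln x)\<^sup>2 / (1 - x)\<^sup>2) \<longlongrightarrow> 1) (at_left 1)"
    by real_asymp
  then have "eventually (\<lambda>x::real. x * (ln x)\<^sup>2 / (1 - x)\<^sup>2 > 1 - r) (at_left 1)"
    using r by (intro order_tendstoD) auto
  moreover have "eventually (\<lambda>x::real. x \<in> {0<..<1}) (at_left 1)"
    by (intro eventually_at_leftI) auto
  ultimately have "eventually (\<lambda>x::real. x * (ln x)\<^sup>2 / (1 - x)\<^sup>2 > 1 - r \<and> x \<in> {0<..<1}) (at_left 1)"
    by eventually_elim auto
  then obtain x :: real where x: "x * (ln x)\<^sup>2 / (1 - x)\<^sup>2 > 1 - r" "0 < x" "x < 1"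
    using eventually_happens'[OF trivial_limit_at_left_real] by (metis (no_types, lifting) greaterThanLessThan_iff)
  have lnx: "(ln x)\<^sup>2 > 0" using x by simp
  let ?X = "x / (1 - x)\<^sup>2"
  have X: "?X / 2 > (1 - r) / (2 * (ln x)\<^sup>2)"
    using x lnx by (simp add: field_simps)
  define B where "B J = (\<Sum>i=1..J. real i * x ^ i)" for J
  define F where "F J = (\<Sum>i=1..J. x ^ i)" for J
  have B: "B \<longlonglongrightarrow> ?X"
  proof -
    have "(\<lambda>n. x * (of_nat (Suc n) * x ^ n)) sums (x * (1 / (1 - x)\<^sup>2))"
      by (intro sums_mult geometric_deriv_sums) (use x in auto)
    then have "(\<lambda>n. \<Sum>i<n. x * (of_nat (Suc i) * x ^ i)) \<longlonglongrightarrow> ?X"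
      by (simp add: sums_def)
    also have "(\<lambda>n. \<Sum>i<n. x * (of_nat (Suc i) * x ^ i)) = B"
      by (intro ext) (simp add: B_def sum.atLeast1_atMost_eq mult_ac)
    finally show ?thesis .
  qed
  have F: "F \<longlonglongrightarrow> x / (1 - x)"
  proof -
    have "(\<lambda>n. x * x ^ n) sums (x * (1 / (1 - x)))"
      by (intro sums_mult geometric_sums) (use x in auto)
    then have "(\<lambda>n. \<Sum>i<n. x * x ^ i) \<longlonglongrightarrow> x / (1 - x)"
      by (simp add: sums_def)
    also have "(\<lambda>n. \<Sum>i<n. x * x ^ i) = F"
      by (intro ext) (simp add: F_def sum.atLeast1_atMost_eq)
    finally show ?thesis .
  qed
  \<comment> \<open>There are \<open>2 * k - 1\<close> pairs with maximum \<open>k\<close>.\<close>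
  have Q: "(\<Sum>i=1..J. \<Sum>j=1..J. x ^ max i j) = 2 * B J - F J" for J
  proof (induction J)
    case (Suc J)
    have "(\<Sum>i=1..Suc J. \<Sum>j=1..Suc J. x ^ max i j)
       = (\<Sum>i=1..J. (\<Sum>j=1..J. x ^ max i j) + x ^ Suc J) + (\<Sum>j=1..Suc J. x ^ Suc J)"
    proof -
      have "(\<Sum>j=1..Suc J. x ^ max i j) = (\<Sum>j=1..J. x ^ max i j) + x ^ Suc J" if "i \<in> {1..J}" for i
        using that by (simp add: max_def del: power_Suc)
      moreover have "(\<Sum>j=1..Suc J. x ^ max (Suc J) j) = (\<Sum>j=1..Suc J. x ^ Suc J)"
        by (intro sum.cong) (auto simp: max_def)
      ultimately show ?thesis
        by (subst sum.cl_ivl_Suc) (simp del: power_Suc sum.cl_ivl_Suc)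
    qed
    also have "\<dots> = (\<Sum>i=1..J. \<Sum>j=1..J. x ^ max i j) + (2 * real (Suc J) - 1) * x ^ Suc J"
      by (simp add: sum.distrib algebra_simps)
    also have "\<dots> = 2 * B (Suc J) - F (Suc J)"
    proof -
      have "B (Suc J) = B J + real (Suc J) * x ^ Suc J" "F (Suc J) = F J + x ^ Suc J"
        by (simp_all add: B_def F_def del: power_Suc of_nat_Suc)
      then show ?thesis unfolding Suc left_diff_distrib mult.assoc by linarith
    qed
    finally show ?case .
  qed (simp add: B_def F_def)
  \<comment> \<open>In the limit \<open>F + F^2 = x / (1 - x)^2\<close>, so variance and drift
    coincide and half of the drift is left.\<close>
  have "(\<lambda>J. B J - (2 * B J - F J - (F J)\<^sup>2) / 2) \<longlonglongrightarrow> ?X - (2 * ?X - x / (1 - x) - (x / (1 - x))\<^sup>2) / 2"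
    by (intro tendsto_intros B F) auto
  also have "?X - (2 * ?X - x / (1 - x) - (x / (1 - x))\<^sup>2) / 2 = ?X / 2"
    using x by (simp add: divide_simps) (simp add: power2_eq_square algebra_simps)
  finally have "eventually (\<lambda>J. B J - (2 * B J - F J - (F J)\<^sup>2) / 2 > (1 - r) / (2 * (ln x)\<^sup>2) \<and> J > 0) sequentially"
    using X by (intro eventually_conj order_tendstoD eventually_gt_at_top) auto
  then obtain J where J: "B J - (2 * B J - F J - (F J)\<^sup>2) / 2 > (1 - r) / (2 * (ln x)\<^sup>2)" "J > 0"
    using eventually_happens'[OF sequentially_bot] by blast
  have "((\<lambda>\<epsilon>. B J - real J ^ 2 * \<epsilon> - real J ^ 3 * \<epsilon> - (1 + \<epsilon>) / 2 * (2 * B J - F J - (F J)\<^sup>2 + 3 * real J ^ 2 * \<epsilon>))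
     \<longlongrightarrow> B J - real J ^ 2 * 0 - real J ^ 3 * 0 - (1 + 0) / 2 * (2 * B J - F J - (F J)\<^sup>2 + 3 * real J ^ 2 * 0)) (at_right 0)"
    by (intro tendsto_intros) auto
  then have "eventually (\<lambda>\<epsilon>. B J - real J ^ 2 * \<epsilon> - real J ^ 3 * \<epsilon> - (1 + \<epsilon>) / 2 * (2 * B J - F J - (F J)\<^sup>2 + 3 * real J ^ 2 * \<epsilon>)
     > (1 - r) / (2 * (ln x)\<^sup>2)) (at_right 0)"
    using J by (intro order_tendstoD) auto
  moreover have "eventually (\<lambda>\<epsilon>::real. \<epsilon> \<in> {0<..<min 1 (x/2)}) (at_right 0)"
    using x by (intro eventually_at_rightI[where b = "min 1 (x/2)"]) auto
  ultimately have "eventually (\<lambda>\<epsilon>. B J - real J ^ 2 * \<epsilon> - real J ^ 3 * \<epsilon> - (1 + \<epsilon>) / 2 * (2 * B J - F J - (F J)\<^sup>2 + 3 * real J ^ 2 * \<epsilon>)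
     > (1 - r) / (2 * (ln x)\<^sup>2) \<and> \<epsilon> \<in> {0<..<min 1 (x/2)}) (at_right 0)"
    by eventually_elim auto
  then obtain \<epsilon> where \<epsilon>: "B J - real J ^ 2 * \<epsilon> - real J ^ 3 * \<epsilon> - (1 + \<epsilon>) / 2 * (2 * B J - F J - (F J)\<^sup>2 + 3 * real J ^ 2 * \<epsilon>)
     > (1 - r) / (2 * (ln x)\<^sup>2)" "\<epsilon> \<in> {0<..<min 1 (x/2)}"
    using eventually_happens'[OF trivial_limit_at_right_real] by blast
  have "(\<Sum>i=1..J. real i * x ^ i) - real J ^ 2 * \<epsilon> - real J ^ 3 * \<epsilon>
      - (1 + \<epsilon>) / 2 * ((\<Sum>i=1..J. \<Sum>j=1..J. x ^ max i j) - (\<Sum>i=1..J. x ^ i)\<^sup>2 + 3 * real J ^ 2 * \<epsilon>)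
      \<ge> (1 - r) / (2 * (ln x)\<^sup>2)"
    using \<epsilon>(1) unfolding Q B_def F_def by linarith
  then show ?thesis
    using x J \<epsilon> by (intro that[of x J \<epsilon>]) auto
qed

text \<open>For the multiplier \<open>g = d / \<sigma>\<close> drift and variance both scale like
  \<open>d^2\<close>, and it is nearly optimal because they nearly agree. In \<open>tilt\<close>,
  \<open>J ^ 2 * \<epsilon>\<close> pays for rounding in the drift,
  \<open>J ^ 3 * \<epsilon>\<close> for the curvature of the thresholds,
  \<open>1 + \<epsilon>\<close> for the variance of a reward and
  \<open>3 * J ^ 2 * \<epsilon>\<close> for rounding in the quadratic form.\<close>

lemma hit_prob_window_sharp:
  fixes Ms :: "nat \<Rightarrow> nat" and Ts :: "nat \<Rightarrow> real" and x r \<epsilon> \<sigma> d q :: real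
  assumes tilt: "(\<Sum>i=1..J. real i * x ^ i) - real J ^ 2 * \<epsilon> - real J ^ 3 * \<epsilon>
      - (1 + \<epsilon>) / 2 * ((\<Sum>i=1..J. \<Sum>j=1..J. x ^ max i j) - (\<Sum>i=1..J. x ^ i)\<^sup>2 + 3 * real J ^ 2 * \<epsilon>)
      \<ge> (1 - r) / (2 * (ln x)\<^sup>2)"
    and x: "0 < x" "x < 1" and \<epsilon>: "0 \<le> \<epsilon>" and \<sigma>: "0 < \<sigma>" and d: "0 \<le> d" "d \<le> \<epsilon> * \<sigma>"
    and q: "0 \<le> q" "q \<le> 1" and v: "q * (1 - q) * exp (2 * real J * (d / \<sigma>)) \<le> (1 + \<epsilon>) * \<sigma>\<^sup>2"
    and Ms: "0 < Ms 0" "\<And>i. i \<le> J \<Longrightarrow> Ms i \<le> Ms 0"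
    and ratio: "\<And>i. i \<in> {1..J} \<Longrightarrow> \<bar>real (Ms i) / real (Ms 0) - x ^ i\<bar> \<le> \<epsilon>"
    and Ts: "\<And>i. i \<in> {1..J} \<Longrightarrow> real i * d * \<sigma> - (real i * d)\<^sup>2 \<le> Ts i - Ts 0"
    and z0: "\<And>u. first_hit st \<phi> (Ms 0) u \<Longrightarrow> successes (Ms 0) u \<le> real (Ms 0) * Ts 0"
    and zi: "\<And>u i. first_hit st \<phi> (Ms 0) u \<Longrightarrow> i \<in> {1..J} \<Longrightarrow> real (Ms i) * Ts i \<le> successes (Ms i) u"
  shows "hit_prob st \<phi> q [] (Ms 0) \<le> exp (- ((1 - r) * d\<^sup>2 / (2 * (ln x)\<^sup>2) * real (Ms 0)))"
proof -
  define a where "a i = real (Ms i) / real (Ms 0)" for i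
  define g where "g = d / \<sigma>"
  define H where "H = 2 * real J * g"
  let ?B = "\<Sum>i=1..J. real i * x ^ i" and ?F = "\<Sum>i=1..J. x ^ i" and ?X = "\<Sum>i=1..J. \<Sum>j=1..J. x ^ max i j"
  let ?A = "\<Sum>i=1..J. a i" and ?Q = "\<Sum>i=1..J. \<Sum>j=1..J. min (a i) (a j)"
  have g: "0 \<le> g" "g \<le> \<epsilon>" using d \<sigma> by (auto simp: g_def field_simps)
  have a: "0 \<le> a i" for i by (simp add: a_def)
  have a1: "a i \<le> 1" if "i \<in> {1..J}" for i using Ms that by (simp add: a_def)
  have r1: "a i \<le> x ^ i + \<epsilon>" "x ^ i - \<epsilon> \<le> a i" if "i \<in> {1..J}" for i
    using ratio[OF that] by (auto simp: a_def abs_le_iff)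
  have sJ: "(\<Sum>i=1..J. f i) \<le> real J * c" if "\<And>i. i \<in> {1..J} \<Longrightarrow> f i \<le> c" for f :: "nat \<Rightarrow> real" and c
    using sum_bounded_above[of "{1..J}" f c] that by simp
  have drift: "d\<^sup>2 * (?B - real J ^ 2 * \<epsilon> - real J ^ 3 * \<epsilon>) \<le> g * (\<Sum>i=1..J. a i * (Ts i - Ts 0))"
  proof -
    have "(\<Sum>i=1..J. a i * (real i * d * \<sigma> - (real i * d)\<^sup>2)) \<le> (\<Sum>i=1..J. a i * (Ts i - Ts 0))"
      using Ts a by (intro sum_mono mult_left_mono) auto
    then have "g * (\<Sum>i=1..J. a i * (real i * d * \<sigma> - (real i * d)\<^sup>2)) \<le> g * (\<Sum>i=1..J. a i * (Ts i - Ts 0))"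
      using g by (intro mult_left_mono)
    moreover have "g * (\<Sum>i=1..J. a i * (real i * d * \<sigma> - (real i * d)\<^sup>2))
        = d\<^sup>2 * ((\<Sum>i=1..J. real i * a i) - g * (\<Sum>i=1..J. a i * (real i)\<^sup>2))"
      using \<sigma> by (simp add: sum_distrib_left sum_subtractf[symmetric] g_def power2_eq_square field_simps)
    moreover have "?B - real J ^ 2 * \<epsilon> \<le> (\<Sum>i=1..J. real i * a i)"
    proof -
      have "?B - (\<Sum>i=1..J. real i * a i) = (\<Sum>i=1..J. real i * (x ^ i - a i))"
        by (simp add: sum_subtractf[symmetric] right_diff_distrib)
      also have "\<dots> \<le> real J * (real J * \<epsilon>)"
      proof (rule sJ)
        fix i assume i: "i \<in> {1..J}"
        have "real i * (x ^ i - a i) \<le> real i * \<epsilon>" using r1(2)[OF i] by (intro mult_left_mono) auto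
        also have "\<dots> \<le> real J * \<epsilon>" using i \<epsilon> by (intro mult_right_mono) auto
        finally show "real i * (x ^ i - a i) \<le> real J * \<epsilon>" .
      qed
      finally show ?thesis by (simp add: power2_eq_square algebra_simps)
    qed
    moreover have "g * (\<Sum>i=1..J. a i * (real i)\<^sup>2) \<le> real J ^ 3 * \<epsilon>"
    proof -
      have "(\<Sum>i=1..J. a i * (real i)\<^sup>2) \<le> real J * (real J)\<^sup>2"
      proof (rule sJ)
        fix i assume i: "i \<in> {1..J}"
        have "a i * (real i)\<^sup>2 \<le> 1 * (real J)\<^sup>2"
          using i a1[OF i] a by (intro mult_mono power_mono) auto
        then show "a i * (real i)\<^sup>2 \<le> (real J)\<^sup>2" by simp
      qed
      then have "g * (\<Sum>i=1..J. a i * (real i)\<^sup>2) \<le> \<epsilon> * (real J * (real J)\<^sup>2)"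
        using g a by (intro mult_mono sum_nonneg) auto
      then show ?thesis by (simp add: power2_eq_square power3_eq_cube mult_ac)
    qed
    ultimately have "?B - real J ^ 2 * \<epsilon> - real J ^ 3 * \<epsilon> \<le> (\<Sum>i=1..J. real i * a i) - g * (\<Sum>i=1..J. a i * (real i)\<^sup>2)"
      and "d\<^sup>2 * ((\<Sum>i=1..J. real i * a i) - g * (\<Sum>i=1..J. a i * (real i)\<^sup>2)) \<le> g * (\<Sum>i=1..J. a i * (Ts i - Ts 0))"
      by linarith+
    then show ?thesis by (meson mult_left_mono order_trans zero_le_power2)
  qed
  have Q: "?Q - ?A\<^sup>2 \<le> ?X - ?F\<^sup>2 + 3 * real J ^ 2 * \<epsilon>"
  proof -
    have "?Q - ?X = (\<Sum>i=1..J. \<Sum>j=1..J. min (a i) (a j) - x ^ max i j)"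
      by (simp add: sum_subtractf)
    also have "\<dots> \<le> real J * (real J * \<epsilon>)"
    proof (intro sJ)
      fix i j assume "i \<in> {1..J}" "j \<in> {1..J}"
      then show "min (a i) (a j) - x ^ max i j \<le> \<epsilon>"
        using r1[of i] r1[of j] by (auto simp: max_def min_def)
    qed
    finally have 1: "?Q \<le> ?X + real J ^ 2 * \<epsilon>" by (simp add: power2_eq_square)
    have "?F - ?A = (\<Sum>i=1..J. x ^ i - a i)" by (simp add: sum_subtractf)
    also have "\<dots> \<le> real J * \<epsilon>"
    proof (rule sJ)
      fix i assume "i \<in> {1..J}"
      from r1(2)[OF this] show "x ^ i - a i \<le> \<epsilon>" by linarith
    qed
    finally have FA: "?F - ?A \<le> real J * \<epsilon>" .
    have F: "0 \<le> ?F" using x by (intro sum_nonneg) auto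
    have "?F \<le> real J * 1" using x by (intro sJ) (auto intro: power_le_one)
    then have "?F * (?F - ?A) \<le> real J * (real J * \<epsilon>)"
      using FA F \<epsilon> by (intro order_trans[OF mult_left_mono[OF FA F]] mult_right_mono) auto
    moreover have "?F\<^sup>2 - ?A\<^sup>2 = 2 * (?F * (?F - ?A)) - (?F - ?A)\<^sup>2"
      by (simp add: power2_eq_square algebra_simps)
    ultimately have "?F\<^sup>2 - ?A\<^sup>2 \<le> 2 * (real J * (real J * \<epsilon>))"
      using zero_le_power2[of "?F - ?A"] by linarith
    with 1 show ?thesis by (simp add: power2_eq_square)
  qed
  have Y: "0 \<le> ?X - ?F\<^sup>2 + 3 * real J ^ 2 * \<epsilon>"
  proof -
    have "?F\<^sup>2 = (\<Sum>i=1..J. \<Sum>j=1..J. x ^ i * x ^ j)"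
      by (simp add: power2_eq_square sum_product)
    also have "\<dots> \<le> ?X"
      unfolding power_add[symmetric] using x by (intro sum_mono power_decreasing) auto
    finally show ?thesis using \<epsilon> by simp
  qed
  have var: "q * (1 - q) * exp H / 2 * g\<^sup>2 * (?Q - ?A\<^sup>2)
      \<le> d\<^sup>2 * ((1 + \<epsilon>) / 2 * (?X - ?F\<^sup>2 + 3 * real J ^ 2 * \<epsilon>))"
  proof -
    have "q * (1 - q) * exp H / 2 * g\<^sup>2 * (?Q - ?A\<^sup>2)
      \<le> q * (1 - q) * exp H / 2 * g\<^sup>2 * (?X - ?F\<^sup>2 + 3 * real J ^ 2 * \<epsilon>)"
      using q by (intro mult_left_mono Q) auto
    also have "\<dots> \<le> (1 + \<epsilon>) * \<sigma>\<^sup>2 / 2 * g\<^sup>2 * (?X - ?F\<^sup>2 + 3 * real J ^ 2 * \<epsilon>)"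
      using v Y by (intro mult_right_mono divide_right_mono) (auto simp: H_def g_def)
    also have "\<dots> = d\<^sup>2 * ((1 + \<epsilon>) / 2 * (?X - ?F\<^sup>2 + 3 * real J ^ 2 * \<epsilon>))"
    proof -
      have "\<sigma>\<^sup>2 * g\<^sup>2 = d\<^sup>2" using \<sigma> by (simp add: g_def power_divide)
      moreover have "(1 + \<epsilon>) * \<sigma>\<^sup>2 / 2 * g\<^sup>2 * W = \<sigma>\<^sup>2 * g\<^sup>2 * ((1 + \<epsilon>) / 2 * W)" for W
        by simp
      ultimately show ?thesis by simp
    qed
    finally show ?thesis .
  qed
  let ?G = "g * (\<Sum>i=1..J. a i * (Ts i - Ts 0)) - q * (1 - q) * exp H / 2 * g\<^sup>2 * (?Q - ?A\<^sup>2)"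
  have "d\<^sup>2 * ((1 - r) / (2 * (ln x)\<^sup>2)) \<le> d\<^sup>2 * (?B - real J ^ 2 * \<epsilon> - real J ^ 3 * \<epsilon>
      - (1 + \<epsilon>) / 2 * (?X - ?F\<^sup>2 + 3 * real J ^ 2 * \<epsilon>))"
    using tilt by (intro mult_left_mono) auto
  also have "\<dots> \<le> ?G"
    using drift var unfolding right_diff_distrib[of "d\<^sup>2"] by linarith
  finally have "real (Ms 0) * (d\<^sup>2 * ((1 - r) / (2 * (ln x)\<^sup>2))) \<le> real (Ms 0) * ?G"
    by (intro mult_left_mono) auto
  then have "exp (- real (Ms 0) * ?G) \<le> exp (- ((1 - r) * d\<^sup>2 / (2 * (ln x)\<^sup>2) * real (Ms 0)))"
    by (simp add: mult_ac)
  moreover have "hit_prob st \<phi> q [] (Ms 0) \<le> exp (- real (Ms 0) * ?G)"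
    unfolding a_def by (rule hit_prob_window[where Ms = Ms and Ts = Ts and J = J and H = H, OF q Ms g(1) _ z0 zi]) (auto simp: H_def)
  ultimately show ?thesis by (rule order_trans[rotated])
qed

section \<open>The stopping rule\<close>

lemma hit_prob_eq_0:
  assumes "0 \<le> q" "q \<le> 1" "\<And>u. \<not> first_hit st \<phi> M u"
  shows "hit_prob st \<phi> q [] M = 0"
proof (rule ccontr)
  assume "hit_prob st \<phi> q [] M \<noteq> 0"
  with hit_prob_bounds[OF assms(1,2), of st \<phi> "[]" M] have pos: "hit_prob st \<phi> q [] M > 0" by simp
  \<comment> \<open>Without a first hit the condition on \<open>z\<close> is void, so
    \<open>z = 1 - ln h\<close> may be taken for the probability \<open>h\<close> itself; this gives
    \<open>h \<le> exp (-1) * h\<close>.\<close>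
  have "hit_prob st \<phi> q [] M \<le> exp (- (1 - ln (hit_prob st \<phi> q [] M)) + q * (\<Sum>j\<in>({}::nat set). 0 * real 0)
      + q * (1 - q) * exp 0 / 2 * (\<Sum>i\<in>({}::nat set). \<Sum>j\<in>({}::nat set). 0 * 0 * real (min 0 0)))"
    by (rule hit_prob_chernoff) (use assms in auto)
  also have "\<dots> = exp (-1) * hit_prob st \<phi> q [] M" using pos by (simp add: exp_diff exp_minus field_simps)
  finally show False using pos by simp
qed

text \<open>Taylor bound, as the sine is 1-Lipschitz. It turns an angular step into a step of the
  threshold with slope \<open>sin \<theta> / 2\<close>, the standard deviation of a reward with mean
  \<open>(1 - cos \<theta>) / 2\<close>.\<close>

lemma cos_diff_lower:
  fixes \<theta> y :: real
  assumes "0 \<le> y"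
  shows "y * sin \<theta> - y\<^sup>2 / 2 \<le> cos \<theta> - cos (\<theta> + y)"
proof -
  let ?g = "\<lambda>t. cos \<theta> - cos (\<theta> + t) - t * sin \<theta> + t\<^sup>2 / 2"
  have lip: "sin \<theta> - sin (\<theta> + t) \<le> t" if "0 \<le> t" for t
  proof -
    have "sin \<theta> - sin (\<theta> + t) = 2 * (sin (- t / 2) * cos ((\<theta> + (\<theta> + t)) / 2))"
      by (subst sin_diff_sin) simp
    also have "\<dots> \<le> 2 * \<bar>sin (- t / 2) * cos ((\<theta> + (\<theta> + t)) / 2)\<bar>" by simp
    also have "\<dots> \<le> 2 * (\<bar>- t / 2\<bar> * 1)"
      unfolding abs_mult by (intro mult_mono abs_sin_x_le_abs_x) auto
    finally show ?thesis using that by simp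
  qed
  have "?g 0 \<le> ?g y"
  proof (rule DERIV_nonneg_imp_nondecreasing[OF assms])
    fix t assume "0 \<le> t" "t \<le> y"
    have "(?g has_real_derivative (sin (\<theta> + t) - sin \<theta> + t)) (at t)"
      by (auto intro!: derivative_eq_intros)
    moreover have "sin (\<theta> + t) - sin \<theta> + t \<ge> 0" using lip[OF \<open>0 \<le> t\<close>] by simp
    ultimately show "\<exists>z. (?g has_real_derivative z) (at t) \<and> 0 \<le> z" by blast
  qed
  then show ?thesis by simp
qed

definition threshold_rule :: "nat \<Rightarrow> (nat \<Rightarrow> nat) \<Rightarrow> (nat \<Rightarrow> real) \<Rightarrow> bool list \<Rightarrow> bool" where
  "threshold_rule k0 M T w \<longleftrightarrow> (\<exists>k\<le>k0. length w = M k \<and> successes (M k) w < real (M k) * T k)"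

lemma first_hit_threshold_rule:
  assumes "first_hit (threshold_rule k0 M T) \<phi> n u" "j \<le> k0" "0 < M j" "M j < n"
  shows "real (M j) * T j \<le> successes (M j) u"
proof -
  from assms have "\<not> threshold_rule k0 M T (take (M j) u)" "length u = n"
    by (auto simp: first_hit_def)
  then show ?thesis
    using assms by (auto simp: threshold_rule_def successes_take not_less)
qed

abbreviation ang :: "real \<Rightarrow> real" where
  "ang x \<equiv> arccos (1 - 2 * x)"

text \<open>
Thresholds are checked only after \<open>M k\<close> pulls, geometrically spaced with ratio \<open>1 / x\<close> close to \<open>1\<close>. The
first check, after about \<open>L = ln N\<close> pulls, removes most poor arms; it carries no large deviation cost, but
\<open>L\<close> pulls at the price \<open>1 / L\<^sup>2\<close> each are negligible against the fraction of good arms. The next check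
comes only at \<open>R = L powr (5/2)\<close>, beyond the scale \<open>L\<^sup>2\<close> on which a drop of order \<open>1 / L\<close> becomes visible,
and its threshold lies lower by the constant \<open>a - a'\<close>, which makes being dropped there unlikely.
\<close>

locale schedule =
  fixes b0 b a' a u x \<epsilon> r \<eta> :: real and J N :: nat
  assumes ord: "0 \<le> b0" "b0 < b" "b < a'" "a' < a" "a < u" "u \<le> 1"
    and x: "0 < x" "x < 1" and \<epsilon>: "0 < \<epsilon>" "\<epsilon> \<le> 1" "\<epsilon> \<le> x / 2" and r: "0 < r" "r < 1" and \<eta>: "0 < \<eta>"
    and J: "0 < J"
    and tilt: "(\<Sum>i=1..J. real i * x ^ i) - real J ^ 2 * \<epsilon> - real J ^ 3 * \<epsilon>
      - (1 + \<epsilon>) / 2 * ((\<Sum>i=1..J. \<Sum>j=1..J. x ^ max i j) - (\<Sum>i=1..J. x ^ i)\<^sup>2 + 3 * real J ^ 2 * \<epsilon>)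
      \<ge> (1 - r / 2) / (2 * (ln x)\<^sup>2)"
begin

definition "L = ln (real N)"
definition "R = L\<^sup>2 * sqrt L"
text \<open>Among the levels of the locale, arms below \<open>b0\<close> count as failures and arms
  from \<open>u\<close> on as good; \<open>a\<close> is the threshold of the first check, and the
  curve runs from \<open>a'\<close> down to \<open>b\<close>, over the angular distance
  \<open>D\<close>.\<close>

definition "D = ang a' - ang b"
text \<open>From one check to the next \<open>ln t\<close> grows by about \<open>- ln x\<close>;
  with this step the curve uses up at most \<open>D\<close> while \<open>ln t\<close> grows by
  \<open>L\<close>.\<close>

definition "d = D * (- ln x) / L"
text \<open>A lower bound for the standard deviation \<open>sqrt (t * (1 - t))\<close> at all
  thresholds \<open>t\<close> between \<open>b\<close> and \<open>a'\<close>.\<close>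

definition "\<sigma>0 = sqrt (b * (1 - a'))"
text \<open>Within this distance of a threshold on the curve, the variance
  \<open>q * (1 - q)\<close> exceeds that of the threshold by a factor of at most
  \<open>1 + \<epsilon> / 3\<close>.\<close>

definition "\<kappa> = \<sigma>0\<^sup>2 * \<epsilon> / 3"
definition "rate = (1 - r) * D\<^sup>2 / (2 * L\<^sup>2)"
text \<open>The exponent achieved at a single late check; the gap to \<open>rate\<close> pays for
  the sum over the checks.\<close>

definition "rate' = (1 - r / 2) * D\<^sup>2 / (2 * L\<^sup>2)"
text \<open>Since \<open>1 / x ^ Suc k0\<close> exceeds \<open>N\<close>, the check after
  \<open>k0\<close> would lie beyond the budget once \<open>R \<ge> 1\<close>.\<close>

definition "k0 = nat \<lfloor>L / (- ln x)\<rfloor>"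
definition "M k = (if k = 0 then nat \<lceil>L\<rceil> else nat \<lceil>R / x ^ k\<rceil>)"
definition "T k = (if k = 0 then a else (1 - cos (ang a' - real k * d)) / 2)"
definition "st = threshold_rule k0 M T"

lemma D_pos: "0 < D"
  unfolding D_def using ord by (simp add: arccos_less_arccos)

lemma lnx: "ln x < 0"
  using x by simp

lemma \<sigma>0: "0 < \<sigma>0" "\<sigma>0\<^sup>2 = b * (1 - a')" "\<sigma>0\<^sup>2 \<le> 1"
proof -
  have "0 < b * (1 - a')" using ord by simp
  then show "0 < \<sigma>0" "\<sigma>0\<^sup>2 = b * (1 - a')" by (simp_all add: \<sigma>0_def)
  have "b * (1 - a') \<le> 1 * 1" using ord by (intro mult_mono) auto
  then show "\<sigma>0\<^sup>2 \<le> 1" using \<open>\<sigma>0\<^sup>2 = b * (1 - a')\<close> by simp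
qed

lemma \<kappa>: "0 < \<kappa>" "\<kappa> \<le> 1"
proof -
  show "0 < \<kappa>" using \<sigma>0(1) \<epsilon>(1) unfolding \<kappa>_def by (intro divide_pos_pos mult_pos_pos) auto
  have "\<sigma>0\<^sup>2 * \<epsilon> \<le> 1 * 1" using \<sigma>0 \<epsilon> by (intro mult_mono) auto
  then show "\<kappa> \<le> 1" by (simp add: \<kappa>_def)
qed

end

text \<open>All that has to hold for large budgets. As \<open>R\<close> is \<open>L\<close> to the
  power 5/2, \<open>rate * R\<close> has the order of \<open>sqrt L\<close>: small against the gain
  of order \<open>L\<close> in \<open>early\<close>, yet large against the logarithm of the number
  of checks, which is what \<open>late\<close> demands.\<close>

locale large_schedule = schedule +
  assumes L1: "1 \<le> L"
    and R1: "1 \<le> R * (1 / x - 1)" "L + 1 \<le> R / x" "1 / R \<le> \<epsilon>"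
    and d1: "d \<le> \<epsilon> * \<sigma>0" "exp (2 * real J * (d / \<sigma>0)) \<le> 1 + \<epsilon> / 3"
    and rate1: "rate * (R / x + 1) \<le> L" "4 * rate / x \<le> (b - b0)\<^sup>2" "rate' \<le> \<kappa>\<^sup>2 * x / 4"
    and early: "exp (rate * (R / x ^ J + 1) - ((a - a') / 2)\<^sup>2 * L / 2) * (L / (- ln x)) \<le> \<eta> / 4"
    and late: "exp (- (r / 2 * D\<^sup>2 / (2 * L\<^sup>2) * R)) * (L / (- ln x)) \<le> \<eta> / 4"
    and first: "exp (rate * (L + 1)) \<le> 1 + \<eta> / 4" "exp (- ((u - a)\<^sup>2 * L / 2)) \<le> \<eta> / 4"
begin

lemma N1: "1 \<le> real N" "exp L = real N"
proof -
  have "N \<noteq> 0" using L1 unfolding L_def by (intro notI) simp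
  then show "1 \<le> real N" "exp L = real N" by (simp_all add: L_def)
qed

lemma R_pos: "0 < R"
  using L1 by (simp add: R_def)

lemma d_nonneg: "0 \<le> d"
  unfolding d_def using L1 D_pos lnx by (intro divide_nonneg_pos mult_nonneg_nonneg) auto

lemma rate_pos: "0 \<le> rate" "rate \<le> rate'" "rate' - rate = r / 2 * D\<^sup>2 / (2 * L\<^sup>2)"
proof -
  show "0 \<le> rate" using r by (simp add: rate_def)
  show eq: "rate' - rate = r / 2 * D\<^sup>2 / (2 * L\<^sup>2)"
    by (simp add: rate_def rate'_def diff_divide_distrib[symmetric] algebra_simps)
  have "0 \<le> r / 2 * D\<^sup>2 / (2 * L\<^sup>2)" using r by simp
  with eq show "rate \<le> rate'" by linarith
qed

lemma M0: "L \<le> real (M 0)" "real (M 0) \<le> L + 1" "0 < M 0"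
  using L1 unfolding M_def by auto

lemma M_bounds:
  assumes "1 \<le> k"
  shows "R / x ^ k \<le> real (M k)" "real (M k) \<le> R / x ^ k + 1"
proof -
  have "0 < R / x ^ k" using R_pos x by simp
  then show "R / x ^ k \<le> real (M k)" "real (M k) \<le> R / x ^ k + 1"
    using assms unfolding M_def by auto
qed

lemma M_less: "i < j \<Longrightarrow> M i < M j"
proof (rule lift_Suc_mono_less[of M])
  fix n
  show "M n < M (Suc n)"
  proof (cases "n = 0")
    case True
    have "real (M 0) < L + 1"
      using L1 ceiling_correct[of L] by (simp add: M_def)
    then have "real (M 0) < real (M 1)" using R1 M_bounds(1)[of 1] by simp
    then show ?thesis using True by simp
  next
    case False
    have "1 \<le> R / x ^ n * (1 / x - 1)"
    proof -
      have "R * (1 / x - 1) \<le> R / x ^ n * (1 / x - 1)"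
        using x R_pos by (intro mult_right_mono) (auto simp: field_simps power_le_one)
      with R1 show ?thesis by linarith
    qed
    moreover have "R / x ^ Suc n = R / x ^ n * (1 / x)" by (simp add: mult.commute)
    ultimately have "R / x ^ n + 1 \<le> R / x ^ Suc n"
      unfolding right_diff_distrib mult_1_right by linarith
    moreover have "real (M n) < R / x ^ n + 1"
    proof -
      have "0 < R / x ^ n" using R_pos x by simp
      then show ?thesis using False unfolding M_def by auto linarith
    qed
    ultimately have "real (M n) < real (M (Suc n))" using M_bounds(1)[of "Suc n"] by linarith
    then show ?thesis by simp
  qed
qed

lemma M_pos: "0 < M k"
  using M_less[of 0 k] M0 by (cases "k = 0") auto

lemma M_inj: "M i = M j \<longleftrightarrow> i = j"
  using M_less[of i j] M_less[of j i] by (cases i j rule: linorder_cases) auto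

lemma M_mono: "i \<le> j \<Longrightarrow> M i \<le> M j"
  using M_less[of i j] by (cases "i = j") auto

text \<open>Check times are rounded up by at most 1, which is at most a fraction
  \<open>1 / R \<le> \<epsilon>\<close> of \<open>R / x ^ k\<close>.\<close>

lemma M_ratio:
  assumes "i < k"
  shows "\<bar>real (M (k - i)) / real (M k) - x ^ i\<bar> \<le> \<epsilon>"
proof -
  define Rk where "Rk = R / x ^ k"
  have k: "1 \<le> k" "1 \<le> k - i" using assms by auto
  have xi: "0 < x ^ i" "x ^ i \<le> 1" using x by (auto intro: power_le_one)
  have Rk: "0 < Rk" "R \<le> Rk" using x R_pos by (auto simp: Rk_def field_simps power_le_one)
  have "x ^ k = x ^ (k - i) * x ^ i" using assms by (simp add: power_add[symmetric])
  then have Ri: "R / x ^ (k - i) = Rk * x ^ i" using x by (simp add: Rk_def)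
  have Mk: "Rk \<le> real (M k)" "real (M k) \<le> Rk + 1" and Mi: "Rk * x ^ i \<le> real (M (k - i))" "real (M (k - i)) \<le> Rk * x ^ i + 1"
    using M_bounds[OF k(1)] M_bounds[OF k(2)] unfolding Ri Rk_def by auto
  have "1 / Rk \<le> 1 / R" using Rk R_pos by (simp add: frac_le)
  with R1 have e: "1 / Rk \<le> \<epsilon>" by linarith
  have "real (M (k - i)) / real (M k) \<le> (Rk * x ^ i + 1) / Rk"
    using Mk Mi Rk xi by (intro frac_le) auto
  also have "\<dots> = x ^ i + 1 / Rk" using Rk by (simp add: field_simps)
  finally have up: "real (M (k - i)) / real (M k) \<le> x ^ i + \<epsilon>" using e by linarith
  have "x ^ i - 1 / Rk \<le> Rk * x ^ i / (Rk + 1)"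
  proof -
    have "x ^ i / (Rk + 1) \<le> 1 / Rk" using Rk xi by (intro frac_le) auto
    moreover have "Rk * x ^ i / (Rk + 1) = x ^ i - x ^ i / (Rk + 1)" using Rk by (simp add: field_simps)
    ultimately show ?thesis by linarith
  qed
  also have "\<dots> \<le> real (M (k - i)) / real (M k)"
    using Mk Mi Rk xi by (intro frac_le) auto
  finally show ?thesis using up e by linarith
qed

lemma k0_le: "k \<le> k0 \<Longrightarrow> real k * (- ln x) \<le> L"
proof -
  assume "k \<le> k0"
  have "0 \<le> L / (- ln x)" using L1 lnx by (intro divide_nonneg_pos) auto
  then have "real k0 \<le> L / (- ln x)" unfolding k0_def by (auto simp: of_nat_floor)
  with \<open>k \<le> k0\<close> have "real k \<le> L / (- ln x)" by linarith
  then show ?thesis using lnx by (simp add: field_simps)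
qed

lemma angles:
  assumes "k \<le> k0"
  shows "ang b \<le> ang a' - real k * d" "ang a' - real k * d \<le> ang a'"
proof -
  have "real k * d = real k * (- ln x) * (D / L)" by (simp add: d_def)
  also have "\<dots> \<le> L * (D / L)" using k0_le[OF assms] L1 D_pos by (intro mult_right_mono) auto
  finally have "real k * d \<le> D" using L1 by simp
  then show "ang b \<le> ang a' - real k * d" by (simp add: D_def)
  show "ang a' - real k * d \<le> ang a'" using d_nonneg by simp
qed

lemma ang_range: "0 \<le> ang b" "ang a' \<le> pi" "cos (ang b) = 1 - 2 * b" "cos (ang a') = 1 - 2 * a'"
  using ord by (auto intro: arccos_lbound arccos_ubound)

lemma T_bounds:
  assumes "k \<le> k0"
  shows "b \<le> T k" "1 \<le> k \<Longrightarrow> T k \<le> a'"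
proof -
  have "cos (ang a' - real k * d) \<le> cos (ang b)" "cos (ang a') \<le> cos (ang a' - real k * d)"
    using angles[OF assms] ang_range(1,2) by (intro cos_monotone_0_pi_le; linarith)+
  then show "b \<le> T k" "1 \<le> k \<Longrightarrow> T k \<le> a'"
    using ord ang_range(3,4) by (auto simp: T_def)
qed

lemma T_antimono:
  assumes "j \<le> k" "k \<le> k0"
  shows "T k \<le> T j"
proof (cases "j = 0")
  case True
  then show ?thesis using T_bounds(2)[OF assms(2)] ord by (cases "k = 0") (auto simp: T_def)
next
  case False
  have "cos (ang a' - real j * d) \<le> cos (ang a' - real k * d)"
  proof (rule cos_monotone_0_pi_le)
    have "real j * d \<le> real k * d" using assms d_nonneg by (intro mult_right_mono) auto
    then show "ang a' - real k * d \<le> ang a' - real j * d" by linarith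
    show "0 \<le> ang a' - real k * d" "ang a' - real j * d \<le> pi"
      using angles[OF assms(2)] angles[of j] ang_range(1,2) assms by linarith+
  qed
  then show ?thesis using False assms by (simp add: T_def)
qed

end

section \<open>Dropping and survival probabilities of the rule\<close>

context large_schedule
begin

lemma st_Nil: "\<not> st []"
  using M_pos by (auto simp: st_def threshold_rule_def)

lemma hit_prev: "first_hit st \<phi> n w \<Longrightarrow> j \<le> k0 \<Longrightarrow> M j < n \<Longrightarrow> real (M j) * T j \<le> successes (M j) w"
  using first_hit_threshold_rule[of k0 M T \<phi> n w j] M_pos by (simp add: st_def)

lemma hit_stop:
  assumes "first_hit st st n w"
  obtains k where "k \<le> k0" "n = M k" "successes (M k) w < real (M k) * T k"
  using assms by (auto simp: first_hit_def st_def threshold_rule_def)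

lemma hit_stop_M: "first_hit st st (M k) w \<Longrightarrow> successes (M k) w \<le> real (M k) * T k"
  by (metis hit_stop M_inj less_imp_le)

text \<open>Near \<open>T k\<close> the variance is the right one and the tilted bound over the last
  \<open>J\<close> checks applies; \<open>J < k\<close> keeps them all on the curve, clear of check
  0. A mean higher by \<open>\<kappa>\<close> is dropped only by a deviation at check
  \<open>k\<close>, and a mean lower by \<open>\<kappa>\<close> must have passed check
  \<open>k - 1\<close> by a deviation. As \<open>\<kappa>\<close> is fixed while
  \<open>rate'\<close> tends to 0, these two cases are unlikely enough.\<close>

lemma hit_prob_late:
  assumes q: "0 \<le> q" "q \<le> 1" and k: "J < k" "k \<le> k0"
  shows "hit_prob st st q [] (M k) \<le> exp (- (rate' * real (M k)))"
proof -
  let ?m = "real (M k)"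
  consider (near) "\<bar>q - T k\<bar> \<le> \<kappa>" | (high) "T k + \<kappa> \<le> q" | (low) "q \<le> T k - \<kappa>" by linarith
  then show ?thesis
  proof cases
    case near
    define \<theta> where "\<theta> = ang a' - real k * d"
    define \<sigma> where "\<sigma> = sin \<theta> / 2"
    have \<theta>: "ang b \<le> \<theta>" "\<theta> \<le> ang a'" using angles[OF k(2)] by (auto simp: \<theta>_def)
    have Tk: "T k = (1 - cos \<theta>) / 2" using k by (simp add: T_def \<theta>_def)
    have "0 \<le> sin \<theta>" using \<theta> ang_range by (intro sin_ge_zero) auto
    then have \<sigma>_nn: "0 \<le> \<sigma>" by (simp add: \<sigma>_def)
    have \<sigma>2: "\<sigma>\<^sup>2 = T k * (1 - T k)"
    proof -
      have "(1 - c\<^sup>2) / 4 = (1 - c) / 2 * (1 - (1 - c) / 2)" for c :: real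
        by (simp add: field_simps power2_eq_square)
      then show ?thesis by (simp add: \<sigma>_def Tk power_divide sin_squared_eq)
    qed
    have "\<sigma>0\<^sup>2 \<le> \<sigma>\<^sup>2"
      unfolding \<sigma>2 \<sigma>0(2) using T_bounds[OF k(2)] k ord by (intro mult_mono) auto
    then have \<sigma>: "\<sigma>0 \<le> \<sigma>" "0 < \<sigma>"
      using \<sigma>_nn \<sigma>0(1) power2_le_imp_le[of \<sigma>0 \<sigma>] by auto
    have "hit_prob st st q [] (M (k - 0)) \<le> exp (- ((1 - r / 2) * d\<^sup>2 / (2 * (ln x)\<^sup>2) * real (M (k - 0))))"
    proof (rule hit_prob_window_sharp[where Ms = "\<lambda>i. M (k - i)" and Ts = "\<lambda>i. T (k - i)" and \<sigma> = \<sigma>, OF tilt x _ \<sigma>(2) d_nonneg _ q])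
      show "0 \<le> \<epsilon>" using \<epsilon> by simp
      have "\<epsilon> * \<sigma>0 \<le> \<epsilon> * \<sigma>" using \<epsilon> \<sigma> by (intro mult_left_mono) auto
      then show "d \<le> \<epsilon> * \<sigma>" using d1 by linarith
      \<comment> \<open>One factor \<open>1 + \<epsilon> / 3\<close> comes from the mean being off
        the threshold, the other from the Taylor remainder.\<close>
      show "q * (1 - q) * exp (2 * real J * (d / \<sigma>)) \<le> (1 + \<epsilon>) * \<sigma>\<^sup>2"
      proof -
        have "d / \<sigma> \<le> d / \<sigma>0" using \<sigma> \<sigma>0(1) d_nonneg by (intro divide_left_mono) auto
        then have "2 * real J * (d / \<sigma>) \<le> 2 * real J * (d / \<sigma>0)" by (intro mult_left_mono) auto
        then have e: "exp (2 * real J * (d / \<sigma>)) \<le> 1 + \<epsilon> / 3" using d1 by (meson exp_le_cancel_iff order_trans)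
        have "q * (1 - q) = T k * (1 - T k) + (q - T k) * (1 - q - T k)" by (simp add: algebra_simps)
        also have "(q - T k) * (1 - q - T k) \<le> \<bar>q - T k\<bar> * \<bar>1 - q - T k\<bar>"
          by (metis abs_ge_self abs_mult)
        also have "\<dots> \<le> \<kappa> * 1"
          using near q T_bounds[OF k(2)] k ord by (intro mult_mono) auto
        also have "\<kappa> * 1 \<le> \<sigma>\<^sup>2 * (\<epsilon> / 3)"
          using \<open>\<sigma>0\<^sup>2 \<le> \<sigma>\<^sup>2\<close> \<epsilon> by (auto simp: \<kappa>_def intro!: mult_right_mono divide_right_mono)
        finally have q1: "q * (1 - q) \<le> \<sigma>\<^sup>2 * (1 + \<epsilon> / 3)" by (simp add: \<sigma>2 algebra_simps)
        have "q * (1 - q) * exp (2 * real J * (d / \<sigma>)) \<le> (\<sigma>\<^sup>2 * (1 + \<epsilon> / 3)) * (1 + \<epsilon> / 3)"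
          by (rule mult_mono[OF q1 e]) (use \<epsilon> in auto)
        also have "\<dots> = \<sigma>\<^sup>2 * ((1 + \<epsilon> / 3) * (1 + \<epsilon> / 3))" by simp
        also have "\<dots> \<le> \<sigma>\<^sup>2 * (1 + \<epsilon>)"
        proof (rule mult_left_mono)
          have "\<epsilon> * \<epsilon> \<le> \<epsilon> * 1" using \<epsilon> by (intro mult_left_mono) auto
          moreover have "(1 + \<epsilon> / 3) * (1 + \<epsilon> / 3) = 1 + 2 * \<epsilon> / 3 + \<epsilon> * \<epsilon> / 9"
            by (simp add: field_simps)
          ultimately show "(1 + \<epsilon> / 3) * (1 + \<epsilon> / 3) \<le> 1 + \<epsilon>" using \<epsilon> by linarith
        qed simp
        finally show ?thesis by (simp add: mult_ac)
      qed
      show "0 < M (k - 0)" by (rule M_pos)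
      show "M (k - i) \<le> M (k - 0)" for i by (intro M_mono) simp
      show "\<bar>real (M (k - i)) / real (M (k - 0)) - x ^ i\<bar> \<le> \<epsilon>" if "i \<in> {1..J}" for i
        using M_ratio[of i k] that k by simp
      show "real i * d * \<sigma> - (real i * d)\<^sup>2 \<le> T (k - i) - T (k - 0)" if "i \<in> {1..J}" for i
      proof -
        have i: "1 \<le> k - i" "i \<le> k" using that k by auto
        have y: "0 \<le> real i * d" using d_nonneg by simp
        have "ang a' - real (k - i) * d = \<theta> + real i * d"
          using i by (simp add: \<theta>_def of_nat_diff algebra_simps)
        moreover have "T (k - i) = (1 - cos (ang a' - real (k - i) * d)) / 2"
          using i by (auto simp: T_def)
        ultimately have "T (k - i) - T k = (cos \<theta> - cos (\<theta> + real i * d)) / 2"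
          by (simp only: Tk diff_divide_distrib)
        moreover have "real i * d * sin \<theta> - (real i * d)\<^sup>2 / 2 \<le> cos \<theta> - cos (\<theta> + real i * d)"
          by (rule cos_diff_lower[OF y])
        moreover have "0 \<le> (real i * d)\<^sup>2" by simp
        moreover have "real i * d * \<sigma> = real i * d * sin \<theta> / 2" by (simp add: \<sigma>_def)
        moreover have "s - y \<le> t" if "t = X / 2" "p - y / 2 \<le> X" "0 \<le> y" "s = p / 2" for s y t X p :: real
          using that by linarith
        ultimately show ?thesis unfolding diff_zero by blast
      qed
      show "successes (M (k - 0)) w \<le> real (M (k - 0)) * T (k - 0)" if "first_hit st st (M (k - 0)) w" for w
        using hit_stop_M[of k w] that by simp
      show "real (M (k - i)) * T (k - i) \<le> successes (M (k - i)) w"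
        if "first_hit st st (M (k - 0)) w" "i \<in> {1..J}" for w i
        using that k by (intro hit_prev[of st "M k"]) (auto intro!: M_less)
    qed
    \<comment> \<open>The factor \<open>(ln x)^2\<close> cancels against the one in
      \<open>d^2\<close>: the rate is independent of the spacing of the checks.\<close>
    moreover have "(1 - r / 2) * d\<^sup>2 / (2 * (ln x)\<^sup>2) = rate'"
      using lnx by (simp add: d_def rate'_def power_divide power_mult_distrib)
    ultimately show ?thesis by simp
  next
    case high
    have "hit_prob st st q [] (M k) \<le> exp (- (\<kappa>\<^sup>2 * real (M k) / 2))"
      using high \<kappa> by (intro hit_prob_tail_high[OF q, where t = "T k"] hit_stop_M) auto
    also have "\<dots> \<le> exp (- (rate' * real (M k)))"
    proof -
      have "rate' \<le> \<kappa>\<^sup>2 / 2"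
      proof -
        have "\<kappa>\<^sup>2 * x \<le> \<kappa>\<^sup>2 * 1" using x by (intro mult_left_mono) auto
        then show ?thesis using rate1(3) zero_le_power2[of \<kappa>] by linarith
      qed
      then have "rate' * real (M k) \<le> \<kappa>\<^sup>2 / 2 * real (M k)" by (intro mult_right_mono) auto
      then show ?thesis by simp
    qed
    finally show ?thesis .
  next
    case low
    have "hit_prob st st q [] (M k) \<le> exp (- (\<kappa>\<^sup>2 * real (M (k - 1)) / 2))"
    proof (rule hit_prob_tail_low[OF q, where t = "T (k - 1)"])
      show "M (k - 1) \<le> M k" by (intro M_mono) simp
      show "q \<le> T (k - 1) - \<kappa>" using low T_antimono[of "k - 1" k] k by simp
      show "real (M (k - 1)) * T (k - 1) \<le> successes (M (k - 1)) w" if "first_hit st st (M k) w" for w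
        using that k by (intro hit_prev[of st "M k"]) (auto intro!: M_less)
    qed (use \<kappa> in auto)
    also have "\<dots> \<le> exp (- (rate' * real (M k)))"
    proof -
      have "x / 2 \<le> real (M (k - 1)) / real (M k)"
        using M_ratio[of 1 k] k J \<epsilon> by (auto simp: abs_le_iff)
      then have *: "x / 2 * real (M k) \<le> real (M (k - 1))" using M_pos[of k] by (simp add: field_simps)
      have "rate' * real (M k) \<le> \<kappa>\<^sup>2 * x / 4 * real (M k)" using rate1(3) by (intro mult_right_mono) auto
      also have "\<dots> = \<kappa>\<^sup>2 / 2 * (x / 2 * real (M k))" by simp
      also have "\<dots> \<le> \<kappa>\<^sup>2 / 2 * real (M (k - 1))" using * by (intro mult_left_mono) auto
      finally show ?thesis by simp
    qed
    finally show ?thesis .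
  qed
qed

text \<open>The middle between \<open>a\<close> and \<open>a'\<close> separates two unlikely events:
  a mean below it passed check 0 at threshold \<open>a\<close>, a mean above it is dropped at check
  \<open>k\<close>, whose threshold is at most \<open>a'\<close>.\<close>

lemma hit_prob_early:
  assumes q: "0 \<le> q" "q \<le> 1" and k: "1 \<le> k" "k \<le> k0"
  shows "hit_prob st st q [] (M k) \<le> exp (- (((a - a') / 2)\<^sup>2 * L / 2))"
proof -
  let ?c = "(a - a') / 2"
  have c: "0 \<le> ?c" "?c \<le> 1" using ord by auto
  have le: "exp (- (?c\<^sup>2 * real m / 2)) \<le> exp (- (?c\<^sup>2 * L / 2))" if "L \<le> real m" for m
    using that by (auto intro!: mult_left_mono divide_right_mono)
  show ?thesis
  proof (cases "q \<le> a - ?c")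
    case True
    have "hit_prob st st q [] (M k) \<le> exp (- (?c\<^sup>2 * real (M 0) / 2))"
    proof (rule hit_prob_tail_low[OF q _ c True])
      show "M 0 \<le> M k" by (intro M_mono) simp
      show "real (M 0) * a \<le> successes (M 0) w" if "first_hit st st (M k) w" for w
        using hit_prev[OF that, of 0] M_less[of 0 k] k by (simp add: T_def)
    qed
    also note le[OF M0(1)]
    finally show ?thesis .
  next
    case False
    have "hit_prob st st q [] (M k) \<le> exp (- (?c\<^sup>2 * real (M k) / 2))"
    proof (rule hit_prob_tail_high[OF q _ c, where t = "T k"])
      show "T k + ?c \<le> q" using T_bounds(2)[OF k(2,1)] False by (simp add: field_simps)
    qed (auto intro: hit_stop_M)
    also have "\<dots> \<le> exp (- (?c\<^sup>2 * L / 2))"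
      using M0(1) M_mono[of 0 k] by (intro le) simp
    finally show ?thesis .
  qed
qed

text \<open>\<open>L / (- ln x)\<close> bounds the number of checks, so this is the share of a
  single check. Up to check \<open>J\<close> the gap between \<open>a\<close> and \<open>a'\<close>
  has to suffice; afterwards the surplus \<open>rate' - rate\<close> acts over a time of at least
  \<open>R\<close>.\<close>

lemma hit_prob_weighted:
  assumes q: "0 \<le> q" "q \<le> 1" and k: "1 \<le> k" "k \<le> k0"
  shows "exp (rate * real (M k)) * hit_prob st st q [] (M k) * (L / (- ln x)) \<le> \<eta> / 4"
proof -
  have L0: "0 \<le> L / (- ln x)" using L1 lnx by (intro divide_nonneg_pos) auto
  show ?thesis
  proof (cases "k \<le> J")
    case True
    have "real (M k) \<le> R / x ^ J + 1"
      using M_mono[OF True] M_bounds(2)[of J] J by simp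
    then have "rate * real (M k) \<le> rate * (R / x ^ J + 1)" using rate_pos by (intro mult_left_mono) auto
    then have "exp (rate * real (M k)) * hit_prob st st q [] (M k)
        \<le> exp (rate * (R / x ^ J + 1)) * exp (- (((a - a') / 2)\<^sup>2 * L / 2))"
      using hit_prob_bounds[OF q] by (intro mult_mono hit_prob_early[OF q k]) auto
    also have "\<dots> = exp (rate * (R / x ^ J + 1) - ((a - a') / 2)\<^sup>2 * L / 2)"
      by (simp add: mult_exp_exp)
    finally show ?thesis using early mult_right_mono[OF _ L0] by (meson order_trans)
  next
    case False
    have "R \<le> R / x ^ k" using x R_pos by (simp add: field_simps power_le_one)
    then have RM: "R \<le> real (M k)" using M_bounds(1)[of k] k by simp
    have "exp (rate * real (M k)) * hit_prob st st q [] (M k) \<le> exp (rate * real (M k)) * exp (- (rate' * real (M k)))"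
      using False k by (intro mult_left_mono hit_prob_late[OF q]) auto
    also have "\<dots> = exp (- ((rate' - rate) * real (M k)))"
      by (simp add: mult_exp_exp algebra_simps)
    also have "\<dots> \<le> exp (- ((rate' - rate) * R))"
    proof -
      have "(rate' - rate) * R \<le> (rate' - rate) * real (M k)"
        using rate_pos(2) by (intro mult_left_mono RM) simp
      then show ?thesis by (simp only: exp_le_cancel_iff neg_le_iff_le)
    qed
    also have "\<dots> = exp (- (r / 2 * D\<^sup>2 / (2 * L\<^sup>2) * R))"
      unfolding rate_pos(3) ..
    finally show ?thesis using late mult_right_mono[OF _ L0] by (meson order_trans)
  qed
qed

lemma sum_K_weighted:
  assumes q: "0 \<le> q" "q \<le> 1"
  shows "(\<Sum>m\<in>{1..N} - {M 0}. exp (rate * real m) * hit_prob st st q [] m) \<le> \<eta> / 4"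
proof -
  let ?f = "\<lambda>m. exp (rate * real m) * hit_prob st st q [] m"
  have L0: "0 < L / (- ln x)" using L1 lnx by (intro divide_pos_pos) auto
  have nn: "0 \<le> ?f m" for m using hit_prob_bounds[OF q] by simp
  \<comment> \<open>Dropping happens at check times only.\<close>
  have "(\<Sum>m\<in>{1..N} - {M 0}. ?f m) = (\<Sum>m\<in>({1..N} - {M 0}) \<inter> M ` {1..k0}. ?f m)"
  proof (intro sum.mono_neutral_right ballI)
    fix m assume m: "m \<in> ({1..N} - {M 0}) - ({1..N} - {M 0}) \<inter> M ` {1..k0}"
    have "\<not> first_hit st st m w" for w
    proof
      assume "first_hit st st m w"
      then obtain k where k: "k \<le> k0" "m = M k" by (rule hit_stop)
      with m have "k \<noteq> 0" by (metis DiffD1 DiffD2 singletonI)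
      with k m show False by auto
    qed
    then show "?f m = 0" by (simp add: hit_prob_eq_0[OF q])
  qed auto
  also have "\<dots> \<le> (\<Sum>m\<in>M ` {1..k0}. ?f m)"
    using nn by (intro sum_mono2) auto
  also have "\<dots> = (\<Sum>k\<in>{1..k0}. ?f (M k))"
    by (subst sum.reindex) (auto simp: inj_on_def M_inj)
  also have "\<dots> \<le> real (card {1..k0}) * (\<eta> / 4 / (L / (- ln x)))"
  proof (rule sum_bounded_above)
    fix k assume "k \<in> {1..k0}"
    then show "?f (M k) \<le> \<eta> / 4 / (L / (- ln x))"
      using hit_prob_weighted[OF q, of k] by (subst pos_le_divide_eq[OF L0]) auto
  qed
  also have "\<dots> \<le> L / (- ln x) * (\<eta> / 4 / (L / (- ln x)))"
  proof (rule mult_right_mono)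
    have "real k0 \<le> L / (- ln x)" using L0 unfolding k0_def by (auto simp: of_nat_floor)
    then show "real (card {1..k0}) \<le> L / (- ln x)" by simp
    have "0 \<le> \<eta> / 4" using \<eta> by simp
    from divide_nonneg_pos[OF this L0] show "0 \<le> \<eta> / 4 / (L / (- ln x))" .
  qed
  also have "\<dots> = \<eta> / 4"
  proof -
    from L0 have ne: "L / (- ln x) \<noteq> 0" by linarith
    have "c * (e / c) = e" if "c \<noteq> 0" for c e :: real using that by simp
    from this[OF ne] show ?thesis .
  qed
  finally show ?thesis .
qed

lemma hit_prob_first:
  assumes q: "u \<le> q" "q \<le> 1"
  shows "hit_prob st st q [] (M 0) \<le> \<eta> / 4"
proof -
  have "hit_prob st st q [] (M 0) \<le> exp (- ((u - a)\<^sup>2 * real (M 0) / 2))"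
  proof (rule hit_prob_tail_high[where t = a])
    show "successes (M 0) w \<le> real (M 0) * a" if "first_hit st st (M 0) w" for w
      using hit_stop_M[OF that] by (simp add: T_def)
  qed (use ord q in auto)
  also have "\<dots> \<le> exp (- ((u - a)\<^sup>2 * L / 2))"
    using M0(1) by (auto intro!: mult_left_mono divide_right_mono)
  finally show ?thesis using first by linarith
qed

text \<open>Check 0 may drop every poor arm, but a good one with probability at most
  \<open>\<eta> / 4\<close>. The weight of check 0 and the sum of all later checks cost about
  \<open>\<eta> / 4\<close> each, and the gain \<open>\<eta>\<close> from the good arms outweighs
  these losses.\<close>

lemma renewal:
  fixes \<mu> :: "real measure"
  assumes \<mu>: "prob_space \<mu>" and s: "sets \<mu> = sets borel" and good: "\<eta> \<le> measure \<mu> {u..}"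
  shows "(\<Sum>m=1..N. ennreal (exp (rate * real m)) * (\<integral>\<^sup>+ y. ennreal (hit_prob st st (clip y) [] m) \<partial>\<mu>)) \<le> 1"
proof -
  interpret prob_space \<mu> by fact
  have [measurable]: "f \<in> borel_measurable \<mu>" if "f \<in> borel_measurable borel" for f :: "real \<Rightarrow> 'b :: topological_space"
    using that measurable_cong_sets[OF s refl] by blast
  have \<eta>1: "\<eta> \<le> 1" using good prob_le_1 by (rule order_trans)
  let ?t = "\<eta> / 4"
  let ?I = "indicator {u..} :: real \<Rightarrow> real"
  let ?f = "\<lambda>y. (1 + ?t) * (1 - (1 - ?t) * ?I y) + ?t"
  have pw: "(\<Sum>m=1..N. exp (rate * real m) * hit_prob st st (clip y) [] m) \<le> ?f y" for y
  proof -
    have "(\<Sum>m=1..N. exp (rate * real m) * hit_prob st st (clip y) [] m)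
      \<le> (\<Sum>m\<in>insert (M 0) ({1..N} - {M 0}). exp (rate * real m) * hit_prob st st (clip y) [] m)"
      using hit_prob_bounds[of "clip y"] by (intro sum_mono2) auto
    also have "\<dots> = exp (rate * real (M 0)) * hit_prob st st (clip y) [] (M 0)
       + (\<Sum>m\<in>{1..N} - {M 0}. exp (rate * real m) * hit_prob st st (clip y) [] m)"
      by (subst sum.insert) auto
    also have "\<dots> \<le> (1 + ?t) * (1 - (1 - ?t) * ?I y) + ?t"
    proof (intro add_mono sum_K_weighted mult_mono)
      have "rate * real (M 0) \<le> rate * (L + 1)" using M0 rate_pos by (intro mult_left_mono)
      then show "exp (rate * real (M 0)) \<le> 1 + ?t" using first by (meson exp_le_cancel_iff order_trans)
      show "hit_prob st st (clip y) [] (M 0) \<le> 1 - (1 - ?t) * ?I y"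
      proof (cases "u \<le> y")
        case True
        then have "u \<le> clip y" using ord by (auto simp: clip_def)
        then show ?thesis using hit_prob_first[of "clip y"] True by simp
      next
        case False
        then show ?thesis using hit_prob_bounds[of "clip y"] by simp
      qed
    qed (use hit_prob_bounds[of "clip y"] \<eta> in auto)
    finally show ?thesis .
  qed
  have "(\<Sum>m=1..N. ennreal (exp (rate * real m)) * (\<integral>\<^sup>+ y. ennreal (hit_prob st st (clip y) [] m) \<partial>\<mu>))
     = (\<Sum>m=1..N. \<integral>\<^sup>+ y. ennreal (exp (rate * real m) * hit_prob st st (clip y) [] m) \<partial>\<mu>)"
    using hit_prob_bounds by (intro sum.cong refl) (simp add: ennreal_mult nn_integral_cmult)
  also have "\<dots> = (\<integral>\<^sup>+ y. (\<Sum>m=1..N. ennreal (exp (rate * real m) * hit_prob st st (clip y) [] m)) \<partial>\<mu>)"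
    by (subst nn_integral_sum) auto
  also have "\<dots> = (\<integral>\<^sup>+ y. ennreal (\<Sum>m=1..N. exp (rate * real m) * hit_prob st st (clip y) [] m) \<partial>\<mu>)"
    using hit_prob_bounds by (intro nn_integral_cong sum_ennreal) auto
  also have "\<dots> \<le> (\<integral>\<^sup>+ y. ennreal (?f y) \<partial>\<mu>)"
    by (intro nn_integral_mono ennreal_leI pw)
  also have "\<dots> = ennreal (\<integral>y. ?f y \<partial>\<mu>)"
  proof (rule nn_integral_eq_integral)
    show "integrable \<mu> ?f"
      by (intro Bochner_Integration.integrable_add integrable_mult_right Bochner_Integration.integrable_diff integrable_const)
         (simp add: s less_top[symmetric] emeasure_finite)
    show "AE y in \<mu>. 0 \<le> ?f y"
      using \<eta> \<eta>1 by (intro AE_I2 add_nonneg_nonneg mult_nonneg_nonneg) (auto simp: indicator_def)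
  qed
  also have "(\<integral>y. ?f y \<partial>\<mu>) = (1 + ?t) * (1 - (1 - ?t) * measure \<mu> {u..}) + ?t"
  proof -
    have "integrable \<mu> ?I" by (simp add: s less_top[symmetric] emeasure_finite)
    then show ?thesis by (simp add: prob_space s)
  qed
  finally have le: "(\<Sum>m=1..N. ennreal (exp (rate * real m)) * (\<integral>\<^sup>+ y. ennreal (hit_prob st st (clip y) [] m) \<partial>\<mu>))
      \<le> ennreal ((1 + ?t) * (1 - (1 - ?t) * measure \<mu> {u..}) + ?t)" .
  have "(1 + ?t) * (1 - (1 - ?t) * measure \<mu> {u..}) + ?t \<le> (1 + ?t) * (1 - (1 - ?t) * \<eta>) + ?t"
    using good \<eta> \<eta>1 by (intro add_mono mult_left_mono diff_mono) auto
  also have "\<dots> \<le> 1"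
  proof -
    have "(1 + ?t) * (1 - (1 - ?t) * \<eta>) + ?t = 1 - \<eta> / 2 * (1 - \<eta> * \<eta> / 8)"
      by (simp add: algebra_simps)
    moreover have "\<eta> * \<eta> \<le> 1 * 1" using \<eta> \<eta>1 by (intro mult_mono) auto
    ultimately show ?thesis using \<eta> by simp
  qed
  finally have "ennreal ((1 + ?t) * (1 - (1 - ?t) * measure \<mu> {u..}) + ?t) \<le> 1"
    by (simp only: ennreal_le_1)
  with le show ?thesis by (rule order_trans)
qed

text \<open>Before check 1 the bound is trivial: \<open>rate * n \<le> L\<close> there, and the
  prefactor \<open>N = exp L\<close> is chosen for this. Later, the last check passed had a
  threshold of at least \<open>b > b0\<close> and took place at a time comparable to
  \<open>n\<close>, which gives a fixed exponential rate while \<open>rate\<close> tends to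
  0.\<close>

lemma survival:
  assumes n: "n \<le> N" and y: "y < b0"
  shows "hit_prob st (\<lambda>w. \<not> st w) (clip y) [] n \<le> real N * exp (- rate * real n)"
proof (cases "n < M 1")
  case True
  have "rate * real n \<le> rate * (R / x + 1)"
    using True M_bounds(2)[of 1] rate_pos by (intro mult_left_mono) auto
  then have "exp (rate * real n) \<le> exp L" using rate1 by simp
  then have "exp (rate * real n) \<le> real N" using N1 by simp
  then have "exp (rate * real n) * exp (- rate * real n) \<le> real N * exp (- rate * real n)"
    by (intro mult_right_mono) auto
  then have "1 \<le> real N * exp (- rate * real n)" by (simp add: mult_exp_exp)
  then show ?thesis using hit_prob_bounds[of "clip y" st "\<lambda>w. \<not> st w" "[]" n] by simp
next
  case False
  define A where "A = {k. k \<le> k0 \<and> M k \<le> n}"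
  have fin: "finite A" unfolding A_def by simp
  have L0: "0 < L / (- ln x)" using L1 lnx by (intro divide_pos_pos) auto
  have big: "n < M (Suc k0)"
  proof -
    have "L / (- ln x) < real (Suc k0)" using L0 unfolding k0_def by linarith
    then have "L < real (Suc k0) * (- ln x)" using lnx by (simp add: field_simps)
    also have "\<dots> = ln (1 / x ^ Suc k0)" using x by (simp add: ln_div ln_realpow del: power_Suc of_nat_Suc)
    finally have "exp L < 1 / x ^ Suc k0" using x by (metis exp_less_cancel_iff exp_ln zero_less_divide_1_iff zero_less_power)
    moreover have "1 \<le> R"
    proof -
      have "1 * 1 \<le> L\<^sup>2 * sqrt L" using L1 by (intro mult_mono) (auto simp: one_le_power)
      then show ?thesis by (simp add: R_def)
    qed
    then have "1 / x ^ Suc k0 \<le> R / x ^ Suc k0" using x by (intro divide_right_mono) auto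
    ultimately have "real N < real (M (Suc k0))"
      using N1 M_bounds(1)[of "Suc k0"] by simp
    then show ?thesis using n by simp
  qed
  have "0 \<in> A" using False M_less[of 0 1] by (auto simp: A_def)
  then have Ane: "A \<noteq> {}" by auto
  define k where "k = Max A"
  have k: "k \<le> k0" "M k \<le> n" using Max_in[OF fin Ane] by (auto simp: k_def A_def)
  have k1: "n < M (Suc k)"
  proof (cases "Suc k \<le> k0")
    case True
    show ?thesis
    proof (rule ccontr)
      assume "\<not> n < M (Suc k)"
      then have "Suc k \<in> A" using True by (auto simp: A_def)
      then have "Suc k \<le> Max A" by (intro Max_ge fin)
      then show False by (simp add: k_def)
    qed
  next
    case False
    then have "k = k0" using k by simp
    then show ?thesis using big by simp
  qed
  have "1 \<le> k" using k1 False by (cases k) auto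
  have n_le: "real n \<le> 2 / x * real (M k)"
  proof -
    have "real n \<le> R / x ^ Suc k" using k1 unfolding M_def[of "Suc k"] by simp linarith
    also have "\<dots> = R / x ^ k / x" by simp
    also have "\<dots> \<le> real (M k) / x" using M_bounds(1)[OF \<open>1 \<le> k\<close>] x by (intro divide_right_mono) auto
    also have "\<dots> \<le> 2 / x * real (M k)" using x by (simp add: field_simps)
    finally show ?thesis .
  qed
  have cl: "clip y \<le> b - (b - b0)" using y ord by (auto simp: clip_def)
  have "hit_prob st (\<lambda>w. \<not> st w) (clip y) [] n \<le> exp (- ((b - b0)\<^sup>2 * real (M k) / 2))"
  proof (rule hit_prob_tail_low[where t = b])
    fix w assume w: "first_hit st (\<lambda>w. \<not> st w) n w"
    have "real (M k) * T k \<le> successes (M k) w"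
    proof (cases "M k < n")
      case True then show ?thesis using hit_prev[OF w k(1)] by simp
    next
      case False
      then have "\<not> st w" "length w = M k" using w k by (auto simp: first_hit_def)
      then show ?thesis using k by (auto simp: st_def threshold_rule_def not_less)
    qed
    moreover have "real (M k) * b \<le> real (M k) * T k" using T_bounds(1)[OF k(1)] by (intro mult_left_mono) auto
    ultimately show "real (M k) * b \<le> successes (M k) w" by linarith
  qed (use ord k cl in auto)
  also have "\<dots> \<le> exp (- rate * real n)"
  proof -
    have "rate * real n \<le> rate * (2 / x * real (M k))" using n_le rate_pos by (intro mult_left_mono)
    also have "\<dots> = 4 * rate / x * real (M k) / 2" by simp
    also have "\<dots> \<le> (b - b0)\<^sup>2 * real (M k) / 2" using rate1(2) by (intro divide_right_mono mult_right_mono) auto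
    finally show ?thesis by simp
  qed
  also have "1 * \<dots> \<le> real N * exp (- rate * real n)" using N1 by (intro mult_right_mono) auto
  finally show ?thesis by simp
qed

end

section \<open>Asymptotics of the schedule\<close>

lemma schedule_asymptotics:
  fixes A B C E \<delta> k :: real
  assumes pos: "0 < A" "0 < B" "0 < C" "0 < E" "0 < k" "0 < \<delta>"
  shows "eventually (\<lambda>l::real. 1 \<le> l) at_top"
    "eventually (\<lambda>l. 1 \<le> l\<^sup>2 * sqrt l * \<delta>) at_top"
    "1 < B \<Longrightarrow> eventually (\<lambda>l. l + 1 \<le> l\<^sup>2 * sqrt l * B) at_top"
    "eventually (\<lambda>l. 1 / (l\<^sup>2 * sqrt l) \<le> \<delta>) at_top"
    "eventually (\<lambda>l. C / l \<le> \<delta>) at_top"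
    "eventually (\<lambda>l. exp (C / l) \<le> 1 + \<delta>) at_top"
    "eventually (\<lambda>l. A / l\<^sup>2 * (l\<^sup>2 * sqrt l * B + 1) \<le> l) at_top"
    "eventually (\<lambda>l. A / l\<^sup>2 \<le> \<delta>) at_top"
    "eventually (\<lambda>l. exp (A / l\<^sup>2 * (l\<^sup>2 * sqrt l * B + 1) - k * l) * (l * E) \<le> \<delta>) at_top"
    "eventually (\<lambda>l. exp (- (A / l\<^sup>2 * (l\<^sup>2 * sqrt l))) * (l * E) \<le> \<delta>) at_top"
    "eventually (\<lambda>l. exp (A / l\<^sup>2 * (l + 1)) \<le> 1 + \<delta>) at_top"
    "eventually (\<lambda>l. exp (- (k * l)) \<le> \<delta>) at_top"
proof -
  have le: "eventually (\<lambda>l. f l \<le> c + \<delta>) at_top" if "(f \<longlongrightarrow> c) at_top" for f :: "real \<Rightarrow> real" and c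
  proof -
    have "eventually (\<lambda>l. f l < c + \<delta>) at_top" using that pos by (intro order_tendstoD) auto
    then show ?thesis by eventually_elim simp
  qed
  note le0 = le[where c = 0, simplified]
  show "eventually (\<lambda>l::real. 1 \<le> l) at_top" by (rule eventually_ge_at_top)
  show "eventually (\<lambda>l. 1 \<le> l\<^sup>2 * sqrt l * \<delta>) at_top" using pos by real_asymp
  show "eventually (\<lambda>l. l + 1 \<le> l\<^sup>2 * sqrt l * B) at_top" using pos by real_asymp
  show "eventually (\<lambda>l. 1 / (l\<^sup>2 * sqrt l) \<le> \<delta>) at_top" by (rule le0) (use pos in real_asymp)
  show "eventually (\<lambda>l. C / l \<le> \<delta>) at_top" by (rule le0) (use pos in real_asymp)
  show "eventually (\<lambda>l. exp (C / l) \<le> 1 + \<delta>) at_top" by (rule le) (use pos in real_asymp)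
  show "eventually (\<lambda>l. A / l\<^sup>2 * (l\<^sup>2 * sqrt l * B + 1) \<le> l) at_top" using pos by real_asymp
  show "eventually (\<lambda>l. A / l\<^sup>2 \<le> \<delta>) at_top" by (rule le0) (use pos in real_asymp)
  show "eventually (\<lambda>l. exp (A / l\<^sup>2 * (l\<^sup>2 * sqrt l * B + 1) - k * l) * (l * E) \<le> \<delta>) at_top"
  proof -
    \<comment> \<open>Before \<open>k * l\<close> is subtracted the exponent is of order
      \<open>sqrt l\<close>; half of \<open>k * l\<close> absorbs it and the other half beats the
      factor \<open>l * E\<close>.\<close>
    define h where "h = k / 2"
    have h: "0 < h" "k = h + h" using pos by (auto simp: h_def)
    have "eventually (\<lambda>l. A / l\<^sup>2 * (l\<^sup>2 * sqrt l * B + 1) \<le> h * l) at_top" using pos h(1) by real_asymp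
    moreover have "eventually (\<lambda>l. exp (- (h * l)) * (l * E) \<le> \<delta>) at_top"
      by (rule le0) (use pos h(1) in real_asymp)
    moreover have "eventually (\<lambda>l::real. 0 \<le> l) at_top" by (rule eventually_ge_at_top)
    ultimately show ?thesis
    proof eventually_elim
      case (elim l)
      have "exp (A / l\<^sup>2 * (l\<^sup>2 * sqrt l * B + 1) - k * l) * (l * E) \<le> exp (- (h * l)) * (l * E)"
        using elim pos by (intro mult_right_mono mult_nonneg_nonneg less_imp_le[OF pos(4)]) (auto simp: h(2) distrib_right)
      with elim show ?case by linarith
    qed
  qed
  show "eventually (\<lambda>l. exp (- (A / l\<^sup>2 * (l\<^sup>2 * sqrt l))) * (l * E) \<le> \<delta>) at_top"
  proof -
    \<comment> \<open>Substituting \<open>sqrt l\<close> for \<open>l\<close> turns this into the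
      claim.\<close>
    have "eventually (\<lambda>l. exp (- (A * l)) * (l\<^sup>2 * E) \<le> \<delta>) at_top"
      by (rule le0) (use pos in real_asymp)
    from eventually_compose_filterlim[OF this sqrt_at_top] show ?thesis
      using eventually_gt_at_top[of "0::real"] by eventually_elim simp
  qed
  show "eventually (\<lambda>l. exp (A / l\<^sup>2 * (l + 1)) \<le> 1 + \<delta>) at_top" by (rule le) (use pos in real_asymp)
  show "eventually (\<lambda>l. exp (- (k * l)) \<le> \<delta>) at_top" by (rule le0) (use pos in real_asymp)
qed

text \<open>For each large \<open>N\<close> one rule serves all reservoirs with enough good arms.
  Half of the slack \<open>r\<close> is spent on the discretised tilt, the other half on summing
  over the checks.\<close>

theorem eventually_good_stopping_rule:
  fixes b0 b a' a u r \<eta> :: real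
  assumes ord: "0 \<le> b0" "b0 < b" "b < a'" "a' < a" "a < u" "u \<le> 1"
    and r: "0 < r" "r < 1" and \<eta>: "0 < \<eta>"
  defines "\<beta> \<equiv> \<lambda>N. (1 - r) * (ang a' - ang b)\<^sup>2 / (2 * (ln (real N))\<^sup>2)"
  shows "eventually (\<lambda>N. \<exists>st. \<not> st [] \<and>
     (\<forall>n\<le>N. \<forall>y<b0. hit_prob st (\<lambda>w. \<not> st w) (clip y) [] n \<le> real N * exp (- \<beta> N * real n)) \<and>
     (\<forall>\<mu>. prob_space \<mu> \<longrightarrow> sets \<mu> = sets borel \<longrightarrow> \<eta> \<le> measure \<mu> {u..} \<longrightarrow>
       (\<Sum>m=1..N. ennreal (exp (\<beta> N * real m)) * (\<integral>\<^sup>+ y. ennreal (hit_prob st st (clip y) [] m) \<partial>\<mu>)) \<le> 1)) sequentially"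
proof -
  have r2: "0 < r / 2" using r by simp
  obtain x \<epsilon> :: real and J :: nat where x: "0 < x" "x < 1" and J: "0 < J" and \<epsilon>: "0 < \<epsilon>" "\<epsilon> \<le> 1" "\<epsilon> \<le> x / 2"
    and tilt: "(\<Sum>i=1..J. real i * x ^ i) - real J ^ 2 * \<epsilon> - real J ^ 3 * \<epsilon>
      - (1 + \<epsilon>) / 2 * ((\<Sum>i=1..J. \<Sum>j=1..J. x ^ max i j) - (\<Sum>i=1..J. x ^ i)\<^sup>2 + 3 * real J ^ 2 * \<epsilon>)
      \<ge> (1 - r / 2) / (2 * (ln x)\<^sup>2)"
    using tilt_parameters[OF r2] by blast
  have sch: "schedule b0 b a' a u x \<epsilon> r \<eta> J"
    by unfold_locales (use ord x J \<epsilon> r \<eta> tilt in auto)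
  define D1 where "D1 = ang a' - ang b"
  define s1 where "s1 = sqrt (b * (1 - a'))"
  define \<kappa>1 where "\<kappa>1 = s1\<^sup>2 * \<epsilon> / 3"
  define A1 where "A1 = (1 - r) * D1\<^sup>2 / 2"
  have D1: "0 < D1" unfolding D1_def using ord by (simp add: arccos_less_arccos)
  have s1: "0 < s1" unfolding s1_def using ord by simp
  have lx: "0 < - ln x" using x by simp
  have A1: "0 < A1" using D1 r by (simp add: A1_def)
  have \<kappa>1: "0 < \<kappa>1" unfolding \<kappa>1_def using s1 \<epsilon>(1) by (intro divide_pos_pos mult_pos_pos) auto
  have c: "0 < 1 / x - 1" "1 < 1 / x" "0 < 1 / x" "0 < 1 / x ^ J" "0 < \<epsilon> * s1" "0 < D1 * (- ln x)" "0 < 2 * real J * (D1 * (- ln x) / s1)"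
    "0 < \<epsilon> / 3" "0 < 4 * A1 / x" "0 < (b - b0)\<^sup>2" "0 < (1 - r / 2) * D1\<^sup>2 / 2" "0 < \<kappa>1\<^sup>2 * x / 4"
    "0 < ((a - a') / 2)\<^sup>2 / 2" "0 < 1 / (- ln x)" "0 < \<eta> / 4" "0 < r / 2 * D1\<^sup>2 / 2" "0 < (u - a)\<^sup>2 / 2"
  proof -
    show "0 < D1 * (- ln x)" using D1 lx by (rule mult_pos_pos)
    then have "0 < D1 * (- ln x) / s1" using s1 by (rule divide_pos_pos)
    then show "0 < 2 * real J * (D1 * (- ln x) / s1)" using J by (intro mult_pos_pos) simp_all
  qed (use x ord s1 D1 J \<epsilon> r \<eta> A1 \<kappa>1 in \<open>simp_all add: field_simps\<close>)
  note as = schedule_asymptotics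
  have ev: "eventually (\<lambda>l. 1 \<le> l \<and> 1 \<le> l\<^sup>2 * sqrt l * (1 / x - 1) \<and> l + 1 \<le> l\<^sup>2 * sqrt l * (1 / x) \<and> 1 / (l\<^sup>2 * sqrt l) \<le> \<epsilon>
    \<and> D1 * (- ln x) / l \<le> \<epsilon> * s1 \<and> exp (2 * real J * (D1 * (- ln x) / s1) / l) \<le> 1 + \<epsilon> / 3
    \<and> A1 / l\<^sup>2 * (l\<^sup>2 * sqrt l * (1 / x) + 1) \<le> l \<and> 4 * A1 / x / l\<^sup>2 \<le> (b - b0)\<^sup>2 \<and> (1 - r / 2) * D1\<^sup>2 / 2 / l\<^sup>2 \<le> \<kappa>1\<^sup>2 * x / 4
    \<and> exp (A1 / l\<^sup>2 * (l\<^sup>2 * sqrt l * (1 / x ^ J) + 1) - ((a - a') / 2)\<^sup>2 / 2 * l) * (l * (1 / (- ln x))) \<le> \<eta> / 4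
    \<and> exp (- (r / 2 * D1\<^sup>2 / 2 / l\<^sup>2 * (l\<^sup>2 * sqrt l))) * (l * (1 / (- ln x))) \<le> \<eta> / 4
    \<and> exp (A1 / l\<^sup>2 * (l + 1)) \<le> 1 + \<eta> / 4 \<and> exp (- ((u - a)\<^sup>2 / 2 * l)) \<le> \<eta> / 4) at_top"
    by (intro eventually_conj as[where A = A1 and B = 1 and C = 1 and E = 1 and k = 1 and \<delta> = 1]
      as(2)[where A = A1 and B = 1 and C = 1 and E = 1 and k = 1]
      as(3)[where A = A1 and C = 1 and E = 1 and k = 1 and \<delta> = 1]
      as(4)[where A = A1 and B = 1 and C = 1 and E = 1 and k = 1]
      as(5,6)[where A = A1 and B = 1 and E = 1 and k = 1]
      as(7)[where C = 1 and E = 1 and k = 1 and \<delta> = 1]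
      as(8)[where B = 1 and C = 1 and E = 1 and k = 1]
      as(9)[where C = 1]
      as(10)[where B = 1 and C = 1 and k = 1]
      as(11)[where B = 1 and C = 1 and E = 1 and k = 1]
      as(12)[where A = A1 and B = 1 and C = 1 and E = 1])
      (use A1 c \<epsilon> in auto)
  have lim: "filterlim (\<lambda>N. ln (real N)) at_top sequentially"
    by (rule filterlim_compose[OF ln_at_top filterlim_real_sequentially])
  from eventually_compose_filterlim[OF ev lim] show ?thesis
  proof eventually_elim
    case (elim N)
    interpret schedule b0 b a' a u x \<epsilon> r \<eta> J N by (rule sch)
    let ?l = "ln (real N)"
    have eqs: "L = ?l" "R = ?l\<^sup>2 * sqrt ?l" "D = D1" "d = D1 * (- ln x) / ?l" "\<sigma>0 = s1" "\<kappa> = \<kappa>1"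
      "rate = A1 / ?l\<^sup>2" "rate' = (1 - r / 2) * D1\<^sup>2 / 2 / ?l\<^sup>2"
      by (simp_all add: L_def R_def D_def D1_def d_def \<sigma>0_def s1_def \<kappa>_def \<kappa>1_def rate_def rate'_def A1_def)
    interpret large_schedule b0 b a' a u x \<epsilon> r \<eta> J N
    proof unfold_locales
      show "1 \<le> L" "1 \<le> R * (1 / x - 1)" "L + 1 \<le> R / x" "1 / R \<le> \<epsilon>" "d \<le> \<epsilon> * \<sigma>0"
        "rate' \<le> \<kappa>\<^sup>2 * x / 4" "exp (rate * (L + 1)) \<le> 1 + \<eta> / 4"
        using elim unfolding eqs by simp_all
      have "2 * real J * (D1 * (- ln x) / ?l / s1) = 2 * real J * (D1 * (- ln x) / s1) / ?l" by simp
      then show "exp (2 * real J * (d / \<sigma>0)) \<le> 1 + \<epsilon> / 3" using elim unfolding eqs by metis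
      show "rate * (R / x + 1) \<le> L" using elim unfolding eqs by simp
      show "4 * rate / x \<le> (b - b0)\<^sup>2" using elim unfolding eqs by (simp add: mult.commute)
      have "((a - a') / 2)\<^sup>2 / 2 * ?l = ((a - a') / 2)\<^sup>2 * ?l / 2" by simp
      then show "exp (rate * (R / x ^ J + 1) - ((a - a') / 2)\<^sup>2 * L / 2) * (L / - ln x) \<le> \<eta> / 4"
        using elim unfolding eqs by simp
      have eq1: "r / 2 * D1\<^sup>2 / (2 * ?l\<^sup>2) = r / 2 * D1\<^sup>2 / 2 / ?l\<^sup>2" by simp
      have eq2: "?l / - ln x = ?l * (1 / - ln x)" by simp
      show "exp (- (r / 2 * D\<^sup>2 / (2 * L\<^sup>2) * R)) * (L / - ln x) \<le> \<eta> / 4"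
        using elim unfolding eqs eq1 eq2 by blast
      have "(u - a)\<^sup>2 / 2 * ?l = (u - a)\<^sup>2 * ?l / 2" by simp
      then show "exp (- ((u - a)\<^sup>2 * L / 2)) \<le> \<eta> / 4" using elim unfolding eqs by metis
    qed
    have \<beta>: "\<beta> N = rate" by (simp add: \<beta>_def rate_def L_def D_def)
    show ?case
      unfolding \<beta> using st_Nil survival renewal by (intro exI[of _ st]) blast
  qed
qed

section \<open>The algorithm\<close>

text \<open>\<open>two_stage\<close> hands the first-stage rewards to \<open>E\<close> as one flat
  list; this recovers the words of the single arms.\<close>

primrec chunks :: "nat \<Rightarrow> nat \<Rightarrow> 'a list \<Rightarrow> 'a list list" where
  "chunks m 0 rs = []"
| "chunks m (Suc n) rs = take m rs # chunks m n (drop m rs)"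

lemma chunks_concat: "ws \<in> words (words A m) n \<Longrightarrow> chunks m n (concat ws) = ws"
proof (induction n arbitrary: ws)
  case (Suc n)
  then obtain w ws' where "ws = w # ws'" "length w = m" "ws' \<in> words (words A m) n"
    by (auto simp: words_def length_Suc_conv)
  then show ?case using Suc.IH[of ws'] by simp
qed (auto simp: words_def)

definition emp_cdf :: "nat \<Rightarrow> nat \<Rightarrow> nat \<Rightarrow> bool list list \<Rightarrow> nat \<Rightarrow> real" where
  "emp_cdf m Q n ws j = (\<Sum>i<n. of_bool (successes m (ws ! i) \<le> real m * (real j / real Q))) / real n"

text \<open>The expectation of \<open>emp_cdf\<close>. It differs from \<open>G \<mu>\<close> by the
  blurring due to \<open>m\<close> pulls, a bias that more arms do not reduce and that is controlled
  through \<open>m\<close>.\<close>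

definition mean_cdf :: "real measure \<Rightarrow> nat \<Rightarrow> nat \<Rightarrow> nat \<Rightarrow> real" where
  "mean_cdf \<mu> m Q j = (\<Sum>w\<in>rewards m. (\<integral>x. wt (clip x) w \<partial>\<mu>) * of_bool (successes m w \<le> real m * (real j / real Q)))"

text \<open>Union bound over the grid. The exponent is linear in \<open>n\<close>, hence a first
  stage with any fixed small share of the budget errs far less than the search, whose exponent is of
  order \<open>N / (ln N)^2\<close>.\<close>

lemma emp_cdf_concentration:
  assumes res: "reservoir \<mu>" and \<kappa>: "0 \<le> \<kappa>" "\<kappa> \<le> 1" and n: "0 < n"
  shows "(\<Sum>ws\<in>words (rewards m) n \<inter> {ws. \<exists>j<Q. \<kappa> < \<bar>emp_cdf m Q n ws j - mean_cdf \<mu> m Q j\<bar>}. \<Prod>i<n. \<integral>x. wt (clip x) (ws ! i) \<partial>\<mu>)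
    \<le> 2 * real Q * exp (- (real n * \<kappa>\<^sup>2 / 2))"
proof -
  interpret prob_space \<mu> using reservoir_prob[OF res] .
  let ?\<nu> = "\<lambda>w. \<integral>x. wt (clip x) w \<partial>\<mu>"
  let ?F = "\<lambda>ws. \<Prod>i<n. ?\<nu> (ws ! i)"
  let ?W = "words (rewards m) n"
  let ?\<phi> = "\<lambda>j w. successes m w \<le> real m * (real j / real Q)"
  let ?B = "\<lambda>j. {ws\<in>?W. real n * \<kappa> \<le> \<bar>(\<Sum>i<n. of_bool (?\<phi> j (ws ! i))) - real n * mean_cdf \<mu> m Q j\<bar>}"
  have \<nu>: "0 \<le> ?\<nu> w" for w
    by (intro Bochner_Integration.integral_nonneg) (auto intro: wt_nonneg)
  have \<nu>1: "(\<Sum>w\<in>rewards m. ?\<nu> w) = 1"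
    by (subst Bochner_Integration.integral_sum[symmetric]) (auto simp: integral_low_prob(3)[OF res] sum_wt prob_space)
  have F: "0 \<le> ?F ws" for ws using \<nu> by (intro prod_nonneg) auto
  have sub: "?W \<inter> {ws. \<exists>j<Q. \<kappa> < \<bar>emp_cdf m Q n ws j - mean_cdf \<mu> m Q j\<bar>} \<subseteq> (\<Union>j<Q. ?B j)"
  proof
    fix ws assume ws: "ws \<in> ?W \<inter> {ws. \<exists>j<Q. \<kappa> < \<bar>emp_cdf m Q n ws j - mean_cdf \<mu> m Q j\<bar>}"
    then obtain j where j: "j < Q" "\<kappa> < \<bar>emp_cdf m Q n ws j - mean_cdf \<mu> m Q j\<bar>" by auto
    have "(\<Sum>i<n. of_bool (?\<phi> j (ws ! i))) - real n * mean_cdf \<mu> m Q j = real n * (emp_cdf m Q n ws j - mean_cdf \<mu> m Q j)"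
      using n by (simp add: emp_cdf_def right_diff_distrib del: of_bool_eq_iff sum_of_bool_eq)
    then have "\<bar>(\<Sum>i<n. of_bool (?\<phi> j (ws ! i))) - real n * mean_cdf \<mu> m Q j\<bar> = real n * \<bar>emp_cdf m Q n ws j - mean_cdf \<mu> m Q j\<bar>"
      by (simp only: abs_mult abs_of_nat)
    moreover have "real n * \<kappa> \<le> real n * \<bar>emp_cdf m Q n ws j - mean_cdf \<mu> m Q j\<bar>" using j by (intro mult_left_mono) auto
    ultimately have "real n * \<kappa> \<le> \<bar>(\<Sum>i<n. of_bool (?\<phi> j (ws ! i))) - real n * mean_cdf \<mu> m Q j\<bar>"
      by (simp only:)
    then show "ws \<in> (\<Union>j<Q. ?B j)" using ws j(1) by blast
  qed
  have "(\<Sum>ws\<in>?W \<inter> {ws. \<exists>j<Q. \<kappa> < \<bar>emp_cdf m Q n ws j - mean_cdf \<mu> m Q j\<bar>}. ?F ws) \<le> (\<Sum>ws\<in>(\<Union>j<Q. ?B j). ?F ws)"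
    using F by (intro sum_mono2 sub) auto
  also have "\<dots> \<le> (\<Sum>ws\<in>(\<Union>j<Q. ?B j). \<Sum>j<Q. if ws \<in> ?B j then ?F ws else 0)"
  proof (rule sum_mono)
    fix ws assume "ws \<in> (\<Union>j<Q. ?B j)"
    then obtain j where j: "j < Q" "ws \<in> ?B j" by blast
    have "(if ws \<in> ?B j then ?F ws else 0) \<le> (\<Sum>j<Q. if ws \<in> ?B j then ?F ws else 0)"
      by (rule member_le_sum) (use j F in auto)
    then show "?F ws \<le> (\<Sum>j<Q. if ws \<in> ?B j then ?F ws else 0)" using j by (simp only: if_True)
  qed
  also have "\<dots> \<le> (\<Sum>ws\<in>?W. \<Sum>j<Q. if ws \<in> ?B j then ?F ws else 0)"
    using F by (intro sum_mono2 sum_nonneg) auto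
  also have "\<dots> = (\<Sum>j<Q. \<Sum>ws\<in>?W. if ws \<in> ?B j then ?F ws else 0)"
    by (rule sum.swap)
  also have "\<dots> = (\<Sum>j<Q. \<Sum>ws\<in>?B j. ?F ws)"
    by (intro sum.cong refl sum.mono_neutral_cong_right) auto
  also have "\<dots> \<le> (\<Sum>j<Q. 2 * exp (- (real n * \<kappa>\<^sup>2 / 2)))"
    unfolding mean_cdf_def by (intro sum_mono sum_words_deviation \<kappa>) (use \<nu> \<nu>1 in auto)
  finally show ?thesis by (simp add: mult_ac)
qed

text \<open>\<open>Q\<close> is chosen for the two discretisation errors \<open>1 / Q\<close>,
  \<open>\<kappa>\<close> for the statistical error, and finally \<open>m\<close> so that blurring
  beyond one grid step stays below \<open>\<kappa>\<close>; this explains the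
  \<open>2 * \<kappa>\<close> in the comparison. The choice is uniform in the reservoir.\<close>

lemma estimation:
  fixes \<eta>1 \<eta>2 \<delta> :: real
  assumes \<eta>: "0 \<le> \<eta>2" "\<eta>2 < \<eta>1" "\<eta>1 \<le> 1" and \<delta>: "0 < \<delta>"
  obtains m Q :: nat and \<kappa> :: real where "0 < m" "0 < Q" "0 < \<kappa>" "\<kappa> \<le> 1"
    "\<And>\<mu> F. reservoir \<mu> \<Longrightarrow> (\<And>j. j < Q \<Longrightarrow> \<bar>F j - mean_cdf \<mu> m Q j\<bar> \<le> \<kappa>) \<Longrightarrow>
      \<bar>grid_alpha \<eta>1 \<eta>2 Q F - alpha \<mu> \<eta>1 \<eta>2\<bar> \<le> \<delta>"
proof -
  let ?w = "\<eta>1 - \<eta>2"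
  obtain Q :: nat where Q: "4 / \<delta> < real Q" using reals_Archimedean2 by blast
  then have Q0: "0 < Q" using \<delta> by (intro gr0I) (auto simp: field_simps)
  have Q1: "2 / real Q \<le> \<delta> / 2" using Q Q0 \<delta> by (simp add: field_simps)
  define \<kappa> where "\<kappa> = min 1 (?w * \<delta> / 8)"
  have \<kappa>: "0 < \<kappa>" "\<kappa> \<le> 1" "\<kappa> / ?w \<le> \<delta> / 8" using \<eta> \<delta> by (auto simp: \<kappa>_def field_simps min_def)
  have "((\<lambda>m. exp (- (real m * (1 / real Q)\<^sup>2 / 2))) \<longlongrightarrow> 0) sequentially"
    using Q0 by real_asymp
  then have "eventually (\<lambda>m. exp (- (real m * (1 / real Q)\<^sup>2 / 2)) < \<kappa> \<and> 0 < m) sequentially"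
    using \<kappa> by (intro eventually_conj order_tendstoD eventually_gt_at_top) auto
  then obtain m where m: "exp (- (real m * (1 / real Q)\<^sup>2 / 2)) < \<kappa>" "0 < m"
    using eventually_happens'[OF sequentially_bot] by blast
  show ?thesis
  proof (rule that[OF m(2) Q0 \<kappa>(1,2)])
    fix \<mu> :: "real measure" and F :: "nat \<Rightarrow> real"
    assume res: "reservoir \<mu>" and F: "\<And>j. j < Q \<Longrightarrow> \<bar>F j - mean_cdf \<mu> m Q j\<bar> \<le> \<kappa>"
    let ?g = "\<lambda>j. G \<mu> (real j / real Q)"
    have q: "0 < 1 / real Q" "1 / real Q \<le> 1" using Q0 by auto
    have mean: "mean_cdf \<mu> m Q j = (\<integral>x. low_prob m (real j / real Q) (clip x) \<partial>\<mu>)" for j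
      by (simp add: mean_cdf_def integral_low_prob(1)[OF res])
    have "\<bar>grid_alpha \<eta>1 \<eta>2 Q F - grid_alpha \<eta>1 \<eta>2 Q ?g\<bar> \<le> 1 / real Q + (2 * \<kappa>) / ?w"
    proof (rule grid_alpha_shift[OF \<eta>(2) Q0])
      fix j assume j: "j < Q"
      have eq: "real j / real Q + 1 / real Q = real (Suc j) / real Q" by (simp add: add_divide_distrib[symmetric])
      have "mean_cdf \<mu> m Q j \<le> ?g (Suc j) + \<kappa>"
        using integral_low_prob_bounds(1)[OF res q, of "real j / real Q" m] m j unfolding mean eq
        by (simp add: divide_le_eq)
      then show "F j \<le> ?g (Suc j) + 2 * \<kappa>" using F[OF j] by linarith
    next
      fix j assume j: "Suc j < Q"
      have eq: "real (Suc j) / real Q - 1 / real Q = real j / real Q" by (simp add: diff_divide_distrib[symmetric])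
      have "?g j \<le> mean_cdf \<mu> m Q (Suc j) + \<kappa>"
        using integral_low_prob_bounds(2)[OF res q, of "real (Suc j) / real Q" m] m unfolding mean eq
        by simp
      then show "?g j \<le> F (Suc j) + 2 * \<kappa>" using F[OF j] by linarith
    qed (use \<kappa> in auto)
    moreover have "\<bar>alpha \<mu> \<eta>1 \<eta>2 - grid_alpha \<eta>1 \<eta>2 Q ?g\<bar> \<le> 1 / real Q"
      by (rule alpha_grid[OF res \<eta>(1,2) Q0])
    moreover have "1 / real Q + 1 / real Q \<le> \<delta> / 2" using Q1 by simp
    moreover have "(2 * \<kappa>) / ?w \<le> \<delta> / 4" using \<kappa>(3) by (simp add: mult.commute)
    ultimately show "\<bar>grid_alpha \<eta>1 \<eta>2 Q F - alpha \<mu> \<eta>1 \<eta>2\<bar> \<le> \<delta>" using \<delta> by linarith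
  qed
qed

text \<open>The cosine is 1-Lipschitz. Both bounds together keep
  \<open>c = (ang \<alpha> - ang (\<alpha> - \<epsilon>))^2 / 2\<close> between
  \<open>2 * \<epsilon>^2\<close> and \<open>pi^2 / 2\<close>, uniformly in the reservoir.\<close>

lemma ang_diff_lower:
  assumes "0 \<le> b" "b \<le> a" "a \<le> 1"
  shows "2 * (a - b) \<le> ang a - ang b" "ang a - ang b \<le> pi"
proof -
  have le: "ang b \<le> ang a" using assms by (intro arccos_le_arccos) auto
  have c: "cos (ang a) = 1 - 2 * a" "cos (ang b) = 1 - 2 * b" using assms by auto
  have "cos (ang b) - cos (ang a) = 2 * (sin ((ang b + ang a) / 2) * sin ((ang a - ang b) / 2))"
    by (simp add: cos_diff_cos)
  also have "\<dots> \<le> 2 * \<bar>sin ((ang b + ang a) / 2) * sin ((ang a - ang b) / 2)\<bar>" by simp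
  also have "\<dots> \<le> 2 * (1 * \<bar>(ang a - ang b) / 2\<bar>)"
    unfolding abs_mult by (intro mult_mono abs_sin_x_le_abs_x) auto
  finally show "2 * (a - b) \<le> ang a - ang b" using le c by simp
  show "ang a - ang b \<le> pi" using assms arccos_ubound[of "1 - 2 * a"] arccos_lbound[of "1 - 2 * b"] by auto
qed

text \<open>The derivative of \<open>ang\<close> is unbounded near 0 and 1, which \<alpha> -
  \<epsilon> and \<alpha> may approach; compactness supplies a uniform modulus of
  continuity.\<close>

lemma ang_uniform:
  assumes "0 < \<omega>"
  obtains \<delta> where "0 < \<delta>" "\<And>x y. x \<in> {0..1} \<Longrightarrow> y \<in> {0..1} \<Longrightarrow> \<bar>x - y\<bar> < \<delta> \<Longrightarrow> \<bar>ang x - ang y\<bar> < \<omega>"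
proof -
  have "uniformly_continuous_on {0..1} ang"
    by (intro compact_uniformly_continuous continuous_intros) auto
  then obtain \<delta> where "0 < \<delta>" "\<And>x y. x \<in> {0..1} \<Longrightarrow> y \<in> {0..1} \<Longrightarrow> dist y x < \<delta> \<Longrightarrow> dist (ang y) (ang x) < \<omega>"
    using assms unfolding uniformly_continuous_on_def by blast
  then show ?thesis by (intro that[of \<delta>]) (auto simp: dist_real_def)
qed

lemma final_asymptotics:
  fixes c1 c2 c3 c4 c5 :: real
  assumes "0 < c1" "0 < c2" "0 < c3" "0 < c4" "0 < c5"
  shows "eventually (\<lambda>t. t * (t + 1) * exp (- (c1 * t / (ln t)\<^sup>2)) \<le> 1 / 2) at_top"
    "eventually (\<lambda>t. c2 * exp (- ((c3 * t - 1) * c4) + c5 * t / (ln t)\<^sup>2) \<le> 1 / 2) at_top"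
proof -
  have "((\<lambda>t. t * (t + 1) * exp (- (c1 * t / (ln t)\<^sup>2))) \<longlongrightarrow> 0) at_top"
    using assms by real_asymp
  then have "eventually (\<lambda>t. t * (t + 1) * exp (- (c1 * t / (ln t)\<^sup>2)) < 1 / 2) at_top"
    by (rule order_tendstoD) simp
  then show "eventually (\<lambda>t. t * (t + 1) * exp (- (c1 * t / (ln t)\<^sup>2)) \<le> 1 / 2) at_top"
    by eventually_elim simp
  have "((\<lambda>t. c2 * exp (- ((c3 * t - 1) * c4) + c5 * t / (ln t)\<^sup>2)) \<longlongrightarrow> 0) at_top"
    using assms by real_asymp
  then have "eventually (\<lambda>t. c2 * exp (- ((c3 * t - 1) * c4) + c5 * t / (ln t)\<^sup>2) < 1 / 2) at_top"
    by (rule order_tendstoD) simp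
  then show "eventually (\<lambda>t. c2 * exp (- ((c3 * t - 1) * c4) + c5 * t / (ln t)\<^sup>2) \<le> 1 / 2) at_top"
    by eventually_elim simp
qed

text \<open>The case \<alpha> < \<epsilon> is left to \<open>fail_prob_eq_0\<close>: almost surely
  no mean lies below a negative threshold.\<close>

lemma eventually_good_algorithm:
  fixes \<eta>1 \<eta>2 \<epsilon> r :: real
  assumes \<eta>: "0 \<le> \<eta>2" "\<eta>2 < \<eta>1" "\<eta>1 \<le> 1" and \<epsilon>: "0 < \<epsilon>" and r: "0 < r" "r < 1"
  shows "eventually (\<lambda>N. \<exists>A. \<forall>\<mu>. reservoir \<mu> \<longrightarrow> 0 \<le> alpha \<mu> \<eta>1 \<eta>2 - \<epsilon> \<longrightarrow>
    fail_prob A \<mu> N (alpha \<mu> \<eta>1 \<eta>2 - \<epsilon>)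
      \<le> exp (- ((1 - r) * cab (alpha \<mu> \<eta>1 \<eta>2) (alpha \<mu> \<eta>1 \<eta>2 - \<epsilon>) * real N / (ln (real N))\<^sup>2))) sequentially"
proof -
  \<comment> \<open>Three losses by a factor \<open>1 - r1\<close> (stopping rule, angular distance,
    length of the search) amount to at most \<open>r / 2\<close>; the other \<open>r / 2\<close>
    absorbs the polynomial factor in \<open>Z\<close>.\<close>
  define r1 where "r1 = r / 6"
  have r1: "0 < r1" "r1 < 1" using r by (auto simp: r1_def)
  obtain \<delta>0 where \<delta>0: "0 < \<delta>0"
    and ang_close: "\<And>x y. x \<in> {0..1} \<Longrightarrow> y \<in> {0..1} \<Longrightarrow> \<bar>x - y\<bar> < \<delta>0 \<Longrightarrow> \<bar>ang x - ang y\<bar> < \<epsilon> * r1 / 2"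
    using ang_uniform[of "\<epsilon> * r1 / 2"] \<epsilon> r1 by (metis divide_pos_pos mult_pos_pos zero_less_numeral)
  define \<delta> where "\<delta> = min 1 (min (\<epsilon> / 8) (\<delta>0 / 8))"
  have \<delta>: "0 < \<delta>" "\<delta> \<le> 1" "8 * \<delta> \<le> \<epsilon>" "8 * \<delta> \<le> \<delta>0" using \<epsilon> \<delta>0 by (auto simp: \<delta>_def)
  define \<eta> where "\<eta> = (\<eta>1 - \<eta>2) * \<delta>"
  have \<eta>0: "0 < \<eta>" using \<eta> \<delta> by (simp add: \<eta>_def)
  obtain m Q :: nat and \<kappa> :: real where mQ: "0 < m" "0 < Q" "0 < \<kappa>" "\<kappa> \<le> 1"
    and est: "\<And>\<mu> F. reservoir \<mu> \<Longrightarrow> (\<And>j. j < Q \<Longrightarrow> \<bar>F j - mean_cdf \<mu> m Q j\<bar> \<le> \<kappa>) \<Longrightarrow>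
      \<bar>grid_alpha \<eta>1 \<eta>2 Q F - alpha \<mu> \<eta>1 \<eta>2\<bar> \<le> \<delta>"
    using estimation[OF \<eta> \<delta>(1)] by blast
  \<comment> \<open>For the rounded estimate, \<alpha> lies between \<open>lev g - \<delta>\<close>
    and \<open>lev g + 2 * \<delta>\<close>. So \<alpha> - \<epsilon> stays below
    \<open>b0 = lev g + 2 * \<delta> - \<epsilon>\<close>, and arms above \<alpha> - \<delta> are
    above \<open>u = lev g - 2 * \<delta>\<close>. The remaining levels follow at distance
    \<open>\<delta>\<close>, for which \<open>8 * \<delta> \<le> \<epsilon>\<close> leaves
    room.\<close>
  define lev where "lev g = real g * \<delta>" for g :: nat
  define D where "D g = ang (lev g - 4 * \<delta>) - ang (lev g + 3 * \<delta> - \<epsilon>)" for g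
  define \<beta> where "\<beta> g N = (1 - r1) * (D g)\<^sup>2 / (2 * (ln (real N))\<^sup>2)" for g N
  define good where "good g N st \<longleftrightarrow> \<not> st [] \<and>
     (\<forall>n\<le>N. \<forall>y<lev g + 2 * \<delta> - \<epsilon>. hit_prob st (\<lambda>w. \<not> st w) (clip y) [] n \<le> real N * exp (- \<beta> g N * real n)) \<and>
     (\<forall>\<mu>. prob_space \<mu> \<longrightarrow> sets \<mu> = sets borel \<longrightarrow> \<eta> \<le> measure \<mu> {lev g - 2 * \<delta>..} \<longrightarrow>
       (\<Sum>m=1..N. ennreal (exp (\<beta> g N * real m)) * (\<integral>\<^sup>+ y. ennreal (hit_prob st st (clip y) [] m) \<partial>\<mu>)) \<le> 1)" for g N st
  \<comment> \<open>Only finitely many levels can occur, so one lower bound on \<open>N\<close>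
    works for all; the constraints ensure \<open>0 \<le> b0\<close> and
    \<open>u \<le> 1\<close>.\<close>
  define Gs where "Gs = {g. g \<le> nat \<lfloor>1 / \<delta>\<rfloor> \<and> 0 \<le> lev g + 2 * \<delta> - \<epsilon> \<and> lev g \<le> 1}"
  have fin: "finite Gs" by (rule finite_subset[of _ "{..nat \<lfloor>1 / \<delta>\<rfloor>}"]) (auto simp: Gs_def)
  have "eventually (\<lambda>N. \<exists>st. good g N st) sequentially" if g: "g \<in> Gs" for g
    unfolding good_def \<beta>_def D_def
    by (rule eventually_good_stopping_rule[where a = "lev g - 3 * \<delta>"]) (use g \<delta> \<epsilon> r1 \<eta>0 in \<open>auto simp: Gs_def\<close>)
  then have ev1: "eventually (\<lambda>N. \<forall>g\<in>Gs. \<exists>st. good g N st) sequentially"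
    using fin by (simp add: eventually_ball_finite)
  \<comment> \<open>With \<open>n0\<close> about \<open>c3 * N\<close> arms, the first stage takes
    at most the share \<open>r1\<close> of the budget.\<close>
  define c3 where "c3 = r1 / real m"
  have c3: "0 < c3" using r1 mQ by (simp add: c3_def)
  \<comment> \<open>These make search error and estimation error at most half of the target each;
    \<open>c \<ge> 2 * \<epsilon>^2\<close> and \<open>c \<le> pi^2 / 2\<close> remove \<alpha> from
    the two conditions.\<close>
  have "eventually (\<lambda>t. t * (t + 1) * exp (- (r * \<epsilon>\<^sup>2 * t / (ln t)\<^sup>2)) \<le> 1 / 2
      \<and> 2 * real Q * exp (- ((c3 * t - 1) * (\<kappa>\<^sup>2 / 2)) + pi\<^sup>2 / 2 * t / (ln t)\<^sup>2) \<le> 1 / 2 \<and> 1 / c3 \<le> t \<and> 3 \<le> t) at_top"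
    by (intro eventually_conj final_asymptotics[where ?c2.0 = 1 and ?c3.0 = 1 and ?c4.0 = 1 and ?c5.0 = 1]
        final_asymptotics(2)[where ?c1.0 = 1] eventually_ge_at_top) (use r \<epsilon> mQ c3 in auto)
  from ev1 eventually_compose_filterlim[OF this filterlim_real_sequentially] show ?thesis
  proof eventually_elim
    case (elim N)
    let ?L = "ln (real N)"
    define st where "st g = (SOME s. good g N s)" for g
    have st: "good g N (st g)" if "g \<in> Gs" for g
      unfolding st_def using elim(1) that by (metis someI)
    define n0 where "n0 = nat \<lfloor>c3 * real N\<rfloor>"
    have N3: "3 \<le> real N" "1 / c3 \<le> real N" using elim(2) by auto
    have L0: "0 < ?L" using N3 by simp
    have n0: "real n0 \<le> c3 * real N" "c3 * real N - 1 \<le> real n0" "0 < n0"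
    proof -
      have "1 \<le> c3 * real N" using N3 c3 by (simp add: field_simps)
      then show "real n0 \<le> c3 * real N" "c3 * real N - 1 \<le> real n0" "0 < n0"
        unfolding n0_def by linarith+
    qed
    have n0m: "real (n0 * m) \<le> r1 * real N"
    proof -
      have "real (n0 * m) \<le> c3 * real N * real m" using n0(1) by (simp add: mult_right_mono)
      then show ?thesis using mQ by (simp add: c3_def)
    qed
    also have "\<dots> \<le> real N" using r1 by (simp add: mult_left_le_one_le)
    finally have n0mN: "n0 * m \<le> N" by linarith
    define n where "n = N - n0 * m"
    have Nn: "N = n0 * m + n" using n0mN by (simp add: n_def)
    have n: "n \<le> N" "(1 - r1) * real N \<le> real n"
      using n0m n0mN by (auto simp: n_def of_nat_diff algebra_simps)
    define est_level where "est_level rs = nat \<lfloor>grid_alpha \<eta>1 \<eta>2 Q (emp_cdf m Q n0 (chunks m n0 rs)) / \<delta>\<rfloor>" for rs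
    define E where "E rs = st (est_level rs)" for rs
    show ?case
    proof (intro exI[of _ "policy (two_stage m n0 E)"] allI impI)
      fix \<mu> :: "real measure"
      assume res: "reservoir \<mu>" and thr: "0 \<le> alpha \<mu> \<eta>1 \<eta>2 - \<epsilon>"
      define \<alpha> where "\<alpha> = alpha \<mu> \<eta>1 \<eta>2"
      define c where "c = cab \<alpha> (\<alpha> - \<epsilon>)"
      define \<Delta> where "\<Delta> = ang \<alpha> - ang (\<alpha> - \<epsilon>)"
      have \<alpha>: "\<epsilon> \<le> \<alpha>" "\<alpha> \<le> 1" using thr alpha_le_1[OF res \<eta>(1,2)] by (auto simp: \<alpha>_def)
      have \<Delta>: "2 * \<epsilon> \<le> \<Delta>" "\<Delta> \<le> pi" using ang_diff_lower[of "\<alpha> - \<epsilon>" \<alpha>] \<alpha> \<epsilon> by (auto simp: \<Delta>_def)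
      have c_eq: "c = \<Delta>\<^sup>2 / 2" by (simp add: c_def cab_def \<Delta>_def)
      have c_lo: "2 * \<epsilon>\<^sup>2 \<le> c" using power_mono[OF \<Delta>(1), of 2] \<epsilon> by (simp add: c_eq power2_eq_square)
      have c_hi: "c \<le> pi\<^sup>2 / 2" using power_mono[OF \<Delta>(2), of 2] \<Delta>(1) \<epsilon> by (simp add: c_eq)
      define T where "T = real N / ?L\<^sup>2"
      have T: "0 \<le> T" by (simp add: T_def)
      define Z where "Z = real N * (real N + 1) * exp (- ((1 - r / 2) * c * T))"
      define Bad where "Bad = {ws. \<exists>j<Q. \<kappa> < \<bar>emp_cdf m Q n0 ws j - mean_cdf \<mu> m Q j\<bar>}"
      have "fail_prob (policy (two_stage m n0 E)) \<mu> N (\<alpha> - \<epsilon>)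
        \<le> Z + (\<Sum>ws\<in>words (rewards m) n0 \<inter> Bad. \<Prod>i<n0. \<integral>x. wt (clip x) (ws ! i) \<partial>\<mu>)"
      proof (rule fail_prob_two_stage_le[OF reservoir_prob[OF res] reservoir_sets[OF res] _ Nn])
        show "0 \<le> Z" by (simp add: Z_def)
        fix ws assume ws: "ws \<in> words (rewards m) n0" "ws \<notin> Bad"
        define ah where "ah = grid_alpha \<eta>1 \<eta>2 Q (emp_cdf m Q n0 ws)"
        define g where "g = nat \<lfloor>ah / \<delta>\<rfloor>"
        have Eg: "E (concat ws) = st g"
          by (simp add: E_def est_level_def chunks_concat[OF ws(1)] g_def ah_def)
        have ah: "\<bar>ah - \<alpha>\<bar> \<le> \<delta>"
        proof -
          have "\<forall>j<Q. \<bar>emp_cdf m Q n0 ws j - mean_cdf \<mu> m Q j\<bar> \<le> \<kappa>"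
            using ws(2) unfolding Bad_def by force
          then show ?thesis unfolding ah_def \<alpha>_def by (intro est res) blast
        qed
        have ah01: "0 \<le> ah" "ah \<le> 1" unfolding ah_def by (rule grid_alpha_bounds[OF \<eta>(2) mQ(2)])+
        have lev: "lev g \<le> ah" "ah < lev g + \<delta>"
        proof -
          have "0 \<le> ah / \<delta>" using ah01 \<delta> by simp
          then have "real g \<le> ah / \<delta>" "ah / \<delta> < real g + 1" unfolding g_def by linarith+
          then show "lev g \<le> ah" "ah < lev g + \<delta>" using \<delta> by (auto simp: lev_def field_simps)
        qed
        have g: "g \<in> Gs"
        proof -
          have "ah / \<delta> \<le> 1 / \<delta>" using ah01 \<delta> by (intro divide_right_mono) auto
          then have "g \<le> nat \<lfloor>1 / \<delta>\<rfloor>" unfolding g_def by (intro nat_mono floor_mono)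
          then show ?thesis using lev ah ah01 \<alpha> \<delta> by (auto simp: Gs_def abs_le_iff)
        qed
        have D: "(1 - r1 / 2) * \<Delta> \<le> D g"
        proof -
          have "\<bar>ang \<alpha> - ang (lev g - 4 * \<delta>)\<bar> < \<epsilon> * r1 / 2"
            using lev ah ah01 \<alpha> \<delta> g by (intro ang_close) (auto simp: Gs_def abs_le_iff)
          moreover have "\<bar>ang (\<alpha> - \<epsilon>) - ang (lev g + 3 * \<delta> - \<epsilon>)\<bar> < \<epsilon> * r1 / 2"
            using lev ah ah01 \<alpha> \<delta> g by (intro ang_close) (auto simp: Gs_def abs_le_iff)
          ultimately have "\<Delta> - \<epsilon> * r1 \<le> D g" unfolding D_def \<Delta>_def by linarith
          moreover have "2 * \<epsilon> * (r1 / 2) \<le> \<Delta> * (r1 / 2)" using \<Delta> r1 by (intro mult_right_mono) auto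
          ultimately show ?thesis by (simp add: algebra_simps)
        qed
        have D2: "(1 - r1) * (2 * c) \<le> (D g)\<^sup>2"
        proof -
          have "1 - r1 \<le> (1 - r1 / 2)\<^sup>2" by (simp add: power2_eq_square algebra_simps)
          then have "(1 - r1) * \<Delta>\<^sup>2 \<le> (1 - r1 / 2)\<^sup>2 * \<Delta>\<^sup>2" by (intro mult_right_mono) auto
          also have "\<dots> = ((1 - r1 / 2) * \<Delta>)\<^sup>2" by (simp add: power_mult_distrib)
          also have "\<dots> \<le> (D g)\<^sup>2" using D \<Delta> \<epsilon> r1 by (intro power_mono) auto
          finally show ?thesis by (simp add: c_eq)
        qed
        have rate: "(1 - r / 2) * c * T \<le> \<beta> g N * real n"
        proof -
          have "1 + 3 * (- r1) \<le> (1 + (- r1)) ^ 3"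
            using Bernoulli_inequality[of "- r1" 3] r1 by simp
          then have "1 - r / 2 \<le> (1 - r1) * (1 - r1) * (1 - r1)"
            by (simp add: r1_def power3_eq_cube)
          then have "(1 - r / 2) * (c * T) \<le> (1 - r1) * (1 - r1) * (1 - r1) * (c * T)"
            using c_lo T order_trans[OF zero_le_power2[of \<epsilon>]] by (intro mult_right_mono mult_nonneg_nonneg) (auto simp: c_eq)
          also have "\<dots> = (1 - r1) * ((1 - r1) * (2 * c)) / (2 * ?L\<^sup>2) * ((1 - r1) * real N)"
            by (simp add: T_def)
          also have "\<dots> \<le> \<beta> g N * real n"
          proof (rule mult_mono)
            show "(1 - r1) * ((1 - r1) * (2 * c)) / (2 * ?L\<^sup>2) \<le> \<beta> g N"
              unfolding \<beta>_def using r1 by (intro divide_right_mono mult_left_mono D2) auto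
            show "0 \<le> \<beta> g N" unfolding \<beta>_def using r1 by simp
          qed (use n r1 in auto)
          finally show ?thesis by (simp add: mult.assoc)
        qed
        have gd: "good g N (st g)" by (rule st[OF g])
        have frac: "\<eta> \<le> measure \<mu> {lev g - 2 * \<delta>..}"
        proof -
          interpret prob_space \<mu> using reservoir_prob[OF res] .
          have "\<eta> \<le> measure \<mu> {\<alpha> - \<delta>..}"
            unfolding \<eta>_def \<alpha>_def by (rule good_fraction[OF res \<eta> \<delta>(1,2)])
          also have "\<dots> \<le> measure \<mu> {lev g - 2 * \<delta>..}"
            using lev ah by (intro finite_measure_mono) (auto simp: reservoir_sets[OF res] abs_le_iff)
          finally show ?thesis .
        qed
        \<comment> \<open>The likelihoods of the first-stage words are the weights on the arms
          before \<open>n0\<close>.\<close>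
        have "(\<integral>\<^sup>+ p. (\<Prod>i\<in>{..<n0}. ennreal (wt (clip (p i)) (ws ! i))) * ennreal (search_fail (st g) (\<alpha> - \<epsilon>) p n0 [] n) \<partial>PiM UNIV (\<lambda>_. \<mu>))
          \<le> (\<Prod>i\<in>{..<n0}. \<integral>\<^sup>+ x. ennreal (wt (clip x) (ws ! i)) \<partial>\<mu>) * ennreal (real N * (real n + 1) * exp (- \<beta> g N * real n))"
        proof (rule search_fail_integral_le[OF reservoir_prob[OF res] reservoir_sets[OF res], where g = "\<lambda>i x. ennreal (wt (clip x) (ws ! i))" and N = N])
          show "\<not> st g []" using gd by (simp add: good_def)
          show "hit_prob (st g) (\<lambda>u. \<not> st g u) (clip x) [] k \<le> real N * exp (- \<beta> g N * real k)" if "k \<le> N" "x < \<alpha> - \<epsilon>" for k x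
          proof -
            have "x < lev g + 2 * \<delta> - \<epsilon>" using that lev ah by (auto simp: abs_le_iff)
            then show ?thesis using gd that by (simp add: good_def)
          qed
          show "(\<Sum>m=1..N. ennreal (exp (\<beta> g N * real m)) * (\<integral>\<^sup>+ x. ennreal (hit_prob (st g) (st g) (clip x) [] m) \<partial>\<mu>)) \<le> 1"
            using gd frac reservoir_prob[OF res] reservoir_sets[OF res] by (simp add: good_def)
          show "(\<lambda>x. ennreal (wt (clip x) (ws ! j))) \<in> borel_measurable \<mu>" for j
            by (simp add: measurable_cong_sets[OF reservoir_sets[OF res] refl])
        qed (use n in auto)
        also have "\<dots> \<le> (\<Prod>i\<in>{..<n0}. \<integral>\<^sup>+ x. ennreal (wt (clip x) (ws ! i)) \<partial>\<mu>) * ennreal Z"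
        proof (intro mult_left_mono ennreal_leI)
          have "exp (- \<beta> g N * real n) \<le> exp (- ((1 - r / 2) * c * T))" using rate by simp
          then show "real N * (real n + 1) * exp (- \<beta> g N * real n) \<le> Z"
            unfolding Z_def using n by (intro mult_mono) auto
        qed simp
        finally show "(\<integral>\<^sup>+ p. (\<Prod>i<n0. ennreal (wt (clip (p i)) (ws ! i))) * ennreal (search_fail (E (concat ws)) (\<alpha> - \<epsilon>) p n0 [] n) \<partial>PiM UNIV (\<lambda>_. \<mu>))
          \<le> (\<Prod>i<n0. \<integral>\<^sup>+ x. ennreal (wt (clip x) (ws ! i)) \<partial>\<mu>) * ennreal Z"
          unfolding Eg .
      qed
      also have "\<dots> \<le> Z + 2 * real Q * exp (- (real n0 * \<kappa>\<^sup>2 / 2))"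
        unfolding Bad_def using mQ n0 by (intro add_left_mono emp_cdf_concentration[OF res]) auto
      also have "\<dots> \<le> 1 / 2 * exp (- ((1 - r) * c * T)) + 1 / 2 * exp (- ((1 - r) * c * T))"
      proof (rule add_mono)
        have "r * \<epsilon>\<^sup>2 * T \<le> r / 2 * c * T"
          using c_lo T r by (intro mult_right_mono) auto
        then have "exp (- (r / 2 * c * T)) \<le> exp (- (r * \<epsilon>\<^sup>2 * T))" by simp
        then have "real N * (real N + 1) * exp (- (r / 2 * c * T)) \<le> real N * (real N + 1) * exp (- (r * \<epsilon>\<^sup>2 * T))"
          by (intro mult_left_mono) auto
        also have "\<dots> \<le> 1 / 2" using elim(2) by (simp add: T_def)
        finally have "real N * (real N + 1) * exp (- (r / 2 * c * T)) * exp (- ((1 - r) * c * T)) \<le> 1 / 2 * exp (- ((1 - r) * c * T))"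
          by (intro mult_right_mono) auto
        moreover have "exp (- ((1 - r / 2) * c * T)) = exp (- (r / 2 * c * T)) * exp (- ((1 - r) * c * T))"
          by (simp add: mult_exp_exp) (simp add: algebra_simps)
        ultimately show "Z \<le> 1 / 2 * exp (- ((1 - r) * c * T))" by (simp add: Z_def mult.assoc)
      next
        have "- (real n0 * \<kappa>\<^sup>2 / 2) \<le> - ((c3 * real N - 1) * (\<kappa>\<^sup>2 / 2))"
          using mult_right_mono[OF n0(2), of "\<kappa>\<^sup>2 / 2"] by simp
        moreover have "(1 - r) * c * T \<le> pi\<^sup>2 / 2 * T"
        proof (rule mult_right_mono)
          have "(1 - r) * c \<le> 1 * c" using r by (intro mult_right_mono) (auto simp: c_eq)
          then show "(1 - r) * c \<le> pi\<^sup>2 / 2" using c_hi by simp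
        qed (rule T)
        ultimately have "exp (- (real n0 * \<kappa>\<^sup>2 / 2)) \<le> exp (- ((c3 * real N - 1) * (\<kappa>\<^sup>2 / 2)) + pi\<^sup>2 / 2 * T - (1 - r) * c * T)"
          by simp
        also have "\<dots> = exp (- ((c3 * real N - 1) * (\<kappa>\<^sup>2 / 2)) + pi\<^sup>2 / 2 * T) * exp (- ((1 - r) * c * T))"
          by (simp add: mult_exp_exp)
        finally have "2 * real Q * exp (- (real n0 * \<kappa>\<^sup>2 / 2)) \<le> 2 * real Q * (exp (- ((c3 * real N - 1) * (\<kappa>\<^sup>2 / 2)) + pi\<^sup>2 / 2 * T) * exp (- ((1 - r) * c * T)))"
          by (intro mult_left_mono) auto
        also have "\<dots> = (2 * real Q * exp (- ((c3 * real N - 1) * (\<kappa>\<^sup>2 / 2)) + pi\<^sup>2 / 2 * T)) * exp (- ((1 - r) * c * T))"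
          by (simp only: mult.assoc)
        also have "\<dots> \<le> 1 / 2 * exp (- ((1 - r) * c * T))"
          using elim(2) by (intro mult_right_mono) (auto simp: T_def)
        finally show "2 * real Q * exp (- (real n0 * \<kappa>\<^sup>2 / 2)) \<le> 1 / 2 * exp (- ((1 - r) * c * T))" .
      qed
      finally show "fail_prob (policy (two_stage m n0 E)) \<mu> N (alpha \<mu> \<eta>1 \<eta>2 - \<epsilon>)
        \<le> exp (- ((1 - r) * cab (alpha \<mu> \<eta>1 \<eta>2) (alpha \<mu> \<eta>1 \<eta>2 - \<epsilon>) * real N / (ln (real N))\<^sup>2))"
        by (simp add: \<alpha>_def[symmetric] c_def[symmetric] T_def)
    qed
  qed
qed

text \<open>Almost surely all means lie in the unit interval. This settles \<alpha> < \<epsilon>,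
  where \<open>rate_term\<close> is infinite without reference to \<open>cab\<close>.\<close>

lemma fail_prob_eq_0:
  assumes res: "reservoir \<mu>" and thr: "b < 0"
  shows "fail_prob A \<mu> N b = 0"
proof -
  interpret P: product_prob_space "\<lambda>_::nat. \<mu>" UNIV
    by (intro product_prob_spaceI reservoir_prob[OF res])
  have "AE x in \<mu>. x \<in> {0..1}"
    by (rule prob_space.AE_prob_1[OF reservoir_prob[OF res] reservoir_unit[OF res]])
  then have "AE p in PiM UNIV (\<lambda>_::nat. \<mu>). p i \<in> {0..1}" for i
    by (intro AE_PiM_component reservoir_prob[OF res]) auto
  then have "AE p in PiM UNIV (\<lambda>_::nat. \<mu>). \<forall>i. p i \<in> {0..1}"
    by (simp add: AE_all_countable)
  then have "AE p in PiM UNIV (\<lambda>_::nat. \<mu>). ennreal (measure_pmf.prob (output_dist A p N) {i. p i < b}) = 0"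
  proof eventually_elim
    case (elim p)
    have "\<not> p i < b" for i using elim[rule_format, of i] thr by simp
    then show ?case by simp
  qed
  then have "(\<integral>\<^sup>+ p. ennreal (measure_pmf.prob (output_dist A p N) {i. p i < b}) \<partial>PiM UNIV (\<lambda>_::nat. \<mu>)) = (\<integral>\<^sup>+ p. 0 \<partial>PiM UNIV (\<lambda>_::nat. \<mu>))"
    by (rule nn_integral_cong_AE)
  then show ?thesis by (simp add: fail_prob_def)
qed

theorem theorem1p9:
  fixes \<eta>1 \<eta>2 \<epsilon> :: real
  assumes "0 \<le> \<eta>2" and "\<eta>2 < \<eta>1" and "\<eta>1 \<le> 1" and "\<epsilon> > 0"
  shows "\<exists>A :: nat \<Rightarrow> algo. \<forall>\<mu> :: nat \<Rightarrow> real measure.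
           (\<forall>N. reservoir (\<mu> N)) \<longrightarrow>
           limsup (\<lambda>N. rate_term (fail_prob (A N) (\<mu> N) N (alpha (\<mu> N) \<eta>1 \<eta>2 - \<epsilon>))
                                  (alpha (\<mu> N) \<eta>1 \<eta>2) (alpha (\<mu> N) \<eta>1 \<eta>2 - \<epsilon>) N) \<ge> 1"
proof -
  define ok where "ok r N A \<longleftrightarrow> (\<forall>\<mu>. reservoir \<mu> \<longrightarrow> 0 \<le> alpha \<mu> \<eta>1 \<eta>2 - \<epsilon> \<longrightarrow>
    fail_prob A \<mu> N (alpha \<mu> \<eta>1 \<eta>2 - \<epsilon>)
      \<le> exp (- ((1 - r) * cab (alpha \<mu> \<eta>1 \<eta>2) (alpha \<mu> \<eta>1 \<eta>2 - \<epsilon>) * real N / (ln (real N))\<^sup>2)))"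
    for r :: real and N :: nat and A :: algo
  \<comment> \<open>The shift by 2 keeps the slack strictly between 0 and 1.\<close>
  define slack where "slack j = 1 / real (j + 2)" for j
  have "eventually (\<lambda>N. (\<exists>A. ok (slack j) N A) \<and> 2 \<le> N) sequentially" for j
    unfolding ok_def
    by (intro eventually_conj eventually_good_algorithm assms eventually_ge_at_top) (auto simp: slack_def)
  then have "\<exists>n0. \<forall>n\<ge>n0. (\<exists>A. ok (slack j) n A) \<and> 2 \<le> n" for j
    unfolding eventually_sequentially .
  then have ex: "\<exists>N>M. (\<exists>A. ok (slack j) N A) \<and> 2 \<le> N" for j M
    by (meson le_SucI less_Suc_eq_le max.cobounded1 max.cobounded2)
  \<comment> \<open>One budget is selected for each slack, in increasing order.\<close>
  obtain f :: "nat \<Rightarrow> nat" where f: "\<And>j. (\<exists>A. ok (slack j) (f j) A) \<and> 2 \<le> f j" "\<And>j. f j < f (Suc j)"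
    using dependent_nat_choice[of "\<lambda>j N. (\<exists>A. ok (slack j) N A) \<and> 2 \<le> N" "\<lambda>j N N'. N < N'"] ex by metis
  have mono: "strict_mono f" using f(2) by (simp add: strict_mono_Suc_iff)
  then have inj: "inj f" by (rule strict_mono_imp_inj_on)
  \<comment> \<open>At budgets outside the range of \<open>f\<close> the choice is arbitrary; the
    limes superior is bounded below along \<open>f\<close>.\<close>
  define A where "A N = (SOME A. ok (slack (inv f N)) N A)" for N
  have A: "ok (slack j) (f j) (A (f j))" for j
    unfolding A_def inv_f_f[OF inj] using f(1)[of j] by (metis someI)
  show ?thesis
  proof (intro exI[of _ A] allI impI)
    fix \<mu> :: "nat \<Rightarrow> real measure" assume res: "\<forall>N. reservoir (\<mu> N)"
    let ?X = "\<lambda>N. rate_term (fail_prob (A N) (\<mu> N) N (alpha (\<mu> N) \<eta>1 \<eta>2 - \<epsilon>))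
                                  (alpha (\<mu> N) \<eta>1 \<eta>2) (alpha (\<mu> N) \<eta>1 \<eta>2 - \<epsilon>) N"
    have X: "ereal (1 - slack j) \<le> ?X (f j)" for j
    proof -
      define N where "N = f j"
      define \<alpha> where "\<alpha> = alpha (\<mu> N) \<eta>1 \<eta>2"
      define P where "P = fail_prob (A N) (\<mu> N) N (\<alpha> - \<epsilon>)"
      define c where "c = cab \<alpha> (\<alpha> - \<epsilon>)"
      have r: "reservoir (\<mu> N)" using res by simp
      have N: "2 \<le> N" using f(1) by (simp add: N_def)
      have "ereal (1 - slack j) \<le> rate_term P \<alpha> (\<alpha> - \<epsilon>) N"
      proof (cases "P = 0")
        case True then show ?thesis by (simp add: rate_term_def)
      next
        case False
        \<comment> \<open>A positive failure probability forces \<alpha> \<ge> \<epsilon>, so both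
          angles are genuine and \<open>c\<close> is positive.\<close>
        have "0 \<le> \<alpha> - \<epsilon>"
          using fail_prob_eq_0[OF r, of "\<alpha> - \<epsilon>" "A N" N] False unfolding P_def by fastforce
        moreover have "\<alpha> \<le> 1" unfolding \<alpha>_def by (rule alpha_le_1[OF r assms(1,2)])
        ultimately have "2 * \<epsilon> \<le> ang \<alpha> - ang (\<alpha> - \<epsilon>)"
          using ang_diff_lower(1)[of "\<alpha> - \<epsilon>" \<alpha>] assms(4) by simp
        then have "0 < (ang \<alpha> - ang (\<alpha> - \<epsilon>))\<^sup>2" using assms(4) by (intro zero_less_power) linarith
        then have c: "0 < c" by (simp add: c_def cab_def)
        have L: "0 < (ln (real N))\<^sup>2" using N by simp
        have P0: "0 < P" using False by (simp add: P_def fail_prob_def less_le)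
        have "P \<le> exp (- ((1 - slack j) * c * real N / (ln (real N))\<^sup>2))"
          using A[of j] r \<open>0 \<le> \<alpha> - \<epsilon>\<close> unfolding ok_def P_def \<alpha>_def c_def N_def by blast
        then have "ln P \<le> ln (exp (- ((1 - slack j) * c * real N / (ln (real N))\<^sup>2)))"
          using P0 by (subst ln_le_cancel_iff) auto
        then have "(1 - slack j) * c * real N / (ln (real N))\<^sup>2 \<le> - ln P" by simp
        then have "(1 - slack j) * c * real N \<le> - ln P * (ln (real N))\<^sup>2"
          using L by (subst (asm) pos_divide_le_eq) auto
        then have "1 - slack j \<le> - ln P * (ln (real N))\<^sup>2 / (c * real N)"
          using c N by (subst pos_le_divide_eq) (auto simp: mult.assoc)
        then show ?thesis using False by (simp add: rate_term_def c_def)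
      qed
      then show ?thesis by (simp add: P_def \<alpha>_def N_def)
    qed
    have "(\<lambda>j. 1 - slack j) \<longlonglongrightarrow> 1" unfolding slack_def by real_asymp
    then have "(\<lambda>j. ereal (1 - slack j)) \<longlonglongrightarrow> ereal 1"
      by (rule tendsto_ereal)
    then have "limsup (\<lambda>j. ereal (1 - slack j)) = 1"
      unfolding one_ereal_def by (rule lim_imp_Limsup[OF sequentially_bot])
    moreover have "limsup (\<lambda>j. ereal (1 - slack j)) \<le> limsup (?X \<circ> f)"
      using X by (intro Limsup_mono) (auto simp: o_def)
    moreover have "limsup (?X \<circ> f) \<le> limsup ?X" by (rule limsup_subseq_mono[OF mono])
    ultimately show "limsup ?X \<ge> 1" by simp
  qed
qed

end
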